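(* Let $k$ be a positive integer. The map $$\Phi_C:\mathbf{A}_{\overline k}^{k}\to\bigcup_{\ell(\lambda)\le k}\mathrm{KT}_k(\lambda)\times\mathrm{SSOT}_k(\lambda),\qquad w\mapsto (P_C(w),Q_C(w)),$$ where the union is over all partitions $\lambda$ with at most $k$ rows, is a bijection.
   Context: Alphabet and tableaux. $[k]=\{1,\dots,k\}$ and $[\overline{k}]=\{1,\overline1,\dots,k,\overline k\}$ with the total order $1<\overline1<2<\overline2<\cdots<k<\overline k$. Partitions are identified with Young diagrams in English notation; $\ell(\lambda)$ is the number of rows of $\lambda$. A King tableau of shape $\lambda$ is a filling of $\lambda$ by elements of $[\overline k]$ such that entries weakly increase along rows, strictly increase down columns, and all entries in row $i$ are $\ge i$ for every $i$. $\mathrm{KT}_k(\lambda)$ is the set of these. Berele insertion $T\leftarrow x$ ($T$ a King tableau, $x\in[\overline k]$). Start as in Schensted row insertion: insert $x$ into row 1; inserting a letter $a$ into a row replaces (bumps) the leftmost entry that is strictly larger than $a$, and the bumped entry is then inserted into the next row; if no entry of the row is larger than $a$, then $a$ is put at the end of the row and the procedure stops. Exception: if at some moment the letter $i$ is to be inserted into row $i$ and row $i$ contains at least one $\overline i$, then instead: replace the first $\overline i$ of row $i$ by $i$, replace the first $i$ of row $i$ by an empty box, and play jeu de taquin with this empty box: repeatedly, if the empty box has a box with entry $b$ below it and/or a box with entry $r$ to its right, slide $b$ up when only $b$ exists or when both exist and $b\le r$, and slide $r$ left when only $r$ exists or when both exist and $b>r$; once the empty box is at a corner of the shape, delete it and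 stop. The result is again a King tableau, and each insertion changes the shape by adding or deleting exactly one box. Arrays. $\mathbf{A}_{\overline k}^{k}$ is the set of all two-line arrays $w=\begin{pmatrix}u_1&\cdots&u_n\\ v_1&\cdots&v_n\end{pmatrix}$ (of any length $n\ge0$) with $u_j\in[k]$, $v_j\in[\overline k]$, $u_j\le u_{j+1}$, and $u_j=u_{j+1}\Rightarrow v_j\le v_{j+1}$. SSOT. A skew shape is a horizontal strip if it contains at most one box in each column. A $k$-semistandard oscillating tableau ($k$-SSOT, of the second kind) of final shape $\lambda$ is a finite sequence of partitions $S=(S^{1},S'^{2},S^{2},S'^{3},\dots,S'^{k},S^{k})$ such that, with $S'^{1}=\emptyset$: $S^{i}\supseteq S'^{i+1}$ and $S^i\setminus S'^{i+1}$ is a (possibly empty) horizontal strip for $1\le i\le k-1$; $S'^{i}\subseteq S^{i}$ and $S^i\setminus S'^i$ is a (possibly empty) horizontal strip for $1\le i\le k$; and $S^k=\lambda$. $\mathrm{SSOT}_k(\lambda)$ is the set of these. Passing from $S'^{i}$ to $S^{i}$ (adding boxes) and, for $i\ge2$, from $S^{i-1}$ to $S'^{i}$ (deleting boxes) are together called step $i$. An SSOT $S$ is identified with the multiset-valued tableau in which the number $i$ is recorded at a box position once for each time that box is added or deleted in step $i$. The map. For $w=\begin{pmatrix}u_1&\cdots&u_n\\ v_1&\cdots&v_n\end{pmatrix}\in\mathbf{A}_{\overline k}^{k}$, $P_0(w)=\emptyset$, $P_j(w)=P_{j-1}(w)\leftarrow v_j$ (Berele insertion), and $P_C(w)=P_n(w)$.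 $Q_0(w)=\emptyset$ and $Q_j(w)$ is the multiset-valued tableau obtained from $Q_{j-1}(w)$ by placing $u_j$ into the position of the box that was added or deleted in the insertion $P_{j-1}(w)\leftarrow v_j$; $Q_C(w)=Q_n(w)$, which is (the multiset-valued tableau encoding) a $k$-SSOT whose final shape is the shape of $P_C(w)$. Equivalently, with $\lambda_j$ the shape of $P_j(w)$, the SSOT $Q_C(w)$ has $S^i=\lambda_{r}$ where $r$ is the number of $j$ with $u_j\le i$, and $S'^{i}$ is the shape reached from $S^{i-1}$ after the box-deleting insertions among those with $u_j=i$ (these precede the box-adding ones). *)

theory Defs
  imports Main "HOL-Library.Multiset"
begin

datatype letter = Plain nat | Barred nat

fun letter_rank :: "letter \<Rightarrow> nat" where
  "letter_rank (Plain i) = 2 * i"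
| "letter_rank (Barred i) = 2 * i + 1"

lemma letter_rank_inject: "letter_rank x = letter_rank y \<longleftrightarrow> x = y"
  by (cases x; cases y) (auto, presburger+)

(* The order 1 < bar 1 < 2 < bar 2 < ... *)
instantiation letter :: linorder
begin

definition less_eq_letter :: "letter \<Rightarrow> letter \<Rightarrow> bool" where
  "x \<le> y \<longleftrightarrow> letter_rank x \<le> letter_rank y"

definition less_letter :: "letter \<Rightarrow> letter \<Rightarrow> bool" where
  "x < y \<longleftrightarrow> letter_rank x < letter_rank y"

instance
  by standard (auto simp: less_eq_letter_def less_letter_def letter_rank_inject)

end

definition letters :: "nat \<Rightarrow> letter set" where
  "letters k = Plain ` {1..k} \<union> Barred ` {1..k}"

definition is_partition :: "nat list \<Rightarrow> bool" where
  "is_partition \<mu> \<longleftrightarrow> sorted_wrt (\<ge>) \<mu> \<and> 0 \<notin> set \<mu>"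

(* Boxes are (row, column), both counted from 0. *)
definition diagram :: "nat list \<Rightarrow> (nat \<times> nat) set" where
  "diagram \<mu> = {(r, c). r < length \<mu> \<and> c < \<mu> ! r}"

definition horizontal_strip :: "(nat \<times> nat) set \<Rightarrow> bool" where
  "horizontal_strip D \<longleftrightarrow> (\<forall>r r' c. (r, c) \<in> D \<longrightarrow> (r', c) \<in> D \<longrightarrow> r = r')"

(* A filling is the list of its rows; no row is empty. *)
type_synonym tableau = "letter list list"

definition shape :: "tableau \<Rightarrow> nat list" where
  "shape T = map length T"

(* List index r is row r + 1 of the tableau, whence the bound Plain (Suc r). *)
definition KT :: "nat \<Rightarrow> nat list \<Rightarrow> tableau set" where
  "KT k \<mu> = {T. shape T = \<mu>
     \<and> (\<forall>R \<in> set T. set R \<subseteq> letters k)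
     \<and> (\<forall>R \<in> set T. sorted R)
     \<and> (\<forall>r c. Suc r < length T \<longrightarrow> c < length (T ! Suc r) \<longrightarrow> T ! r ! c < T ! Suc r ! c)
     \<and> (\<forall>r < length T. \<forall>x \<in> set (T ! r). Plain (Suc r) \<le> x)}"

(* Jeu de taquin with the empty box at (r, c).  The entry stored at the empty box is
   irrelevant.  When no box lies below or to the right, the empty box ends its row and
   is deleted, together with the row if that becomes empty. *)
function jeu_de_taquin :: "nat \<Rightarrow> nat \<Rightarrow> tableau \<Rightarrow> tableau" where
  "jeu_de_taquin r c T =
    (let has_below = (Suc r < length T \<and> c < length (T ! Suc r));
         has_right = (r < length T \<and> Suc c < length (T ! r))
     in if has_below \<and> (has_right \<longrightarrow> T ! Suc r ! c \<le> T ! r ! Suc c)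
        then jeu_de_taquin (Suc r) c (T[r := (T ! r)[c := T ! Suc r ! c]])
        else if has_right
        then jeu_de_taquin r (Suc c) (T[r := (T ! r)[c := T ! r ! Suc c]])
        else filter (\<lambda>R. R \<noteq> []) (T[r := butlast (T ! r)]))"
  by pat_completeness auto
termination
  by (relation "measures [\<lambda>(r, c, T). length T - r, \<lambda>(r, c, T). length (T ! r) - c]") auto

declare jeu_de_taquin.simps [simp del]

definition first_index :: "('a \<Rightarrow> bool) \<Rightarrow> 'a list \<Rightarrow> nat" where
  "first_index p xs = (LEAST j. j < length xs \<and> p (xs ! j))"

(* insert_from i T x inserts x into row i, where T consists of the rows i, i+1, ...
   of the tableau; the earlier rows play no further role. *)
fun insert_from :: "nat \<Rightarrow> tableau \<Rightarrow> letter \<Rightarrow> tableau" where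
  "insert_from i [] x = [[x]]"
| "insert_from i (R # Rs) x =
    (if x = Plain i \<and> Barred i \<in> set R then
       (let R' = R[first_index (\<lambda>y. y = Barred i) R := Plain i]
        in jeu_de_taquin 0 (first_index (\<lambda>y. y = Plain i) R') (R' # Rs))
     else if \<exists>y \<in> set R. x < y then
       (let j = first_index (\<lambda>y. x < y) R
        in R[j := x] # insert_from (Suc i) Rs (R ! j))
     else (R @ [x]) # Rs)"

definition berele_insert :: "tableau \<Rightarrow> letter \<Rightarrow> tableau" where
  "berele_insert T x = insert_from 1 T x"

(* A two-line array is the list of its columns (u, v). *)
type_synonym two_line = "(nat \<times> letter) list"

definition arrays :: "nat \<Rightarrow> two_line set" where
  "arrays k = {w. (\<forall>(u, v) \<in> set w. u \<in> {1..k} \<and> v \<in> letters k)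
     \<and> (\<forall>j. Suc j < length w \<longrightarrow>
           fst (w ! j) \<le> fst (w ! Suc j)
         \<and> (fst (w ! j) = fst (w ! Suc j) \<longrightarrow> snd (w ! j) \<le> snd (w ! Suc j)))}"

(* An SSOT is the list [S^1, S'^2, S^2, ..., S'^k, S^k]; the following give S^i and S'^i,
   with S^0 and S'^1 empty. *)
definition ssot_S :: "nat list list \<Rightarrow> nat \<Rightarrow> nat list" where
  "ssot_S S i = (if i = 0 then [] else S ! (2 * i - 2))"

definition ssot_S' :: "nat list list \<Rightarrow> nat \<Rightarrow> nat list" where
  "ssot_S' S i = (if i \<le> 1 then [] else S ! (2 * i - 3))"

definition SSOT :: "nat \<Rightarrow> nat list \<Rightarrow> nat list list set" where
  "SSOT k \<mu> = {S. length S = 2 * k - 1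
     \<and> (\<forall>\<nu> \<in> set S. is_partition \<nu>)
     \<and> (\<forall>i \<in> {1..<k}. diagram (ssot_S' S (Suc i)) \<subseteq> diagram (ssot_S S i)
          \<and> horizontal_strip (diagram (ssot_S S i) - diagram (ssot_S' S (Suc i))))
     \<and> (\<forall>i \<in> {1..k}. diagram (ssot_S' S i) \<subseteq> diagram (ssot_S S i)
          \<and> horizontal_strip (diagram (ssot_S S i) - diagram (ssot_S' S i)))
     \<and> ssot_S S k = \<mu>}"

(* Multiset-valued tableaux; positions carrying no number have the value {#}. *)
type_synonym mtableau = "nat \<times> nat \<Rightarrow> nat multiset"

(* The multiset-valued tableau with which an SSOT is identified.  No box is deleted in
   step 1, since S^0 is empty. *)
definition ssot_tableau :: "nat \<Rightarrow> nat list list \<Rightarrow> mtableau" where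
  "ssot_tableau k S b = (\<Sum>i = 1..k.
     (if b \<in> diagram (ssot_S S (i - 1)) - diagram (ssot_S' S i) then {#i#} else {#})
   + (if b \<in> diagram (ssot_S S i) - diagram (ssot_S' S i) then {#i#} else {#}))"

primrec P_seq :: "two_line \<Rightarrow> nat \<Rightarrow> tableau" where
  "P_seq w 0 = []"
| "P_seq w (Suc j) = berele_insert (P_seq w j) (snd (w ! j))"

(* An insertion adds or deletes exactly one box, so the set of changed boxes is a singleton. *)
definition changed_boxes :: "tableau \<Rightarrow> tableau \<Rightarrow> (nat \<times> nat) set" where
  "changed_boxes T T' =
     (diagram (shape T) - diagram (shape T')) \<union> (diagram (shape T') - diagram (shape T))"

primrec Q_seq :: "two_line \<Rightarrow> nat \<Rightarrow> mtableau" where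
  "Q_seq w 0 = (\<lambda>b. {#})"
| "Q_seq w (Suc j) = (\<lambda>b. if b \<in> changed_boxes (P_seq w j) (P_seq w (Suc j))
      then add_mset (fst (w ! j)) (Q_seq w j b) else Q_seq w j b)"

definition P_C :: "two_line \<Rightarrow> tableau" where
  "P_C w = P_seq w (length w)"

definition Q_C :: "two_line \<Rightarrow> mtableau" where
  "Q_C w = Q_seq w (length w)"

definition Phi_C :: "two_line \<Rightarrow> tableau \<times> mtableau" where
  "Phi_C w = (P_C w, Q_C w)"

lemma diagram_inject:
  assumes "is_partition \<mu>" "is_partition \<nu>" "diagram \<mu> = diagram \<nu>"
  shows "\<mu> = \<nu>"
proof (rule nth_equalityI)
  have *: "r < length \<nu> \<longleftrightarrow> (r, 0) \<in> diagram \<nu>" if "is_partition \<nu>" for \<nu> r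
    using that by (force simp: diagram_def is_partition_def in_set_conv_nth)
  show len: "length \<mu> = length \<nu>"
    using *[OF assms(1), of "length \<nu>"] *[OF assms(2), of "length \<mu>"]
      *[OF assms(1), of "length \<mu>"] *[OF assms(2), of "length \<nu>"] assms(3) by simp
  fix r assume r: "r < length \<mu>"
  have "(r, c) \<in> diagram \<mu> \<longleftrightarrow> (r, c) \<in> diagram \<nu>" for c
    using assms(3) by simp
  then have "c < \<mu> ! r \<longleftrightarrow> c < \<nu> ! r" for c
    using r len by (simp add: diagram_def)
  from this[of "\<mu> ! r"] this[of "\<nu> ! r"] show "\<mu> ! r = \<nu> ! r"
    by simp
qed

lemma count_ssot_tableau:
  assumes "i \<in> {1..k}"
  shows "count (ssot_tableau k S b) i =
    of_bool (b \<in> diagram (ssot_S S (i - 1)) - diagram (ssot_S' S i))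
  + of_bool (b \<in> diagram (ssot_S S i) - diagram (ssot_S' S i))"
proof -
  have "count (ssot_tableau k S b) i = (\<Sum>j = 1..k. if j = i then
    of_bool (b \<in> diagram (ssot_S S (i - 1)) - diagram (ssot_S' S i))
  + of_bool (b \<in> diagram (ssot_S S i) - diagram (ssot_S' S i)) else 0)"
    unfolding ssot_tableau_def count_sum by (rule sum.cong) auto
  also have "\<dots> = of_bool (b \<in> diagram (ssot_S S (i - 1)) - diagram (ssot_S' S i))
  + of_bool (b \<in> diagram (ssot_S S i) - diagram (ssot_S' S i))"
    using assms by (subst sum.delta) auto
  finally show ?thesis .
qed

(* The identification of SSOTs with multiset-valued tableaux is injective. *)
lemma inj_on_ssot_tableau: "inj_on (ssot_tableau k) (\<Union>\<mu>. SSOT k \<mu>)"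
proof (rule inj_onI)
  fix S U assume "S \<in> (\<Union>\<mu>. SSOT k \<mu>)" "U \<in> (\<Union>\<mu>. SSOT k \<mu>)"
    and eq: "ssot_tableau k S = ssot_tableau k U"
  then obtain \<mu> \<nu> where S: "S \<in> SSOT k \<mu>" and U: "U \<in> SSOT k \<nu>" by auto
  have sub: "diagram (ssot_S' V i) \<subseteq> diagram (ssot_S V (i - 1))"
    "diagram (ssot_S' V i) \<subseteq> diagram (ssot_S V i)"
    if V: "V \<in> SSOT k \<nu>" and i: "i \<in> {1..k}" for V \<nu> i
  proof -
    show "diagram (ssot_S' V i) \<subseteq> diagram (ssot_S V i)"
      using V i by (auto simp: SSOT_def)
    show "diagram (ssot_S' V i) \<subseteq> diagram (ssot_S V (i - 1))"
    proof (cases "i = 1")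
      case True
      then show ?thesis by (simp add: ssot_S'_def diagram_def)
    next
      case False
      then obtain j where j: "i = Suc j" "j \<in> {1..<k}" using i by (cases i) auto
      have "\<forall>i \<in> {1..<k}. diagram (ssot_S' V (Suc i)) \<subseteq> diagram (ssot_S V i)"
        using V by (simp add: SSOT_def)
      then show ?thesis using j by simp
    qed
  qed
  have step: "i \<le> k \<Longrightarrow> diagram (ssot_S S i) = diagram (ssot_S U i)
    \<and> diagram (ssot_S' S i) = diagram (ssot_S' U i)" for i
  proof (induction i)
    case 0
    then show ?case by (simp add: ssot_S_def ssot_S'_def)
  next
    case (Suc i)
    then have i: "Suc i \<in> {1..k}" and IH: "diagram (ssot_S S i) = diagram (ssot_S U i)" by auto
    have "(b \<in> diagram (ssot_S S (Suc i)) \<longleftrightarrow> b \<in> diagram (ssot_S U (Suc i)))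
      \<and> (b \<in> diagram (ssot_S' S (Suc i)) \<longleftrightarrow> b \<in> diagram (ssot_S' U (Suc i)))" for b
    proof -
      have "b \<in> diagram (ssot_S' S (Suc i)) \<Longrightarrow> b \<in> diagram (ssot_S S i) \<and> b \<in> diagram (ssot_S S (Suc i))"
        and "b \<in> diagram (ssot_S' U (Suc i)) \<Longrightarrow> b \<in> diagram (ssot_S U i) \<and> b \<in> diagram (ssot_S U (Suc i))"
        using sub[OF S i] sub[OF U i] by auto
      then show ?thesis
        using count_ssot_tableau[OF i, of S b] count_ssot_tableau[OF i, of U b]
        unfolding eq IH diff_Suc_1 Diff_iff
        by (cases "b \<in> diagram (ssot_S U i)"; cases "b \<in> diagram (ssot_S' S (Suc i))";
            cases "b \<in> diagram (ssot_S' U (Suc i))"; cases "b \<in> diagram (ssot_S S (Suc i))";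
            cases "b \<in> diagram (ssot_S U (Suc i))"; simp)
    qed
    then show ?case by blast
  qed
  have len: "length S = 2 * k - 1" "length U = 2 * k - 1"
    using S U by (auto simp: SSOT_def)
  show "S = U"
  proof (rule nth_equalityI)
    show "length S = length U" using len by simp
    fix n assume n: "n < length S"
    have "diagram (S ! n) = diagram (U ! n)"
    proof (cases "even n")
      case True
      then obtain m where "n = 2 * m" by auto
      then show ?thesis using step[of "Suc m"] n len by (simp add: ssot_S_def)
    next
      case False
      then obtain m where m: "n = 2 * m + 1" by (auto elim: oddE)
      then have "2 * (m + 2) - 3 = n" by simp
      then show ?thesis using step[of "m + 2"] n len m by (simp add: ssot_S'_def)
    qed
    moreover have "is_partition (S ! n)" "is_partition (U ! n)"
      using S U n len by (auto simp: SSOT_def)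
    ultimately show "S ! n = U ! n" using diagram_inject by blast
  qed
qed

end

theory Submission imports Defs
begin

text \<open>
  A King tableau is determined by the numbers \<open>f r m\<close> of entries of row \<open>r\<close> whose rank is at most
  \<open>m\<close>, that is, by the chain of the shapes of its restrictions to the letters of rank at most \<open>m\<close>.
  (Rows are counted from 0.) Along this chain a Berele insertion is a one-box change that propagates
  from level \<open>m\<close> to level \<open>m + 1\<close> by a local rule: nothing happens below the inserted letter, then the
  chain gains a box
  whose row grows with each bump, and a bump that would move the letter \<open>Barred (r + 1)\<close> out of row
  \<open>r\<close> (which would violate the King condition) makes the chain lose a box from that level on; jeu de
  taquin transports the loss. The local rules can be run backwards from the last level,
  which inverts a single insertion. They also allow two successive insertions to be compared level by
  level: inserting \<open>x\<close> and then \<open>y\<close> yields deletions in rows of weakly increasing index followed by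
  additions in rows of weakly decreasing index if and only if \<open>x \<le> y\<close>. Such row sequences are exactly
  the ways to remove and then to add a horizontal strip one box at a time.
\<close>

section \<open>Growth of a King tableau by one insertion\<close>

text \<open>Levels are a better coordinate than rows because bumping and jeu de taquin, which look
  quite different row by row, both meet the letters in weakly increasing order: the bumped letters
  increase, and the entries that slide into the hole increase weakly. A cancellation in the middle
  of an insertion then becomes a mere change of state. The price is that a state on one level does
  not tell how it arose, so the local rules come with side conditions on neighbouring levels. They
  are collected in \<open>admissible\<close> for the forward run and in \<open>coadmissible\<close>
  for the backward run, and they are tightest at the levels \<open>2 * r + 2\<close> and
  \<open>2 * r + 3\<close>, where \<open>Plain (Suc r)\<close> and \<open>Barred (Suc r)\<close>
  become available. To undo an insertion one needs, besides the new tableau, only the last state,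
  that is, the row of the changed box and whether it was added or deleted; the recording tableau
  reveals this for the last column of an array. Both directions of the comparison with
  \<open>x \<le> y\<close> are used: one makes the recorded changes form horizontal strips, the
  other makes the array that is read off from given strips sorted.\<close>

text \<open>
  The state at level \<open>m\<close> says how the insertion changes the shape formed by the letters of rank at
  most \<open>m\<close>. \<open>Pending r\<close> is the level just before a cancellation in row \<open>r\<close>: the gain of a box is
  already taken back, but no box is lost yet.
\<close>
datatype state = Unchanged | Added nat | Pending nat | Deleted nat

text \<open>The interlacing shifted by one level is column strictness: above an entry of rank
  \<open>Suc m\<close> stands one of rank at most \<open>m\<close>. Row \<open>r\<close> starts with
  \<open>Plain (Suc r)\<close>, of rank \<open>2 * r + 2\<close>, and \<open>2 * k + 1\<close> is
  the rank of the largest letter \<open>Barred k\<close>. These number arrays are the symplectic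
  analogue of Gelfand-Tsetlin patterns.\<close>

definition king :: "nat \<Rightarrow> (nat \<Rightarrow> nat \<Rightarrow> nat) \<Rightarrow> bool" where
  "king k f \<longleftrightarrow> (\<forall>r m. f r m \<le> f r (Suc m)) \<and> (\<forall>r m. f (Suc r) (Suc m) \<le> f r m)
     \<and> (\<forall>r m. m < 2 * r + 2 \<longrightarrow> f r m = 0) \<and> (\<forall>r m. 2 * k + 1 \<le> m \<longrightarrow> f r m = f r (2 * k + 1))"

lemma kingD:
  assumes "king k f"
  shows "f r m \<le> f r (Suc m)" "f (Suc r) (Suc m) \<le> f r m"
    "m < 2 * r + 2 \<Longrightarrow> f r m = 0" "2 * k + 1 \<le> m \<Longrightarrow> f r m = f r (2 * k + 1)"
    "f (Suc r) m \<le> f r m"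
proof -
  show *: "f r m \<le> f r (Suc m)" "f (Suc r) (Suc m) \<le> f r m" for r m
    using assms unfolding king_def by auto
  show "m < 2 * r + 2 \<Longrightarrow> f r m = 0" "2 * k + 1 \<le> m \<Longrightarrow> f r m = f r (2 * k + 1)"
    using assms unfolding king_def by blast+
  show "f (Suc r) m \<le> f r m"
    using *(1)[of "Suc r" m] *(2)[of r m] by simp
qed

text \<open>
  A letter of rank \<open>m\<close> arrives in row \<open>r\<close>. The rank \<open>2 * r + 2\<close> belongs to \<open>Plain (Suc r)\<close>, and the
  inequality says that row \<open>r\<close> contains \<open>Barred (Suc r)\<close>.
\<close>
definition enter :: "(nat \<Rightarrow> nat \<Rightarrow> nat) \<Rightarrow> nat \<Rightarrow> nat \<Rightarrow> state" where
  "enter f r m = (if m = 2 * r + 2 \<and> f r m < f r (Suc m) then Pending r else Added r)"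

text \<open>If \<open>f r m < f r (Suc m)\<close>, row \<open>r\<close> contains a letter of rank
  \<open>Suc m\<close>; the first of these is bumped and reaches the next row on level
  \<open>Suc m\<close>. In state \<open>Deleted r\<close> the hole is the last box of row
  \<open>r\<close> on level \<open>m\<close>, and \<open>f (Suc r) (Suc m) = f r m\<close> says that
  the entry below it has rank \<open>Suc m\<close>. Ties favour the entry below, so row
  \<open>r\<close> itself is not consulted.\<close>

fun advance :: "(nat \<Rightarrow> nat \<Rightarrow> nat) \<Rightarrow> nat \<Rightarrow> state \<Rightarrow> state" where
  "advance f m Unchanged = Unchanged"
| "advance f m (Added r) = (if f r m < f r (Suc m) then enter f (Suc r) (Suc m) else Added r)"
| "advance f m (Pending r) = Deleted r"
| "advance f m (Deleted r) = (if f (Suc r) (Suc m) = f r m then Deleted (Suc r) else Deleted r)"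

primrec trace :: "(nat \<Rightarrow> nat \<Rightarrow> nat) \<Rightarrow> nat \<Rightarrow> nat \<Rightarrow> state" where
  "trace f x 0 = Unchanged"
| "trace f x (Suc m) = (if Suc m = x then enter f 0 x else advance f m (trace f x m))"

fun shift :: "state \<Rightarrow> (nat \<Rightarrow> nat) \<Rightarrow> nat \<Rightarrow> nat" where
  "shift (Added r) g = g(r := Suc (g r))"
| "shift (Deleted r) g = g(r := g r - 1)"
| "shift _ g = g"

definition grow :: "(nat \<Rightarrow> nat \<Rightarrow> nat) \<Rightarrow> nat \<Rightarrow> nat \<Rightarrow> nat \<Rightarrow> nat" where
  "grow f x r m = shift (trace f x m) (\<lambda>r. f r m) r"

lemma advance_Unchanged: "advance f m s = Unchanged \<longleftrightarrow> s = Unchanged"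
  by (cases s) (auto simp: enter_def)

lemma trace_Unchanged: "2 \<le> x \<Longrightarrow> trace f x m = Unchanged \<longleftrightarrow> m < x"
proof (induction m)
  case (Suc m)
  then show ?case
    by (cases "Suc m = x") (auto simp: enter_def advance_Unchanged split: if_splits)
qed simp

text \<open>Here \<open>s\<close> is the state at level \<open>m - 1\<close>.\<close>
fun admissible :: "(nat \<Rightarrow> nat \<Rightarrow> nat) \<Rightarrow> nat \<Rightarrow> state \<Rightarrow> state \<Rightarrow> bool" where
  "admissible f m s Unchanged \<longleftrightarrow> True"
| "admissible f m s (Added r) \<longleftrightarrow> 2 * r + 2 \<le> m \<and> (m = 2 * r + 2 \<longrightarrow> f r (Suc m) = f r m)
      \<and> (\<forall>q. r = Suc q \<longrightarrow> f r m < f q m)"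
| "admissible f m s (Pending r) \<longleftrightarrow> m = 2 * r + 2 \<and> f r m < f r (Suc m)
      \<and> (\<forall>q. r = Suc q \<longrightarrow> s = Added q)"
| "admissible f m s (Deleted r) \<longleftrightarrow> 2 * r + 2 \<le> m \<and> 3 \<le> m \<and> f (Suc r) m < f r m
      \<and> (m = 2 * r + 2 \<longrightarrow> (\<exists>q. r = Suc q \<and> f r m = f q (m - 1) \<and> s = Deleted q))"

text \<open>The point is that no bump leaves row \<open>r\<close> at level \<open>2 * r + 2\<close>:
  a letter staying there as \<open>Added r\<close> has met no \<open>Barred (Suc r)\<close>. Hence a
  bumped letter has rank at least \<open>2 * r + 4\<close> and respects the King bound of the next
  row.\<close>

lemma advance_admissible:
  assumes f: "king k f" and adm: "admissible f m s' s"
  shows "admissible f (Suc m) s (advance f m s)"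
proof (cases s)
  case (Added r)
  note k = kingD[OF f]
  have i1: "2 * r + 2 \<le> m" and i2: "m = 2 * r + 2 \<longrightarrow> f r (Suc m) = f r m"
    and i3: "\<forall>q. r = Suc q \<longrightarrow> f r m < f q m" using adm Added by auto
  show ?thesis
  proof (cases "f r m < f r (Suc m)")
    case True
    with i1 i2 have "2 * r + 3 \<le> m" by linarith
    moreover have "f (Suc r) (Suc m) < f r (Suc m)" using True k(2)[of r m] by linarith
    moreover have "f (Suc r) (Suc m) \<le> f (Suc r) (Suc (Suc m))" by (rule k(1))
    ultimately show ?thesis using True unfolding Added by (cases "m = 2 * r + 3") (auto simp: enter_def)
  next
    case False
    then have "f r (Suc m) = f r m" using k(1)[of r m] by linarith
    moreover from this have "\<forall>q. r = Suc q \<longrightarrow> f r (Suc m) < f q (Suc m)"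
      using i3 k(1)[THEN [2] less_le_trans] by auto
    ultimately show ?thesis using i1 False unfolding Added by simp
  qed
next
  case (Pending r)
  then have "m = 2 * r + 2" "f r m < f r (Suc m)" using adm by auto
  with kingD(3)[OF f, of "Suc m" "Suc r"] show ?thesis unfolding Pending by simp
next
  case (Deleted r)
  note k = kingD[OF f]
  have i: "2 * r + 2 \<le> m" "3 \<le> m" "f (Suc r) m < f r m" using adm Deleted by auto
  show ?thesis
  proof (cases "f (Suc r) (Suc m) = f r m")
    case True
    have "f (Suc (Suc r)) (Suc m) < f (Suc r) (Suc m)"
      using k(2)[of "Suc r" m] True i by linarith
    moreover have "2 * r + 4 \<le> Suc m"
      using i True k(3)[of "Suc m" "Suc r"] by (cases "2 * r + 4 \<le> Suc m") auto
    ultimately show ?thesis using True i unfolding Deleted by auto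
  next
    case False
    then have "f (Suc r) (Suc m) < f r (Suc m)" using k(1,2)[of r m] by linarith
    then show ?thesis using False i unfolding Deleted by simp
  qed
qed simp

lemma trace_admissible:
  assumes f: "king k f" and x: "2 \<le> x"
  shows "admissible f m (trace f x (m - 1)) (trace f x m)"
proof (induction m)
  case (Suc m)
  show ?case
  proof (cases "Suc m = x")
    case True
    moreover have "f 0 x \<le> f 0 (Suc x)" by (rule kingD(1)[OF f])
    ultimately show ?thesis using x by (auto simp: enter_def)
  next
    case False
    then show ?thesis using advance_admissible[OF f Suc] by simp
  qed
qed simp

text \<open>All pairs of consecutive states, each with the inequalities on which the later
  comparisons rest. Exact levels are given by bounds such as \<open>m \<le> 1\<close> or
  \<open>m \<le> 2 * r + 3\<close>, so that \<open>m\<close> is not substituted away when two such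
  case analyses are combined.\<close>

lemma trace_cases:
  assumes f: "king k f" and x: "2 \<le> x"
  obtains
    (wait) "trace f x m = Unchanged" "trace f x (Suc m) = Unchanged" "Suc m \<noteq> x"
  | (start_add) "trace f x m = Unchanged" "trace f x (Suc m) = Added 0" "x = Suc m"
      "m \<le> 1 \<longrightarrow> f 0 (Suc (Suc m)) = f 0 (Suc m)"
  | (start_pend) "trace f x m = Unchanged" "trace f x (Suc m) = Pending 0" "x = Suc m" "m \<le> 1"
      "f 0 (Suc m) < f 0 (Suc (Suc m))"
  | (keep_add) r where "trace f x m = Added r" "trace f x (Suc m) = Added r"
      "f r (Suc m) = f r m" "2 * r + 2 \<le> m" "\<forall>q. r = Suc q \<longrightarrow> f r m < f q m"
  | (bump) r where "trace f x m = Added r" "trace f x (Suc m) = Added (Suc r)"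
      "f r m < f r (Suc m)" "2 * r + 3 \<le> m" "\<forall>q. r = Suc q \<longrightarrow> f r m < f q m"
      "m \<le> 2 * r + 3 \<longrightarrow> f (Suc r) (Suc (Suc m)) = f (Suc r) (Suc m)"
  | (pend) r where "trace f x m = Added r" "trace f x (Suc m) = Pending (Suc r)"
      "f r m < f r (Suc m)" "2 * r + 3 \<le> m" "m \<le> 2 * r + 3" "\<forall>q. r = Suc q \<longrightarrow> f r m < f q m"
      "f (Suc r) (Suc m) < f (Suc r) (Suc (Suc m))"
  | (cancel) r where "trace f x m = Pending r" "trace f x (Suc m) = Deleted r"
      "2 * r + 2 \<le> m" "m \<le> 2 * r + 2" "f r m < f r (Suc m)" "\<forall>q. r = Suc q \<longrightarrow> trace f x (m - 1) = Added q"
  | (keep_del) r where "trace f x m = Deleted r" "trace f x (Suc m) = Deleted r"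
      "f (Suc r) (Suc m) < f r m" "f (Suc r) m < f r m" "2 * r + 2 \<le> m" "3 \<le> m"
      "m \<le> 2 * r + 2 \<longrightarrow> (\<exists>q. r = Suc q \<and> f r m = f q (m - 1) \<and> trace f x (m - 1) = Deleted q)"
  | (slide) r where "trace f x m = Deleted r" "trace f x (Suc m) = Deleted (Suc r)"
      "f (Suc r) (Suc m) = f r m" "f (Suc r) m < f r m" "2 * r + 3 \<le> m" "3 \<le> m"
proof -
  note k = kingD[OF f]
  note a = trace_admissible[OF f x, of m]
  note b = trace_admissible[OF f x, of "Suc m", unfolded diff_Suc_1]
  have u: "trace f x m = Unchanged" if "Suc m = x"
    using trace_Unchanged[OF x, of f m] that by simp
  show ?thesis
  proof (cases "trace f x m")
    case Unchanged
    show ?thesis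
    proof (cases "Suc m = x")
      case False
      then show ?thesis using wait Unchanged by simp
    next
      case True
      show ?thesis
      proof (cases "x = 2 \<and> f 0 x < f 0 (Suc x)")
        case T: True
        then have "trace f x (Suc m) = Pending 0" using True by (auto simp: enter_def numeral_2_eq_2)
        moreover have "m \<le> 1" using T True by simp
        moreover have "f 0 (Suc m) < f 0 (Suc (Suc m))"
          using T unfolding True[symmetric] by blast
        ultimately show ?thesis using start_pend[OF Unchanged] True by blast
      next
        case F: False
        then have "trace f x (Suc m) = Added 0"
          unfolding trace.simps(2) if_P[OF True] by (auto simp: enter_def numeral_2_eq_2 numeral_3_eq_3)
        moreover have "f 0 (Suc x) = f 0 x" if "m \<le> 1"
        proof -
          have "x = 2" using that True x by linarith
          then show ?thesis using F k(1)[of 0 x] by linarith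
        qed
        ultimately show ?thesis using start_add[OF Unchanged] unfolding True by blast
      qed
    qed
  next
    case (Added r)
    then have ne: "Suc m \<noteq> x" using u by auto
    have i: "2 * r + 2 \<le> m" "m = 2 * r + 2 \<longrightarrow> f r (Suc m) = f r m"
      "\<forall>q. r = Suc q \<longrightarrow> f r m < f q m" using a unfolding Added by auto
    show ?thesis
    proof (cases "f r m < f r (Suc m)")
      case False
      then have "f r (Suc m) = f r m" using k(1)[of r m] by linarith
      then show ?thesis using keep_add[OF Added] i ne Added by simp
    next
      case True
      then have m: "2 * r + 3 \<le> m" using i by linarith
      have t: "trace f x (Suc m) = enter f (Suc r) (Suc m)" using True Added ne by simp
      show ?thesis
      proof (cases "m = 2 * r + 3 \<and> f (Suc r) (Suc m) < f (Suc r) (Suc (Suc m))")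
        case T: True
        then have "Suc m = 2 * Suc r + 2" by simp
        moreover have "f (Suc r) (Suc m) < f (Suc r) (Suc (Suc m))" using T by blast
        ultimately have "trace f x (Suc m) = Pending (Suc r)" unfolding t enter_def by (simp only: simp_thms if_True)
        moreover have "2 * r + 3 \<le> m" "m \<le> 2 * r + 3" using T by simp_all
        ultimately show ?thesis using pend[OF Added] True i T by blast
      next
        case F: False
        have "Suc m = 2 * Suc r + 2 \<longleftrightarrow> m = 2 * r + 3" by auto
        then have n: "\<not> (Suc m = 2 * Suc r + 2 \<and> f (Suc r) (Suc m) < f (Suc r) (Suc (Suc m)))"
          using F by blast
        have "trace f x (Suc m) = Added (Suc r)" unfolding t enter_def if_not_P[OF n] ..
        moreover have "m \<le> 2 * r + 3 \<longrightarrow> f (Suc r) (Suc (Suc m)) = f (Suc r) (Suc m)"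
          using F k(1)[of "Suc r" "Suc m"] m by linarith
        ultimately show ?thesis using bump[OF Added] True i m by blast
      qed
    qed
  next
    case (Pending r)
    then have ne: "Suc m \<noteq> x" using u by auto
    show ?thesis using cancel[OF Pending] a ne Pending by auto
  next
    case (Deleted r)
    then have ne: "Suc m \<noteq> x" using u by auto
    have i: "2 * r + 2 \<le> m" "3 \<le> m" "f (Suc r) m < f r m"
      "m = 2 * r + 2 \<longrightarrow> (\<exists>q. r = Suc q \<and> f r m = f q (m - 1) \<and> trace f x (m - 1) = Deleted q)"
      using a unfolding Deleted by auto
    show ?thesis
    proof (cases "f (Suc r) (Suc m) = f r m")
      case True
      then have t: "trace f x (Suc m) = Deleted (Suc r)" using Deleted ne by simp
      have "2 * r + 3 \<le> m" using b unfolding t by simp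
      then show ?thesis using slide[OF Deleted t] True i by simp
    next
      case False
      then have "trace f x (Suc m) = Deleted r" using Deleted ne by simp
      moreover have "f (Suc r) (Suc m) < f r m" using False k(2)[of r m] by simp
      moreover have "m \<le> 2 * r + 2 \<longrightarrow> m = 2 * r + 2" using i(1) by simp
      ultimately show ?thesis using keep_del[OF Deleted] i by blast
    qed
  qed
qed


declare trace.simps(2) [simp del]

lemma grow_eq: "grow f x r m = (if trace f x m = Added r then Suc (f r m)
   else if trace f x m = Deleted r then f r m - 1 else f r m)"
  by (cases "trace f x m") (auto simp: grow_def)

text \<open>A letter that enters row \<open>r\<close> on the lowest possible level without
  cancelling has found no \<open>Barred (Suc r)\<close>, so it has nothing to bump on the next
  level.\<close>

lemma trace_Added_least:
  assumes "king k f" "2 \<le> x" "trace f x (2 * r + 2) = Added r"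
  shows "trace f x (2 * r + 3) = Added r" "f r (2 * r + 3) = f r (2 * r + 2)"
proof -
  have "trace f x (Suc (2 * r + 2)) = Added r \<and> f r (Suc (2 * r + 2)) = f r (2 * r + 2)"
    by (cases rule: trace_cases[OF assms(1,2), of "2 * r + 2"]) (use assms(3) in \<open>auto simp: Suc_double_not_eq_double double_not_eq_Suc_double\<close>)
  then show "trace f x (2 * r + 3) = Added r" "f r (2 * r + 3) = f r (2 * r + 2)"
    by (simp_all add: numeral_3_eq_3)
qed

lemma trace_final_const:
  assumes f: "king k f" and x: "2 \<le> x" "x \<le> 2 * k + 1" and m: "2 * k + 1 \<le> m"
  shows "trace f x m = trace f x (2 * k + 1)"
  using m
proof (induction m rule: dec_induct)
  case (step m)
  have c: "f r (Suc m) = f r m" for r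
    using kingD(4)[OF f, of m r] kingD(4)[OF f, of "Suc m" r] step by simp
  have "trace f x (Suc m) = trace f x m"
    by (cases rule: trace_cases[OF f x(1), of m]) (use c step x in auto)
  with step show ?case by simp
qed simp

text \<open>Monotonicity and interlacing each involve two neighbouring levels and can be checked
  against every transition separately. A gain fits because the row above is longer, a loss because
  the row below is shorter.\<close>

lemma king_grow:
  assumes f: "king k f" and x: "2 \<le> x" "x \<le> 2 * k + 1"
  shows "king k (grow f x)"
  unfolding king_def
proof (intro conjI allI impI)
  note k = kingD[OF f]
  fix r m
  show "grow f x r m \<le> grow f x r (Suc m)"
    by (cases rule: trace_cases[OF f x(1), of m])
      (use k(1)[of r m] in \<open>auto simp: grow_eq\<close>)
  show "grow f x (Suc r) (Suc m) \<le> grow f x r m"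
    by (cases rule: trace_cases[OF f x(1), of m])
      (use k(2)[of r m] in \<open>auto simp: grow_eq\<close>)
  show "grow f x r m = 0" if "m < 2 * r + 2"
    by (cases rule: trace_cases[OF f x(1), of m])
      (use k(3)[OF that] that in \<open>auto simp: grow_eq\<close>)
  show "grow f x r m = grow f x r (2 * k + 1)" if "2 * k + 1 \<le> m"
    using k(4)[OF that, of r] trace_final_const[OF f x that] by (simp add: grow_eq)
qed

section \<open>Comparison of two successive insertions\<close>

text \<open>The invariant for \<open>x \<le> y\<close>, with the state of the first insertion on the
  left. The second insertion may still be idle while the first one runs, but not conversely.
  \<open>Pending r\<close> occurs only on level \<open>2 * r + 2\<close>, so two pending states on
  one level belong to the same row.\<close>

fun in_order :: "state \<Rightarrow> state \<Rightarrow> bool" where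
  "in_order s Unchanged \<longleftrightarrow> True"
| "in_order (Added r) (Added q) \<longleftrightarrow> q \<le> r"
| "in_order (Pending r) (Added q) \<longleftrightarrow> True"
| "in_order (Deleted r) (Added q) \<longleftrightarrow> True"
| "in_order (Pending r) (Pending q) \<longleftrightarrow> True"
| "in_order (Deleted r) (Pending q) \<longleftrightarrow> True"
| "in_order (Deleted r) (Deleted q) \<longleftrightarrow> r \<le> q"
| "in_order _ _ \<longleftrightarrow> False"

lemma grow_Added_least:
  assumes "king k f" "2 \<le> x" "trace f x (2 * r + 2) = Added r"
  shows "grow f x r (2 * r + 3) = grow f x r (2 * r + 2)"
  using trace_Added_least[OF assms] assms(3) by (simp add: grow_eq)

lemma in_order_trace:
  assumes f: "king k f" and x: "2 \<le> x" "x \<le> 2 * k + 1" and y: "x \<le> y" and g: "g = grow f x"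
  shows "in_order (trace f x m) (trace g y m)"
proof (induction m)
  case (Suc m)
  have f': "king k g" unfolding g by (rule king_grow[OF f x])
  have y2: "2 \<le> y" using x y by simp
  have U: "trace f x m \<noteq> Unchanged" if "trace g y m \<noteq> Unchanged"
    using that y trace_Unchanged[OF x(1), of f m] trace_Unchanged[OF y2, of g m] by auto
  have U2: "trace f x (Suc m) \<noteq> Unchanged" if "x \<le> Suc m"
    using that trace_Unchanged[OF x(1), of f "Suc m"] by auto
  \<comment> \<open>If the first letter entered row \<open>r\<close> at level
    \<open>2 * r + 2\<close> without cancelling, then row \<open>r\<close> of \<open>g\<close>
    contains no \<open>Barred (Suc r)\<close> either, and a second letter arriving there at this
    level cannot cancel.\<close>
  have least: "g r (Suc (Suc m)) = g r (Suc m)" if "m \<le> 2 * r + 1" "trace f x (Suc m) = Added r" for r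
  proof -
    have "Suc m = 2 * r + 2"
      using trace_admissible[OF f x(1), of "Suc m"] that by simp
    then show ?thesis
      using grow_Added_least[OF f x(1), of r] that unfolding g by (auto simp: numeral_3_eq_3)
  qed
  note k = kingD[OF f]
  have ge: "g r m = (if trace f x m = Added r then Suc (f r m)
     else if trace f x m = Deleted r then f r m - 1 else f r m)" for r m
    unfolding g by (rule grow_eq)
  show ?case
    using Suc U U2 least y ge[of _ m] ge[of _ "Suc m"]
    apply (cases rule: trace_cases[OF f x(1), of m]; cases rule: trace_cases[OF f' y2, of m])
    apply (simp_all split: if_splits)
    subgoal for r ra by (cases "r = ra") auto
    subgoal for r ra by (cases "r = ra") auto
    done
qed simp


text \<open>The invariant for \<open>y < x\<close>, where the roles of the starting levels are
  exchanged: the second insertion may run while the first one is idle. On last states, which are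
  \<open>Added\<close> or \<open>Deleted\<close>, it is incompatible with \<open>in_order\<close>;
  this is what turns two implications into an equivalence.\<close>

fun out_of_order :: "state \<Rightarrow> state \<Rightarrow> bool" where
  "out_of_order Unchanged t \<longleftrightarrow> True"
| "out_of_order (Added r) (Added q) \<longleftrightarrow> r < q"
| "out_of_order (Added r) (Pending q) \<longleftrightarrow> True"
| "out_of_order (Added r) (Deleted q) \<longleftrightarrow> True"
| "out_of_order (Pending r) (Deleted q) \<longleftrightarrow> q < r"
| "out_of_order (Deleted r) (Deleted q) \<longleftrightarrow> q < r"
| "out_of_order _ _ \<longleftrightarrow> False"

lemma out_of_order_trace:
  assumes f: "king k f" and x: "2 \<le> x" "x \<le> 2 * k + 1" and y: "y < x" "2 \<le> y"
    and g: "g = grow f x"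
  shows "out_of_order (trace f x m) (trace g y m)"
proof (induction m)
  case (Suc m)
  have f': "king k g" unfolding g by (rule king_grow[OF f x])
  have U: "trace f x m = Unchanged" if "trace g y m = Unchanged"
    using that y trace_Unchanged[OF x(1), of f m] trace_Unchanged[OF y(2), of g m] by auto
  have U2: "trace g y (Suc m) \<noteq> Unchanged" if "x = Suc m"
    using that y trace_Unchanged[OF y(2), of g "Suc m"] by auto
  note k = kingD[OF f]
  have ge: "g r m = (if trace f x m = Added r then Suc (f r m)
     else if trace f x m = Deleted r then f r m - 1 else f r m)" for r m
    unfolding g by (rule grow_eq)
  show ?case
    using Suc U U2 y ge[of _ m] ge[of _ "Suc m"] k(1,2)[of _ m]
    apply (cases rule: trace_cases[OF f x(1), of m]; cases rule: trace_cases[OF f' y(2), of m])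
    apply (simp_all split: if_splits)
    \<comment> \<open>The surviving pairs of transitions are settled by monotonicity or interlacing
      of \<open>f\<close> in a specific row. The explicit level \<open>2 * ra + 4\<close> is the one
      on which a cancellation in row \<open>Suc ra\<close> is pending.\<close>
    subgoal using k(1)[of 0 m] by simp
    subgoal for r ra using k(1)[of ra m] by simp
    subgoal for r ra using k(2)[of ra m] by simp
    subgoal for r ra using k(2)[of ra "Suc (Suc (Suc (Suc (2 * ra))))"] by linarith
    subgoal for r ra using k(2)[of ra m] by linarith
    done
qed simp

section \<open>Running the growth backwards\<close>

text \<open>
  Here \<open>g\<close> is the chain after the insertion. At level \<open>2 * r + 2\<close> a loss in row \<open>r\<close> can stem from a
  cancellation in row \<open>r\<close> or from a slide out of row \<open>r - 1\<close>; in the second case, and only then, rows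
  \<open>r - 1\<close> and \<open>r\<close> of \<open>g\<close> have equal length at the levels compared here.
\<close>
fun retreat :: "(nat \<Rightarrow> nat \<Rightarrow> nat) \<Rightarrow> nat \<Rightarrow> state \<Rightarrow> state" where
  "retreat g m Unchanged = Unchanged"
| "retreat g m (Added r) = (if g r (Suc m) = g r m then Added r
     else case r of 0 \<Rightarrow> Unchanged | Suc q \<Rightarrow> Added q)"
| "retreat g m (Pending r) = (case r of 0 \<Rightarrow> Unchanged | Suc q \<Rightarrow> Added q)"
| "retreat g m (Deleted r) = (case r of 0 \<Rightarrow> if m = 2 then Pending 0 else Deleted 0
     | Suc q \<Rightarrow> if g r (Suc m) = g q m then Deleted q
         else if m = 2 * r + 2 \<and> g r m < g q (m - 1) then Pending r else Deleted r)"

text \<open>A bump into row \<open>r\<close> leaves a letter of rank \<open>Suc m\<close> there,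
  while a gain that stays in row \<open>r\<close> leaves none; this decides \<open>Added\<close>.
  For a loss at \<open>m = 2 * r + 2\<close> one looks at level \<open>m - 1\<close>. Before a
  cancellation row \<open>q = r - 1\<close> had just gained a box, so
  \<open>g r m < g q (m - 1)\<close>. If instead the loss slid down from row \<open>q\<close>, both
  sides are short by one and remain equal.\<close>

lemma retreat_trace:
  assumes f: "king k f" and x: "2 \<le> x"
  shows "trace f x m = retreat (grow f x) m (trace f x (Suc m))"
proof -
  note k = kingD[OF f]
  show ?thesis
  proof (cases rule: trace_cases[OF f x, of m, case_names wait start_add start_pend keep_add bump pend
        cancel keep_del slide])
    case start_add
    then show ?thesis using k(1)[of 0 m] by (simp add: grow_eq)
  next
    case (bump r)
    then show ?thesis using k(1)[of "Suc r" m] by (simp add: grow_eq)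
  next
    case (cancel r)
    show ?thesis
    proof (cases r)
      case 0
      then show ?thesis using cancel by simp
    next
      case (Suc q)
      then have "trace f x (m - 1) = Added q" "m - 1 = 2 * q + 3" "m = 2 * q + 4"
        using cancel by auto
      moreover have "f (Suc q) (Suc (m - 1)) \<le> f q (m - 1)" by (rule k(2))
      ultimately show ?thesis
        using cancel Suc k(2)[of q m] by (auto simp: grow_eq)
    qed
  next
    case (keep_del r)
    show ?thesis
    proof (cases r)
      case 0
      then show ?thesis using keep_del by simp
    next
      case (Suc q)
      have "f r (Suc m) > 0" using keep_del k(1)[of r m] by linarith
      then show ?thesis using keep_del Suc k(2)[of q m] by (auto simp: grow_eq)
    qed
  next
    case (slide r)
    then show ?thesis by (simp add: grow_eq)
  next
    case (keep_add r)
    then have "grow f x r (Suc m) = grow f x r m" by (simp add: grow_eq)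
    then show ?thesis using keep_add by simp
  qed auto
qed

text \<open>Equal results and equal last states force equal states on all levels by backward
  induction. Then \<open>f\<close> is regained by undoing the shift on each level, and
  \<open>x\<close> is the first level whose state is not \<open>Unchanged\<close>.\<close>

lemma grow_inject:
  assumes f: "king k f" and x: "2 \<le> x" "x \<le> 2 * k + 1"
    and f': "king k f'" and x': "2 \<le> x'" "x' \<le> 2 * k + 1"
    and grow: "grow f x = grow f' x'" and last: "trace f x (2 * k + 1) = trace f' x' (2 * k + 1)"
  shows "f = f' \<and> x = x'"
proof -
  have le: "trace f x m = trace f' x' m" if "m \<le> 2 * k + 1" for m
    using that
  proof (induction m rule: inc_induct)
    case (step m)
    then show ?case
      using retreat_trace[OF f x(1), of m] retreat_trace[OF f' x'(1), of m] grow by simp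
  qed (rule last)
  have tr: "trace f x m = trace f' x' m" for m
  proof (cases "m \<le> 2 * k + 1")
    case False
    then have "2 * k + 1 \<le> m" by simp
    then show ?thesis
      using trace_final_const[OF f x] trace_final_const[OF f' x'] last by metis
  qed (rule le)
  have "f r m = f' r m" for r m
  proof -
    have "grow f x r m = grow f' x' r m" using grow by simp
    \<comment> \<open>The subtraction in \<open>shift\<close> is truncated, so a loss can be undone
      only because the shortened row was not empty.\<close>
    moreover have "0 < f r m" if "trace f x m = Deleted r"
      using that trace_admissible[OF f x(1), of m] by simp
    moreover have "0 < f' r m" if "trace f' x' m = Deleted r"
      using that trace_admissible[OF f' x'(1), of m] by simp
    ultimately show ?thesis using tr[of m] by (auto simp: grow_eq split: if_splits)
  qed
  moreover have "m < x \<longleftrightarrow> m < x'" for m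
    using trace_Unchanged[OF x(1), of f m] trace_Unchanged[OF x'(1), of f' m] tr[of m] by simp
  then have "x = x'" by (metis less_irrefl linorder_neqE_nat)
  ultimately show ?thesis by auto
qed

text \<open>Here \<open>s\<close> is the state at level \<open>m + 1\<close>.\<close>
fun coadmissible :: "(nat \<Rightarrow> nat \<Rightarrow> nat) \<Rightarrow> nat \<Rightarrow> state \<Rightarrow> state \<Rightarrow> bool" where
  "coadmissible g m s Unchanged \<longleftrightarrow> True"
| "coadmissible g m s (Added r) \<longleftrightarrow> g (Suc r) m < g r m
     \<and> (m \<le> 2 * r + 2 \<longrightarrow> s = Added r \<and> g r (Suc m) = g r m)"
| "coadmissible g m s (Pending r) \<longleftrightarrow> m = 2 * r + 2 \<and> s = Deleted r
     \<and> (\<forall>q. r = Suc q \<longrightarrow> g r m < g q (m - 1) \<and> g r (Suc m) < g q m)"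
| "coadmissible g m s (Deleted r) \<longleftrightarrow> 2 * r + 2 \<le> m
     \<and> (m \<le> 2 * r + 2 \<longrightarrow> (\<exists>q. r = Suc q \<and> g r m = g q (m - 1)))
     \<and> (\<forall>q. r = Suc q \<longrightarrow> g r m < g q m)"

lemma king_pos:
  assumes "king k g" "0 < g r m" shows "2 * r + 2 \<le> m"
  using assms kingD(3)[of k g m r] by (cases "m < 2 * r + 2") auto

text \<open>This is why the backward run never gets stuck. The delicate case is a loss in row
  \<open>r = Suc q\<close> on its lowest level \<open>2 * r + 2\<close>. If it fails the test for a
  cancellation, interlacing leaves only \<open>g r m = g q (m - 1)\<close>, and this equality makes
  the next backward step lift the loss to row \<open>q\<close>.\<close>

lemma retreat_coadmissible:
  assumes g: "king k g" and adm: "coadmissible g (Suc m) s' s"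
  shows "coadmissible g m s (retreat g m s)"
proof -
  note k = kingD[OF g]
  show ?thesis
  proof (cases s)
    case (Added r)
    have i: "g (Suc r) (Suc m) < g r (Suc m)" using adm Added by simp
    show ?thesis
    proof (cases "g r (Suc m) = g r m")
      case True
      moreover have "g (Suc r) m \<le> g (Suc r) (Suc m)" by (rule k(1))
      ultimately show ?thesis using Added i by simp
    next
      case F: False
      show ?thesis
      proof (cases r)
        case (Suc q)
        have "g r m < g q m" using F k(1)[of r m] k(2)[of q m] Suc by simp
        moreover have "2 * r + 2 \<le> Suc m" using king_pos[OF g, of r "Suc m"] i by simp
        ultimately show ?thesis using Added F Suc by simp
      qed (use F Added in simp)
    qed
  next
    case (Pending r)
    show ?thesis
    proof (cases r)
      case (Suc q)
      have "Suc m = 2 * r + 2" "\<forall>q. r = Suc q \<longrightarrow> g r (Suc m) < g q (Suc m - 1)"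
        using adm[unfolded Pending coadmissible.simps] by blast+
      then have i: "m = 2 * q + 3" "g r (Suc m) < g q m" using Suc by auto
      moreover have "g r m \<le> g r (Suc m)" by (rule k(1))
      ultimately have "g (Suc q) m < g q m" unfolding Suc by linarith
      then show ?thesis using Pending Suc i(1) by simp
    qed (use Pending in simp)
  next
    case (Deleted r)
    have i: "2 * r + 2 \<le> Suc m" "Suc m \<le> 2 * r + 2 \<longrightarrow> (\<exists>q. r = Suc q \<and> g r (Suc m) = g q m)"
      "\<forall>q. r = Suc q \<longrightarrow> g r (Suc m) < g q (Suc m)" using adm Deleted by auto
    show ?thesis
    proof (cases r)
      case 0
      then show ?thesis using Deleted i by auto
    next
      case (Suc q)
      show ?thesis
      proof (cases "g r (Suc m) = g q m")
        case True
        have "g q m < g p m" if "q = Suc p" for p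
          using True i(3) Suc k(2)[of p m] that by simp
        then have "\<forall>p. q = Suc p \<longrightarrow> g q m < g p m" by blast
        moreover have "2 * q + 3 \<le> m" using i(1) Suc by simp
        ultimately show ?thesis using True Deleted Suc by simp
      next
        case False
        then have *: "g r (Suc m) < g q m" using k(2)[of q m] Suc by simp
        moreover have "g r m \<le> g r (Suc m)" by (rule k(1))
        moreover have "2 * r + 2 \<le> m"
        proof (rule ccontr)
          assume "\<not> 2 * r + 2 \<le> m"
          then have "Suc m \<le> 2 * r + 2" by simp
          then show False using i(2) False Suc by blast
        qed
        ultimately have i: "g r m < g q m" "g r (Suc m) < g q m" "2 * r + 2 \<le> m" by linarith+
        show ?thesis
        proof (cases "m = 2 * r + 2 \<and> g r m < g q (m - 1)")
          case True
          have "retreat g m s = Pending r"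
            unfolding Deleted retreat.simps Suc nat.case if_not_P[OF False[unfolded Suc]]
              if_P[OF True[unfolded Suc]] ..
          moreover have "m = 2 * r + 2" "g r m < g q (m - 1)" using True by blast+
          ultimately show ?thesis using i(2) Deleted Suc by (simp del: diff_Suc_1)
        next
          case F: False
          have "g r m = g q (m - 1)" if "m \<le> 2 * r + 2"
          proof -
            have "g (Suc q) (Suc (m - 1)) \<le> g q (m - 1)" "Suc (m - 1) = m" "m = 2 * r + 2"
              using k(2)[of q "m - 1"] i that by simp_all
            then show ?thesis using F Suc by simp
          qed
          moreover have "retreat g m s = Deleted r" unfolding Deleted retreat.simps Suc nat.case using False F Suc by (simp only: if_False simp_thms)
          ultimately show ?thesis using i Suc by simp
        qed
      qed
    qed
  qed simp
qed

lemma untrace_ex: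
  assumes g: "king k g" and s0: "coadmissible g (2 * k + 1) s0 s0"
    and s0': "s0 = Added r \<or> s0 = Deleted r"
  obtains s where "\<And>m. coadmissible g m (s (Suc m)) (s m)" "\<forall>m. 2 * k + 1 \<le> m \<longrightarrow> s m = s0"
    "\<forall>m. m < 2 * k + 1 \<longrightarrow> s m = retreat g m (s (Suc m))"
proof (rule that)
  let ?K = "2 * k + 1"
  define u where "u = rec_nat s0 (\<lambda>j. retreat g (?K - Suc j))"
  \<comment> \<open>The recursion \<open>u\<close> counts levels downwards from \<open>?K\<close>.
    Truncated subtraction gives \<open>u 0 = s0\<close> on every level from \<open>?K\<close> on, in
    accordance with \<open>g\<close> being constant there.\<close>
  define s where "s m = u (?K - m)" for m
  have c: "s m = s0" if "?K \<le> m" for m using that by (simp add: s_def u_def)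
  then show "\<forall>m. ?K \<le> m \<longrightarrow> s m = s0" by blast
  have r: "s m = retreat g m (s (Suc m))" if "m < ?K" for m
  proof -
    have "?K - m = Suc (?K - Suc m)" "?K - Suc (?K - Suc m) = m" using that by auto
    then show ?thesis by (simp add: s_def u_def)
  qed
  then show "\<forall>m. m < ?K \<longrightarrow> s m = retreat g m (s (Suc m))" by blast
  have K: "coadmissible g m (s (Suc m)) (s m)" if "?K \<le> m" for m
  proof -
    have "g r m = g r ?K" for r by (rule kingD(4)[OF g that])
    moreover have "g r (Suc m) = g r ?K" for r by (rule kingD(4)[OF g]) (use that in simp)
    moreover have "r < k" if "s0 = Deleted r"
      using s0 that by (cases "2 * k + 1 \<le> 2 * r + 2") auto
    ultimately show ?thesis using s0 s0' that by (auto simp: c)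
  qed
  show "coadmissible g m (s (Suc m)) (s m)" for m
  proof (cases "m \<le> ?K")
    case True
    then show ?thesis
    proof (induction m rule: inc_induct)
      case base
      then show ?case using K by simp
    next
      case (step m)
      then show ?case using retreat_coadmissible[OF g step(3)] r[of m] by simp
    qed
  qed (use K in simp)
qed


text \<open>The backward counterpart of \<open>trace_cases\<close>, with the same nine transitions.
  The inequalities now concern \<open>g\<close>; they come from the test made by
  \<open>retreat\<close> and from coadmissibility on levels \<open>m\<close> and
  \<open>Suc m\<close>.\<close>

lemma retreat_cases:
  assumes g: "king k g" and s0: "coadmissible g (2 * k + 1) s0 s0"
    and s0': "s0 = Added p \<or> s0 = Deleted p"
    and adm: "\<And>m. coadmissible g m (s (Suc m)) (s m)"
    and fin: "\<forall>m. 2 * k + 1 \<le> m \<longrightarrow> s m = s0"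
    and ret: "\<forall>m. m < 2 * k + 1 \<longrightarrow> s m = retreat g m (s (Suc m))"
  obtains
    (wait) "s m = Unchanged" "s (Suc m) = Unchanged"
  | (start_add) "s m = Unchanged" "s (Suc m) = Added 0" "g 0 m < g 0 (Suc m)"
      "m \<le> 1 \<longrightarrow> s (Suc (Suc m)) = Added 0 \<and> g 0 (Suc (Suc m)) = g 0 (Suc m)"
  | (start_pend) "s m = Unchanged" "s (Suc m) = Pending 0" "m = 1" "s (Suc (Suc m)) = Deleted 0"
  | (keep_add) r where "s m = Added r" "s (Suc m) = Added r"
      "g r (Suc m) = g r m" "g (Suc r) m < g r m" "g (Suc r) (Suc m) < g r m"
  | (bump) r where "s m = Added r" "s (Suc m) = Added (Suc r)"
      "g (Suc r) m < g (Suc r) (Suc m)" "g (Suc r) m < g r m" "2 * r + 3 \<le> m"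
      "m \<le> 2 * r + 3 \<longrightarrow> s (Suc (Suc m)) = Added (Suc r)
         \<and> g (Suc r) (Suc (Suc m)) = g (Suc r) (Suc m)"
  | (pend) r where "s m = Added r" "s (Suc m) = Pending (Suc r)"
      "m = 2 * r + 3" "g (Suc r) (Suc m) < g r m" "s (Suc (Suc m)) = Deleted (Suc r)"
  | (cancel) r where "s m = Pending r" "s (Suc m) = Deleted r"
      "m = 2 * r + 2" "\<forall>q. r = Suc q \<longrightarrow> g r (Suc m) < g q m"
  | (keep_del) r where "s m = Deleted r" "s (Suc m) = Deleted r" "2 * r + 2 \<le> m"
      "\<forall>q. r = Suc q \<longrightarrow> g r (Suc m) < g q m"
  | (slide) r where "s m = Deleted r" "s (Suc m) = Deleted (Suc r)"
      "g (Suc r) (Suc m) = g r m" "2 * r + 2 \<le> m" "g (Suc r) (Suc m) < g r (Suc m)"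
proof (cases "m < 2 * k + 1")
  case False
  then have m: "2 * k + 1 \<le> m" by simp
  have s: "s m = s0" "s (Suc m) = s0" using fin m by simp_all
  have c: "g r (Suc m) = g r m" for r
    using kingD(4)[OF g, of m r] kingD(4)[OF g, of "Suc m" r] m by simp
  show ?thesis using s0'
  proof
    assume a: "s0 = Added p"
    then show ?thesis using keep_add[of p] adm[of m] s c by simp
  next
    assume a: "s0 = Deleted p"
    then show ?thesis using keep_del[of p] adm[of m] s c by simp
  qed
next
  case True
  note k = kingD[OF g]
  note r = ret[rule_format, OF True]
  note a = adm[of m] and b = adm[of "Suc m"]
  show ?thesis
  proof (cases "s (Suc m)")
    case Unchanged
    then show ?thesis using wait r by simp
  next
    case (Added r')
    show ?thesis
    proof (cases "g r' (Suc m) = g r' m")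
      case True
      then have s: "s m = Added r'" using r Added by simp
      have "g (Suc r') (Suc m) < g r' (Suc m)" "g (Suc r') m < g r' m"
        using a b unfolding s Added by simp_all
      then show ?thesis using keep_add[OF s Added] True by simp
    next
      case False
      then have lt: "g r' m < g r' (Suc m)" using k(1)[of r' m] by linarith
      have b': "g (Suc r') (Suc m) < g r' (Suc m)"
          "Suc m \<le> 2 * r' + 2 \<longrightarrow> s (Suc (Suc m)) = Added r' \<and> g r' (Suc (Suc m)) = g r' (Suc m)"
        using b unfolding Added by simp_all
      show ?thesis
      proof (cases r')
        case 0
        then have "s m = Unchanged" using r Added False by simp
        then show ?thesis using start_add lt b'(2) Added 0 by auto
      next
        case (Suc q)
        then have s: "s m = Added q" using r Added False by simp
        have "g r' m < g q m" using a unfolding s by (simp add: Suc)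
        moreover have "2 * r' + 2 \<le> Suc m"
          using king_pos[OF g, of r' "Suc m"] b' by linarith
        then have "2 * q + 3 \<le> m" using Suc by simp
        moreover have "m \<le> 2 * q + 3 \<longrightarrow> Suc m \<le> 2 * r' + 2" using Suc by simp
        ultimately show ?thesis using bump[OF s] Added lt b' unfolding Suc by blast
      qed
    qed
  next
    case (Pending r')
    have b': "Suc m = 2 * r' + 2" "s (Suc (Suc m)) = Deleted r'"
      "\<forall>q. r' = Suc q \<longrightarrow> g r' (Suc m) < g q m"
      using b[unfolded Pending coadmissible.simps diff_Suc_1] by blast+
    show ?thesis
    proof (cases r')
      case 0
      then show ?thesis using start_pend r Pending b' by simp
    next
      case (Suc q)
      then have "s m = Added q" "m = 2 * q + 3" using r Pending b'(1) by simp_all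
      then show ?thesis using pend[of q] Pending b' unfolding Suc by blast
    qed
  next
    case (Deleted r')
    show ?thesis
    proof (cases r')
      case 0
      have s: "s m = (if m = 2 then Pending 0 else Deleted 0)" using r Deleted 0 by simp
      show ?thesis
      proof (cases "m = 2")
        case True
        then show ?thesis using cancel[of 0] s Deleted 0 by simp
      next
        case False
        then have "s m = Deleted 0" using s by simp
        then show ?thesis using keep_del[of 0] a Deleted 0 by simp
      qed
    next
      case (Suc q)
      show ?thesis
      proof (cases "g r' (Suc m) = g q m")
        case True
        then have s: "s m = Deleted q" using r Deleted Suc by simp
        have "2 * q + 2 \<le> m" using a unfolding s by simp
        moreover have "g r' (Suc m) < g q (Suc m)" using b Suc unfolding Deleted by simp
        ultimately show ?thesis using slide[OF s] Deleted True Suc by simp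
      next
        case False
        then have lt: "g r' (Suc m) < g q m" using k(2)[of q m] Suc by simp
        have s: "s m = (if m = 2 * r' + 2 \<and> g r' m < g q (m - 1) then Pending r' else Deleted r')"
          unfolding r Deleted retreat.simps Suc nat.case using False Suc by (simp only: if_False)
        show ?thesis
        proof (cases "m = 2 * r' + 2 \<and> g r' m < g q (m - 1)")
          case True
          have "s m = Pending r'" unfolding s if_P[OF True] ..
          then show ?thesis using cancel[of r'] True lt Deleted Suc by blast
        next
          case F: False
          have s: "s m = Deleted r'" unfolding s if_not_P[OF F] ..
          have "2 * r' + 2 \<le> m" using a unfolding s by simp
          then show ?thesis using keep_del[OF s Deleted] lt Suc by blast
        qed
      qed
    qed
  qed
qed

text \<open>The preimage \<open>f\<close> is obtained by undoing on each level the shift that the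
  backward run prescribes. It remains to see that the forward rules, evaluated with
  \<open>f\<close>, reproduce that run; the letter \<open>x\<close> is read off as the first level
  on which the run is not \<open>Unchanged\<close>.\<close>

lemma grow_surj:
  assumes g: "king k g" and s0: "coadmissible g (2 * k + 1) s0 s0"
    and s0': "s0 = Added p \<or> s0 = Deleted p"
  obtains f x where "king k f" "2 \<le> x" "x \<le> 2 * k + 1" "grow f x = g" "trace f x (2 * k + 1) = s0"
proof -
  obtain s where adm: "\<And>m. coadmissible g m (s (Suc m)) (s m)"
    and fin: "\<forall>m. 2 * k + 1 \<le> m \<longrightarrow> s m = s0"
    and ret: "\<forall>m. m < 2 * k + 1 \<longrightarrow> s m = retreat g m (s (Suc m))"
    by (rule untrace_ex[OF g s0 s0']) (rule that)
  note k = kingD[OF g]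
  note rc = retreat_cases[OF g s0 s0' adm fin ret]
  define f where "f r m = (if s m = Added r then g r m - 1 else if s m = Deleted r then Suc (g r m)
    else g r m)" for r m
  have pos: "0 < g r m" if "s m = Added r" for r m
    using adm[of m] that by simp
  have f: "king k f"
    unfolding king_def
  proof (intro conjI allI impI)
    fix r m
    show "f r m \<le> f r (Suc m)"
      by (cases rule: rc[of m])
        (use k(1)[of r m] in \<open>auto simp: f_def\<close>)
    show "f (Suc r) (Suc m) \<le> f r m"
      by (cases rule: rc[of m])
        (use k(2)[of r m] in \<open>auto simp: f_def\<close>)
    show "f r m = 0" if "m < 2 * r + 2"
      using k(3)[OF that] adm[of m] that by (auto simp: f_def)
    show "f r m = f r (2 * k + 1)" if "2 * k + 1 \<le> m"
      using k(4)[OF that, of r] fin[rule_format, OF that] fin[rule_format, of "2 * k + 1"] by (simp add: f_def)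
  qed
  define x where "x = (LEAST m. s m \<noteq> Unchanged)"
  have "s (2 * k + 1) \<noteq> Unchanged" using fin[rule_format, of "2 * k + 1"] s0' by auto
  then have x1: "s x \<noteq> Unchanged" "x \<le> 2 * k + 1"
    unfolding x_def by (rule LeastI, rule Least_le)
  have x2: "s m = Unchanged" if "m < x" for m
    using that not_less_Least unfolding x_def by blast
  have "2 \<le> m" if "s m \<noteq> Unchanged" for m
  proof (cases "s m")
    case (Added r)
    then have "2 * r + 2 \<le> m" using king_pos[OF g pos] by blast
    then show ?thesis by simp
  qed (use adm[of m] that in auto)
  then have x3: "2 \<le> x" using x1 by blast
  have tr: "trace f x m = s m" for m
  proof (induction m)
    case 0
    then show ?case using x2[of 0] x3 by simp
  next
    case (Suc m)
    have start: "x = Suc m" if "s m = Unchanged" "s (Suc m) \<noteq> Unchanged"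
      using that x1 x2 trace_Unchanged[OF x3, of f m] Suc
      by (metis less_SucE not_less_eq linorder_neqE_nat)
    have nostart: "x \<noteq> Suc m" if "s m \<noteq> Unchanged \<or> s (Suc m) = Unchanged"
      using that x1 x2[of m] by auto
    have advance: "trace f x (Suc m) = advance f m (s m)" if "s m \<noteq> Unchanged"
      using nostart that Suc by (auto simp: trace.simps(2))
    have enter: "trace f x (Suc m) = enter f 0 (Suc m)" if "s m = Unchanged" "s (Suc m) \<noteq> Unchanged"
      using start[OF that] by (simp add: trace.simps(2))
    show ?case
    proof (cases rule: rc[of m, case_names wait start_add start_pend keep_add bump pend
        cancel keep_del slide])
      case wait
      then show ?thesis using nostart Suc by (auto simp: trace.simps(2))
    next
      case start_add
      have "f 0 (Suc (Suc m)) = f 0 (Suc m)" if "m \<le> 1"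
        using start_add that by (simp add: f_def)
      then have "\<not> (Suc m = 2 * 0 + 2 \<and> f 0 (Suc m) < f 0 (Suc (Suc m)))" by auto
      then show ?thesis using enter start_add(1,2) by (simp only: enter_def if_False) simp
    next
      case start_pend
      have "f 0 (Suc m) < f 0 (Suc (Suc m))"
        using start_pend(2,4) k(1)[of 0 "Suc m"] by (simp add: f_def)
      then have p: "Suc m = 2 * 0 + 2 \<and> f 0 (Suc m) < f 0 (Suc (Suc m))" using start_pend(3) by simp
      have "enter f 0 (Suc m) = Pending 0" unfolding enter_def if_P[OF p] ..
      then show ?thesis using enter start_pend(1,2) by simp
    next
      case (keep_add r)
      then have "f r (Suc m) = f r m" by (simp add: f_def)
      then show ?thesis using advance keep_add(1,2) by simp
    next
      case (bump r)
      have lt: "f r m < f r (Suc m)" using bump(1,2) k(1)[of r m] pos[of m r] by (simp add: f_def)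
      have "f (Suc r) (Suc (Suc m)) = f (Suc r) (Suc m)" if "m \<le> 2 * r + 3"
        using bump(2) bump(6)[rule_format, OF that] by (simp add: f_def)
      then have "\<not> (Suc m = 2 * Suc r + 2 \<and> f (Suc r) (Suc m) < f (Suc r) (Suc (Suc m)))"
        by auto
      then have "enter f (Suc r) (Suc m) = Added (Suc r)" by (simp only: enter_def if_False)
      then show ?thesis using advance bump(1,2) lt by simp
    next
      case (pend r)
      have lt: "f r m < f r (Suc m)" using pend(1,2) k(1)[of r m] pos[of m r] by (simp add: f_def)
      have "f (Suc r) (Suc m) < f (Suc r) (Suc (Suc m))"
        using pend(2,5) k(1)[of "Suc r" "Suc m"] by (simp add: f_def)
      then have p: "Suc m = 2 * Suc r + 2 \<and> f (Suc r) (Suc m) < f (Suc r) (Suc (Suc m))"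
        using pend(3) by simp
      have "enter f (Suc r) (Suc m) = Pending (Suc r)" unfolding enter_def if_P[OF p] ..
      then show ?thesis using advance pend(1,2) lt by simp
    next
      case (cancel r)
      then show ?thesis using advance by simp
    next
      case (keep_del r)
      then have "f (Suc r) (Suc m) \<noteq> f r m" using k(2)[of r m] by (simp add: f_def)
      then show ?thesis using advance keep_del(1,2) by simp
    next
      case (slide r)
      then have "f (Suc r) (Suc m) = f r m" by (simp add: f_def)
      then show ?thesis using advance slide(1,2) by simp
    qed
  qed
  moreover have "grow f x = g"
  proof (intro ext)
    fix r m
    show "grow f x r m = g r m"
      using tr[of m] pos[of m r] by (auto simp: grow_eq f_def)
  qed
  moreover have "s (2 * k + 1) = s0" using fin by simp
  ultimately show ?thesis using that[OF f x3 x1(2)] by simp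
qed

section \<open>Jeu de taquin by levels\<close>

definition count_le :: "nat \<Rightarrow> letter list \<Rightarrow> nat" where
  "count_le m R = length (filter (\<lambda>y. letter_rank y \<le> m) R)"

definition cnt :: "tableau \<Rightarrow> nat \<Rightarrow> nat \<Rightarrow> nat" where
  "cnt T r m = (if r < length T then count_le m (T ! r) else 0)"

lemma count_le_simps [simp]:
  "count_le m [] = 0"
  "count_le m (y # R) = of_bool (letter_rank y \<le> m) + count_le m R"
  "count_le m (R @ R') = count_le m R + count_le m R'"
  by (auto simp: count_le_def)

lemma count_le_length: "count_le m R \<le> length R"
  by (simp add: count_le_def)

lemma cnt_Cons [simp]: "cnt (R # T) 0 m = count_le m R" "cnt (R # T) (Suc r) m = cnt T r m"
  by (auto simp: cnt_def)

lemma cnt_Nil [simp]: "cnt [] r m = 0"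
  by (simp add: cnt_def)

lemma less_count_le_iff:
  "sorted R \<Longrightarrow> c < length R \<Longrightarrow> c < count_le m R \<longleftrightarrow> letter_rank (R ! c) \<le> m"
proof (induction R arbitrary: c)
  case (Cons y R)
  show ?case
  proof (cases "letter_rank y \<le> m")
    case True
    then show ?thesis using Cons by (cases c) auto
  next
    case False
    then have "\<not> letter_rank z \<le> m" if "z \<in> set (y # R)" for z
      using Cons(2) that by (auto simp: less_eq_letter_def)
    moreover from this have "count_le m (y # R) = 0"
      unfolding count_le_def by (simp add: filter_empty_conv)
    moreover have "(y # R) ! c \<in> set (y # R)" using Cons(3) by (rule nth_mem)
    ultimately show ?thesis by simp
  qed
qed simp

lemma count_le_eqI:
  assumes "sorted R" "n \<le> length R"
    "\<And>c. c < n \<Longrightarrow> letter_rank (R ! c) \<le> m" "n < length R \<Longrightarrow> m < letter_rank (R ! n)"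
  shows "count_le m R = n"
proof (rule antisym)
  show "count_le m R \<le> n"
  proof (cases "n < length R")
    case True
    then show ?thesis using less_count_le_iff[OF assms(1) True, of m] assms(4) by auto
  next
    case False
    then show ?thesis using assms(2) count_le_length[of m R] by simp
  qed
  show "n \<le> count_le m R"
  proof (cases n)
    case (Suc c)
    then show ?thesis using less_count_le_iff[OF assms(1), of c m] assms(2) assms(3)[of c] by simp
  qed simp
qed

lemma count_le_update:
  "j < length R \<Longrightarrow> count_le m (R[j := x]) + of_bool (letter_rank (R ! j) \<le> m)
     = count_le m R + of_bool (letter_rank x \<le> m)"
proof (induction R arbitrary: j)
  case (Cons y R)
  then show ?case by (cases j) auto
qed simp

lemma count_le_Suc: "count_le m R < count_le (Suc m) R \<longleftrightarrow> (\<exists>y \<in> set R. letter_rank y = Suc m)"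
proof -
  have mono: "count_le m R \<le> count_le (Suc m) R" for R
    by (induction R) auto
  show ?thesis
  proof (induction R)
    case (Cons y R)
    then show ?case using mono[of R] by auto
  qed simp
qed

lemma sorted_update:
  fixes R :: "letter list"
  assumes "sorted R" "\<And>i. i < j \<Longrightarrow> i < length R \<Longrightarrow> R ! i \<le> x"
    "Suc j < length R \<Longrightarrow> x \<le> R ! Suc j"
  shows "sorted (R[j := x])"
  unfolding sorted_iff_nth_mono_less
proof (intro allI impI)
  fix a b assume ab: "a < b" "b < length (R[j := x])"
  have "x \<le> R ! b" if "a = j"
  proof -
    have "R ! Suc j \<le> R ! b" using ab that assms(1) by (simp add: sorted_iff_nth_mono)
    then show ?thesis using assms(3) ab that by simp
  qed
  moreover have "R ! a \<le> R ! b" using ab assms(1) by (simp add: sorted_iff_nth_mono)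
  ultimately show "R[j := x] ! a \<le> R[j := x] ! b"
    using ab assms(2)[of a] by (cases "a = j"; cases "b = j") auto
qed

text \<open>Column strictness is required only from row \<open>r\<close> on, because a downward
  slide leaves the moved entry in row \<open>r\<close> and a leftover copy of it directly below, so
  it breaks strictness between the row just left and the next one.\<close>

definition semistandard_from :: "nat \<Rightarrow> tableau \<Rightarrow> bool" where
  "semistandard_from r T \<longleftrightarrow> (\<forall>R \<in> set T. sorted R \<and> R \<noteq> [])
     \<and> (\<forall>q c. r \<le> q \<longrightarrow> Suc q < length T \<longrightarrow> c < length (T ! Suc q)
          \<longrightarrow> c < length (T ! q) \<and> T ! q ! c < T ! Suc q ! c)"

lemma cnt_update_row:
  "r < length T \<Longrightarrow> cnt (T[r := R]) q m = (if q = r then count_le m R else cnt T q m)"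
  by (auto simp: cnt_def)

text \<open>Only the last row can have become empty, so dropping it does not renumber the other
  rows.\<close>

lemma cnt_filter_nonempty:
  assumes "\<forall>q < length T. q \<noteq> r \<longrightarrow> T ! q \<noteq> []" "T ! r = [] \<longrightarrow> Suc r = length T"
  shows "cnt (filter (\<lambda>R. R \<noteq> []) T) q m = cnt T q m"
proof (cases "T ! r = [] \<and> r < length T")
  case True
  then have T: "T = take r T @ [[]]"
    using assms(2) id_take_nth_drop[of r T] by simp
  have "R \<noteq> []" if R: "R \<in> set (take r T)" for R
  proof -
    obtain i where "i < length (take r T)" "R = take r T ! i"
      using R unfolding in_set_conv_nth by blast
    then show ?thesis using assms(1) by simp
  qed
  then have "filter (\<lambda>R. R \<noteq> []) (take r T) = take r T"
    by (simp add: filter_id_conv)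
  then have "filter (\<lambda>R. R \<noteq> []) (take r T @ [[]]) = take r T"
    by simp
  then have "filter (\<lambda>R. R \<noteq> []) T = take r T"
    unfolding T[symmetric] .
  moreover have "cnt (take r T) q m = cnt T q m"
    using True assms(2) by (cases "q = r") (auto simp: cnt_def)
  ultimately show ?thesis by simp
next
  case False
  then have "\<forall>R \<in> set T. R \<noteq> []" using assms(1) by (auto simp: in_set_conv_nth)
  then show ?thesis by (simp add: filter_id_conv)
qed

text \<open>
  The entry stored at the empty box is a leftover copy of rank \<open>v\<close>, so it is counted by \<open>cnt T\<close>; \<open>d m\<close>
  is the row that contains the empty box once all letters of rank at most \<open>m\<close> have been passed.
\<close>
lemma jeu_de_taquin_cnt:
  assumes "semistandard_from r T" "r < length T" "c < length (T ! r)" "v = letter_rank (T ! r ! c)"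
    "d v = r"
    "\<And>m. v \<le> m \<Longrightarrow> d (Suc m) = (if cnt T (Suc (d m)) (Suc m) = cnt T (d m) m then Suc (d m) else d m)"
  shows "(\<forall>R \<in> set (jeu_de_taquin r c T). sorted R \<and> R \<noteq> [])
    \<and> (\<forall>q m. cnt (jeu_de_taquin r c T) q m = cnt T q m - of_bool (v \<le> m \<and> d m = q))"
  using assms
proof (induction r c T arbitrary: v rule: jeu_de_taquin.induct)
  case (1 r c T)
  note ss = 1(3) and r = 1(4) and c = 1(5) and v = 1(6) and dv = 1(7) and run = 1(8)
  define below where "below \<longleftrightarrow> Suc r < length T \<and> c < length (T ! Suc r)"
  define right where "right \<longleftrightarrow> r < length T \<and> Suc c < length (T ! r)"
  define b where "b = T ! Suc r ! c"
  define w where "w = T ! r ! Suc c"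
  define P where "P \<longleftrightarrow> below \<and> (right \<longrightarrow> b \<le> w)"
  have jdt: "jeu_de_taquin r c T = (if P then jeu_de_taquin (Suc r) c (T[r := (T ! r)[c := b]])
      else if right then jeu_de_taquin r (Suc c) (T[r := (T ! r)[c := w]])
      else filter (\<lambda>R. R \<noteq> []) (T[r := butlast (T ! r)]))"
    unfolding P_def below_def right_def b_def w_def
    by (subst jeu_de_taquin.simps) (simp add: Let_def)
  have IH1: "\<And>v. P \<Longrightarrow> semistandard_from (Suc r) (T[r := (T ! r)[c := b]])
      \<Longrightarrow> Suc r < length (T[r := (T ! r)[c := b]])
      \<Longrightarrow> c < length (T[r := (T ! r)[c := b]] ! Suc r)
      \<Longrightarrow> v = letter_rank (T[r := (T ! r)[c := b]] ! Suc r ! c) \<Longrightarrow> d v = Suc r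
      \<Longrightarrow> (\<And>m. v \<le> m \<Longrightarrow> d (Suc m) = (if cnt (T[r := (T ! r)[c := b]]) (Suc (d m)) (Suc m)
          = cnt (T[r := (T ! r)[c := b]]) (d m) m then Suc (d m) else d m))
      \<Longrightarrow> (\<forall>R \<in> set (jeu_de_taquin (Suc r) c (T[r := (T ! r)[c := b]])). sorted R \<and> R \<noteq> [])
        \<and> (\<forall>q m. cnt (jeu_de_taquin (Suc r) c (T[r := (T ! r)[c := b]])) q m
            = cnt (T[r := (T ! r)[c := b]]) q m - of_bool (v \<le> m \<and> d m = q))"
    using 1(1)[OF refl refl] unfolding P_def below_def right_def b_def w_def by blast
  have IH2: "\<And>v. \<not> P \<Longrightarrow> right \<Longrightarrow> semistandard_from r (T[r := (T ! r)[c := w]])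
      \<Longrightarrow> r < length (T[r := (T ! r)[c := w]])
      \<Longrightarrow> Suc c < length (T[r := (T ! r)[c := w]] ! r)
      \<Longrightarrow> v = letter_rank (T[r := (T ! r)[c := w]] ! r ! Suc c) \<Longrightarrow> d v = r
      \<Longrightarrow> (\<And>m. v \<le> m \<Longrightarrow> d (Suc m) = (if cnt (T[r := (T ! r)[c := w]]) (Suc (d m)) (Suc m)
          = cnt (T[r := (T ! r)[c := w]]) (d m) m then Suc (d m) else d m))
      \<Longrightarrow> (\<forall>R \<in> set (jeu_de_taquin r (Suc c) (T[r := (T ! r)[c := w]])). sorted R \<and> R \<noteq> [])
        \<and> (\<forall>q m. cnt (jeu_de_taquin r (Suc c) (T[r := (T ! r)[c := w]])) q m
            = cnt (T[r := (T ! r)[c := w]]) q m - of_bool (v \<le> m \<and> d m = q))"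
    using 1(2)[OF refl refl] unfolding P_def below_def right_def b_def w_def by blast
  have rows: "sorted (T ! q)" "T ! q \<noteq> []" if "q < length T" for q
    using ss that by (auto simp: semistandard_from_def)
  have cols: "c < length (T ! q)" "T ! q ! c < T ! Suc q ! c"
    if "r \<le> q" "Suc q < length T" "c < length (T ! Suc q)" for q c
    using ss that by (auto simp: semistandard_from_def)
  note sr = rows(1)[OF r]
  have le_c: "T ! r ! i \<le> T ! r ! c" if "i \<le> c" for i
    using sr c that by (simp add: sorted_iff_nth_mono)
  have rank_c: "letter_rank (T ! r ! i) \<le> m" if "i < Suc c" "v \<le> m" for i m
    using le_c[of i] that v by (simp add: less_eq_letter_def)
  have pos: "0 < cnt T r m" if "v \<le> m" for m
    using less_count_le_iff[OF sr c, of m] v that r by (auto simp: cnt_def)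
  \<comment> \<open>From the level of the leftover entry up to the level just below its right
    neighbour, row \<open>r\<close> has exactly \<open>c + 1\<close> entries. The test for a slide
    therefore first succeeds when the row below reaches length \<open>c + 1\<close>, that is, on the
    level of the entry \<open>b\<close>, provided that \<open>b\<close> does not exceed the right
    neighbour.\<close>
  have cnt_r: "cnt T r m = Suc c" if "v \<le> m" "right \<Longrightarrow> m < letter_rank w" for m
  proof -
    have "count_le m (T ! r) = Suc c"
      using c that(2) rank_c[OF _ that(1)] r
      by (intro count_le_eqI[OF sr]) (auto simp: right_def w_def)
    then show ?thesis using r by (simp add: cnt_def)
  qed
  have cnt_below: "cnt T (Suc r) m \<le> c" if "below \<Longrightarrow> m < letter_rank b" for m
  proof (cases below)
    case True
    then have "\<not> c < count_le m (T ! Suc r)"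
      using less_count_le_iff[OF rows(1), of "Suc r" c m] that by (auto simp: below_def b_def)
    then show ?thesis using True by (simp add: cnt_def below_def)
  next
    case False
    then show ?thesis using count_le_length[of m "T ! Suc r"]
      by (auto simp: cnt_def below_def)
  qed
  have stay: "d m = r" if "v \<le> m" "m < n" "\<And>i. v \<le> i \<Longrightarrow> Suc i < n \<Longrightarrow> cnt T (Suc r) (Suc i) \<noteq> cnt T r i" for m n
    using that(1,2)
  proof (induction m rule: dec_induct)
    case base
    then show ?case using dv by simp
  next
    case (step m)
    then show ?case using run[of m] that(3)[of m] by simp
  qed
  have mono: "d m \<le> d m'" if "v \<le> m" "m \<le> m'" for m m'
    using that(2)
  proof (induction m' rule: dec_induct)
    case (step m')
    then show ?case using run[of m'] that(1) by (simp split: if_splits)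
  qed simp
  show ?case
  proof (cases P)
    case True
    then have below: "below" and bw: "right \<Longrightarrow> b \<le> w" by (auto simp: P_def)
    then have Sr: "Suc r < length T" "c < length (T ! Suc r)" by (auto simp: below_def)
    have vb: "T ! r ! c < b" using cols(2)[OF _ Sr] by (simp add: b_def)
    then have vb': "v < letter_rank b" by (simp add: v less_letter_def)
    define T1 where "T1 = T[r := (T ! r)[c := b]]"
    have "sorted ((T ! r)[c := b])"
    proof (rule sorted_update[OF sr])
      show "T ! r ! i \<le> b" if "i < c" for i
        using le_c[of i] vb that by (meson less_imp_le order_trans)
      show "b \<le> T ! r ! Suc c" if "Suc c < length (T ! r)"
        using bw that r by (simp add: right_def w_def)
    qed
    then have ss1: "semistandard_from (Suc r) T1"
      unfolding semistandard_from_def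
    proof (intro conjI ballI allI impI)
      fix R assume "sorted ((T ! r)[c := b])" "R \<in> set T1"
      then have "R \<in> set T \<or> R = (T ! r)[c := b]"
        unfolding T1_def using set_update_subset_insert by fastforce
      moreover have "[] \<noteq> (T ! r)[c := b]" using c by (metis list_update_nonempty list.size(3) not_less_zero)
      ultimately show "sorted R" "R \<noteq> []"
        using \<open>sorted ((T ! r)[c := b])\<close> ss c by (auto simp: semistandard_from_def)
    next
      fix q i assume q: "Suc r \<le> q" "Suc q < length T1" "i < length (T1 ! Suc q)"
      then have "T1 ! q = T ! q" "T1 ! Suc q = T ! Suc q" by (auto simp: T1_def)
      then show "i < length (T1 ! q)" "T1 ! q ! i < T1 ! Suc q ! i"
        using cols[of q i] q by (auto simp: T1_def)
    qed
    have cntT1: "cnt T1 q m = (if q = r then cnt T r m - of_bool (v \<le> m) + of_bool (letter_rank b \<le> m)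
        else cnt T q m)" for q m
    proof (cases "q = r")
      case True
      have "cnt T r m = count_le m (T ! r)" using r by (simp add: cnt_def)
      then show ?thesis
        using count_le_update[OF c, of m b] r v True pos[of m]
          by (cases "v \<le> m") (auto simp: T1_def cnt_update_row)
    qed (use r in \<open>simp add: T1_def cnt_update_row\<close>)
    have stay': "d m = r" if "v \<le> m" "m < letter_rank b" for m
    proof (rule stay[OF that])
      fix i assume i: "v \<le> i" "Suc i < letter_rank b"
      have "cnt T r i = Suc c"
        using i bw by (intro cnt_r) (auto simp: less_eq_letter_def)
      moreover have "cnt T (Suc r) (Suc i) \<le> c" using i by (intro cnt_below)
      ultimately show "cnt T (Suc r) (Suc i) \<noteq> cnt T r i" by simp
    qed
    obtain m0 where m0: "letter_rank b = Suc m0" "v \<le> m0"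
      using vb' by (metis Suc_pred less_Suc_eq_le not_less0 gr0I)
    have "d (Suc m0) = Suc r"
    proof -
      have "cnt T r m0 = Suc c"
        using m0 bw by (intro cnt_r) (auto simp: less_eq_letter_def)
      moreover have "count_le (Suc m0) (T ! Suc r) = Suc c"
      proof (rule count_le_eqI[OF rows(1)[OF Sr(1)]])
        show "Suc c \<le> length (T ! Suc r)" using Sr by simp
        fix i assume "i < Suc c"
        then have "T ! Suc r ! i \<le> b"
          using rows(1)[OF Sr(1)] Sr(2) by (simp add: sorted_iff_nth_mono b_def)
        then show "letter_rank (T ! Suc r ! i) \<le> Suc m0" using m0 by (simp add: less_eq_letter_def)
      next
        assume a: "Suc c < length (T ! Suc r)"
        \<comment> \<open>The right neighbour of \<open>b\<close> stands below \<open>w\<close>,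
          hence exceeds \<open>w\<close> and thus \<open>b\<close>. So on the level of
          \<open>b\<close> the row below has exactly \<open>c + 1\<close> entries, and the test is
          met with equality.\<close>
        then have "right" "w < T ! Suc r ! Suc c"
          using cols[of r "Suc c"] Sr by (auto simp: right_def w_def)
        then show "Suc m0 < letter_rank (T ! Suc r ! Suc c)"
          using bw m0 by (simp add: less_eq_letter_def less_letter_def)
      qed
      ultimately have "cnt T (Suc r) (Suc m0) = cnt T r m0" using Sr by (simp add: cnt_def)
      then show ?thesis using run[OF m0(2)] stay'[OF m0(2)] m0 by simp
    qed
    then have dSr: "d (letter_rank b) = Suc r" using m0 by simp
    have ge: "Suc r \<le> d m" if "letter_rank b \<le> m" for m
      using mono[of "letter_rank b" m] dSr that vb' by simp
    have "(\<forall>R \<in> set (jeu_de_taquin (Suc r) c T1). sorted R \<and> R \<noteq> [])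
        \<and> (\<forall>q m. cnt (jeu_de_taquin (Suc r) c T1) q m
            = cnt T1 q m - of_bool (letter_rank b \<le> m \<and> d m = q))"
      unfolding T1_def
    proof (rule IH1[OF True ss1[unfolded T1_def]])
      fix m assume m: "letter_rank b \<le> m"
      then have "d m \<noteq> r" "Suc (d m) \<noteq> r" using ge[OF m] by auto
      then show "d (Suc m) = (if cnt (T[r := (T ! r)[c := b]]) (Suc (d m)) (Suc m)
          = cnt (T[r := (T ! r)[c := b]]) (d m) m then Suc (d m) else d m)"
        using run[of m] m vb' unfolding T1_def[symmetric] cntT1 by simp
    qed (use Sr dSr in \<open>auto simp: b_def\<close>)
    \<comment> \<open>Replacing the leftover by \<open>b\<close> already takes one entry from row
      \<open>r\<close> on the levels between \<open>v\<close> and the rank of \<open>b\<close>,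
      which are the levels on which the hole is in row \<open>r\<close>; from the rank of
      \<open>b\<close> on, the induction hypothesis accounts for the loss.\<close>
    moreover have "cnt T1 q m - of_bool (letter_rank b \<le> m \<and> d m = q)
        = cnt T q m - of_bool (v \<le> m \<and> d m = q)" for q m
    proof (cases "letter_rank b \<le> m")
      case True
      then show ?thesis using ge[OF True] vb' pos[of m] by (auto simp: cntT1)
    next
      case False
      then show ?thesis using stay'[of m] by (auto simp: cntT1)
    qed
    ultimately show ?thesis using True by (simp add: jdt T1_def)
  next
    case nP: False
    show ?thesis
    proof (cases right)
      case True
      have wb: "w < b" if below using nP that True by (auto simp: P_def)
      have Sc: "Suc c < length (T ! r)" using True by (simp add: right_def)
      have vw: "T ! r ! c \<le> w" using sr Sc by (simp add: w_def sorted_iff_nth_mono)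
      then have vw': "v \<le> letter_rank w" by (simp add: v less_eq_letter_def)
      define T1 where "T1 = T[r := (T ! r)[c := w]]"
      have sorted1: "sorted ((T ! r)[c := w])"
      proof (rule sorted_update[OF sr])
        show "T ! r ! i \<le> w" if "i < c" for i
          using le_c[of i] vw that by (meson less_imp_le order_trans)
      qed (simp add: w_def)
      have ss1: "semistandard_from r T1"
        unfolding semistandard_from_def
      proof (intro conjI ballI allI impI)
        fix R assume "R \<in> set T1"
        then have "R \<in> set T \<or> R = (T ! r)[c := w]"
          unfolding T1_def using set_update_subset_insert by fastforce
        moreover have "[] \<noteq> (T ! r)[c := w]" using c by (metis list_update_nonempty list.size(3) not_less_zero)
        ultimately show "sorted R" "R \<noteq> []"
          using sorted1 ss c by (auto simp: semistandard_from_def)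
      next
        fix q i assume q: "r \<le> q" "Suc q < length T1" "i < length (T1 ! Suc q)"
        then have q': "Suc q < length T" "i < length (T ! Suc q)" by (auto simp: T1_def)
        note cc = cols[OF q(1) q']
        show "i < length (T1 ! q)" using cc by (cases "q = r") (auto simp: T1_def r)
        have "w < T ! Suc q ! i" if "q = r" "i = c"
          using wb that q' by (auto simp: below_def b_def)
        then show "T1 ! q ! i < T1 ! Suc q ! i"
          using cc q q' r by (cases "q = r"; cases "i = c") (auto simp: T1_def)
      qed
      have cntT1: "cnt T1 q m = (if q = r then cnt T r m - of_bool (v \<le> m) + of_bool (letter_rank w \<le> m)
          else cnt T q m)" for q m
      proof (cases "q = r")
        case True
        have "cnt T r m = count_le m (T ! r)" using r by (simp add: cnt_def)
        then show ?thesis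
          using count_le_update[OF c, of m w] r v True pos[of m]
          by (cases "v \<le> m") (auto simp: T1_def cnt_update_row)
      qed (use r in \<open>simp add: T1_def cnt_update_row\<close>)
      have cntT1': "cnt T1 q m = cnt T q m" if "letter_rank w \<le> m" for q m
        using that vw' pos[of m] by (auto simp: cntT1)
      \<comment> \<open>In this branch \<open>w < b\<close>, so the hole is still in row
        \<open>r\<close> on the level of \<open>w\<close> itself, as the induction hypothesis
        requires.\<close>
      have stay': "d m = r" if "v \<le> m" "m \<le> letter_rank w" for m
      proof (rule stay[of m "Suc (letter_rank w)"])
        fix i assume i: "v \<le> i" "Suc i < Suc (letter_rank w)"
        have "cnt T r i = Suc c"
          using i by (intro cnt_r) auto
        moreover have "cnt T (Suc r) (Suc i) \<le> c"
          using i wb by (intro cnt_below) (auto simp: less_letter_def)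
        ultimately show "cnt T (Suc r) (Suc i) \<noteq> cnt T r i" by simp
      qed (use that in auto)
      have "(\<forall>R \<in> set (jeu_de_taquin r (Suc c) T1). sorted R \<and> R \<noteq> [])
          \<and> (\<forall>q m. cnt (jeu_de_taquin r (Suc c) T1) q m
              = cnt T1 q m - of_bool (letter_rank w \<le> m \<and> d m = q))"
        unfolding T1_def
      proof (rule IH2[OF nP True ss1[unfolded T1_def]])
        fix m assume m: "letter_rank w \<le> m"
        show "d (Suc m) = (if cnt (T[r := (T ! r)[c := w]]) (Suc (d m)) (Suc m)
            = cnt (T[r := (T ! r)[c := w]]) (d m) m then Suc (d m) else d m)"
          using run[of m] m vw' unfolding T1_def[symmetric] by (simp add: cntT1')
      qed (use r Sc stay'[OF vw'] in \<open>auto simp: w_def\<close>)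
      moreover have "cnt T1 q m - of_bool (letter_rank w \<le> m \<and> d m = q)
          = cnt T q m - of_bool (v \<le> m \<and> d m = q)" for q m
      proof (cases "letter_rank w \<le> m")
        case True
        then show ?thesis using vw' by (auto simp: cntT1')
      next
        case False
        then show ?thesis using stay'[of m] by (auto simp: cntT1)
      qed
      ultimately show ?thesis using nP True by (simp add: jdt T1_def)
    next
      case nr: False
      then have nb: "\<not> below" using nP by (auto simp: P_def)
      have len: "length (T ! r) = Suc c" using nr r c by (simp add: right_def)
      define T1 where "T1 = T[r := butlast (T ! r)]"
      have jd: "jeu_de_taquin r c T = filter (\<lambda>R. R \<noteq> []) T1" using nr nP by (simp add: jdt T1_def)
      have stay': "d m = r" if "v \<le> m" for m
      proof (rule stay[OF that])
        show "m < Suc m" by simp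
        fix i assume i: "v \<le> i"
        have "cnt T r i = Suc c" using i nr by (intro cnt_r) auto
        moreover have "cnt T (Suc r) (Suc i) \<le> c" using nb by (intro cnt_below) auto
        ultimately show "cnt T (Suc r) (Suc i) \<noteq> cnt T r i" by simp
      qed
      have split: "T ! r = butlast (T ! r) @ [T ! r ! c]"
        using len append_butlast_last_id[of "T ! r"] last_conv_nth[of "T ! r"] by fastforce
      have cb: "count_le m (butlast (T ! r)) = count_le m (T ! r) - of_bool (v \<le> m)" for m
        using arg_cong[OF split, of "count_le m"] v by simp
      have "cnt (filter (\<lambda>R. R \<noteq> []) T1) q m = cnt T1 q m" for q m
      proof (rule cnt_filter_nonempty[of T1 r])
        show "\<forall>q < length T1. q \<noteq> r \<longrightarrow> T1 ! q \<noteq> []" using rows(2) by (simp add: T1_def)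
        show "T1 ! r = [] \<longrightarrow> Suc r = length T1"
        proof
          assume "T1 ! r = []"
          then have "length (butlast (T ! r)) = 0" using r by (simp add: T1_def)
          then have "c = 0" using len by simp
          then have "\<not> Suc r < length T" using nb rows(2)[of "Suc r"] by (auto simp: below_def)
          then show "Suc r = length T1" using r by (simp add: T1_def)
        qed
      qed
      moreover have "cnt T1 q m = cnt T q m - of_bool (v \<le> m \<and> d m = q)" for q m
        unfolding T1_def cnt_update_row[OF r] using stay'[of m] r cb[of m] by (auto simp: cnt_def)
      moreover have "\<forall>R \<in> set T1. sorted R"
      proof
        fix R assume "R \<in> set T1"
        then have "R \<in> set T \<or> R = butlast (T ! r)"
          unfolding T1_def using set_update_subset_insert by fastforce
        then show "sorted R"
          using sr ss by (auto simp: semistandard_from_def sorted_butlast)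
      qed
      ultimately show ?thesis by (simp add: jd)
    qed
  qed
qed

section \<open>Berele insertion by levels\<close>

fun state_row :: "state \<Rightarrow> nat" where
  "state_row Unchanged = 0"
| "state_row (Added r) = r"
| "state_row (Pending r) = r"
| "state_row (Deleted r) = r"

lemma shift_other: "state_row s \<noteq> q \<Longrightarrow> shift s g q = g q"
  by (cases s) auto

lemma state_row_advance: "s \<noteq> Unchanged \<Longrightarrow> state_row s \<le> state_row (advance f m s)"
  by (cases s) (auto simp: enter_def)

lemma state_row_mono:
  assumes "s a \<noteq> Unchanged" "\<And>m. a \<le> m \<Longrightarrow> s (Suc m) = advance F m (s m)" "a \<le> m"
  shows "state_row (s a) \<le> state_row (s m) \<and> s m \<noteq> Unchanged"
  using assms(3)
proof (induction m rule: dec_induct)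
  case base
  then show ?case using assms(1) by simp
next
  case (step m)
  then show ?case
    using assms(2)[of m] state_row_advance[of "s m" F m] by (auto simp: advance_Unchanged)
qed

lemma state_row_enter [simp]: "state_row (enter F p a) = p" "enter F p a \<noteq> Unchanged"
  by (auto simp: enter_def)

lemma added_until:
  assumes "s a = Added p" "\<And>m. a \<le> m \<Longrightarrow> s (Suc m) = advance F m (s m)"
    "\<And>m. a \<le> m \<Longrightarrow> Suc m < b \<Longrightarrow> F p m = F p (Suc m)" "a \<le> m" "m < b"
  shows "s m = Added p"
  using assms(4,5)
proof (induction m rule: dec_induct)
  case (step m)
  then show ?case using assms(2)[of m] assms(3)[of m] by simp
qed (rule assms(1))

lemma first_index:
  assumes "\<exists>y \<in> set R. P y"
  shows "first_index P R < length R" "P (R ! first_index P R)"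
    "i < first_index P R \<Longrightarrow> \<not> P (R ! i)"
proof -
  have ex: "\<exists>j. j < length R \<and> P (R ! j)" using assms by (auto simp: in_set_conv_nth)
  from LeastI_ex[OF ex] show *: "first_index P R < length R" "P (R ! first_index P R)"
    unfolding first_index_def by blast+
  show "\<not> P (R ! i)" if "i < first_index P R"
    using not_less_Least[of i "\<lambda>j. j < length R \<and> P (R ! j)"] that *(1)
    unfolding first_index_def by auto
qed

lemma letter_rank_eq_iff:
  "letter_rank x = 2 * i \<longleftrightarrow> x = Plain i" "letter_rank x = Suc (2 * i) \<longleftrightarrow> x = Barred i"
  by (cases x; auto; presburger)+

lemma semistandard_from_Cons:
  "semistandard_from 0 (R # T) \<Longrightarrow> semistandard_from 0 T"
  unfolding semistandard_from_def by force

text \<open>By the King bound only copies of \<open>Plain (Suc p)\<close> precede the first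
  \<open>Barred (Suc p)\<close>, so after the replacement the row begins with
  \<open>Plain (Suc p)\<close> and the hole starts in column 0. The replacement lowers one rank from
  \<open>2 * p + 3\<close> to \<open>2 * p + 2\<close>, which only level \<open>2 * p + 2\<close>
  notices.\<close>

lemma cancel_row:
  assumes T: "semistandard_from 0 (R # T)"
    and bound: "\<And>r y. r < length (R # T) \<Longrightarrow> y \<in> set ((R # T) ! r) \<Longrightarrow> 2 * (p + r) + 2 \<le> letter_rank y"
    and B: "Barred (Suc p) \<in> set R"
  defines "R' \<equiv> R[first_index (\<lambda>y. y = Barred (Suc p)) R := Plain (Suc p)]"
  shows "semistandard_from 0 (R' # T)" "first_index (\<lambda>y. y = Plain (Suc p)) R' = 0"
    "0 < length R'" "R' ! 0 = Plain (Suc p)"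
    "count_le m R' = count_le m R + of_bool (m = 2 * p + 2)"
proof -
  define j where "j = first_index (\<lambda>y. y = Barred (Suc p)) R"
  have ex: "\<exists>y \<in> set R. y = Barred (Suc p)" using B by blast
  note j = first_index[OF ex, folded j_def]
  have R': "R' = R[j := Plain (Suc p)]" by (simp add: R'_def j_def)
  have sR: "sorted R" using T by (simp add: semistandard_from_def)
  have before: "R ! i = Plain (Suc p)" if "i < j" for i
  proof -
    have "R ! i \<le> Barred (Suc p)" using sR that j(1,2) by (metis less_imp_le sorted_nth_mono)
    moreover have "2 * p + 2 \<le> letter_rank (R ! i)" using bound[of 0 "R ! i"] that j(1) by simp
    moreover have "letter_rank (R ! i) \<noteq> Suc (2 * Suc p)"
      using j(3)[OF that] letter_rank_eq_iff(2) by blast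
    ultimately have "letter_rank (R ! i) = 2 * Suc p" by (simp add: less_eq_letter_def)
    then show ?thesis using letter_rank_eq_iff(1) by blast
  qed
  have le: "R' ! i \<le> R ! i" for i
    using j(1,2) by (cases "i = j") (simp_all add: R' less_eq_letter_def)
  have "sorted R'"
    unfolding R'
  proof (rule sorted_update[OF sR])
    show "R ! i \<le> Plain (Suc p)" if "i < j" for i using before[OF that] by simp
    show "Plain (Suc p) \<le> R ! Suc j" if "Suc j < length R"
      using bound[of 0 "R ! Suc j"] that by (simp add: less_eq_letter_def)
  qed
  moreover have "R' \<noteq> []" using B by (auto simp: R')
  ultimately show "semistandard_from 0 (R' # T)"
    unfolding semistandard_from_def
  proof (intro conjI ballI allI impI)
    fix Q assume "sorted R'" "R' \<noteq> []" "Q \<in> set (R' # T)"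
    then show "sorted Q" "Q \<noteq> []" using T by (auto simp: semistandard_from_def)
  next
    fix q c assume q: "Suc q < length (R' # T)" "c < length ((R' # T) ! Suc q)"
    then have *: "c < length ((R # T) ! q)" "(R # T) ! q ! c < (R # T) ! Suc q ! c"
      using T unfolding semistandard_from_def by auto
    then show "c < length ((R' # T) ! q)" by (cases q) (simp_all add: R')
    show "(R' # T) ! q ! c < (R' # T) ! Suc q ! c"
      using * le[of c] by (cases q) auto
  qed
  show "0 < length R'" using \<open>R' \<noteq> []\<close> by simp
  show 0: "R' ! 0 = Plain (Suc p)" using before[of 0] j(1) by (cases j) (simp_all add: R')
  have "first_index (\<lambda>y. y = Plain (Suc p)) R' = (LEAST i. i < length R' \<and> R' ! i = Plain (Suc p))"
    by (simp add: first_index_def)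
  also have "\<dots> = 0" using 0 \<open>0 < length R'\<close> by (intro Least_equality) auto
  finally show "first_index (\<lambda>y. y = Plain (Suc p)) R' = 0" .
  show "count_le m R' = count_le m R + of_bool (m = 2 * p + 2)"
    using count_le_update[OF j(1), of m "Plain (Suc p)"] unfolding R' j(2)
    by (cases "m < 2 * p + 2"; cases "m = 2 * p + 2") auto
qed

text \<open>The replacement adds an entry on level \<open>2 * p + 2\<close> alone, and emptying the
  first box removes one from that level on. The balance is zero on level \<open>2 * p + 2\<close>,
  which is the state \<open>Pending p\<close>, and a loss from \<open>2 * p + 3\<close> on.\<close>

lemma insert_from_cancel_cnt:
  assumes T: "semistandard_from 0 (R # T)"
    and bound: "\<And>r y. r < length (R # T) \<Longrightarrow> y \<in> set ((R # T) ! r) \<Longrightarrow> 2 * (p + r) + 2 \<le> letter_rank y"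
    and B: "Barred (Suc p) \<in> set R"
    and F: "\<And>r m. F (p + r) m = cnt (R # T) r m"
    and s: "s (2 * p + 2) = Pending p" "\<And>m. 2 * p + 2 \<le> m \<Longrightarrow> s (Suc m) = advance F m (s m)"
  shows "(\<forall>Q \<in> set (insert_from (Suc p) (R # T) (Plain (Suc p))). sorted Q \<and> Q \<noteq> [])
    \<and> (\<forall>r m. cnt (insert_from (Suc p) (R # T) (Plain (Suc p))) r m
        = (if m < 2 * p + 2 then cnt (R # T) r m else shift (s m) (\<lambda>q. F q m) (p + r)))"
proof -
  define R' where "R' = R[first_index (\<lambda>y. y = Barred (Suc p)) R := Plain (Suc p)]"
  note R' = cancel_row[OF T bound B, folded R'_def]
  define d where "d m = (if m < 2 * p + 3 then 0 else state_row (s m) - p)" for m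
  have del: "s m = Deleted (p + d m)" if "2 * p + 3 \<le> m" for m
    using that
  proof (induction m rule: dec_induct)
    case base
    have "s (Suc (2 * p + 2)) = Deleted p" using s by simp
    then show ?case by (simp add: d_def numeral_3_eq_3)
  next
    case (step m)
    then obtain q where "s m = Deleted (p + q)" by blast
    then have "s (Suc m) = Deleted (p + q) \<or> s (Suc m) = Deleted (p + Suc q)"
      using s(2)[of m] step(1) by simp
    then show ?case using step(1) by (auto simp: d_def)
  qed
  have ins: "insert_from (Suc p) (R # T) (Plain (Suc p)) = jeu_de_taquin 0 0 (R' # T)"
    using B R'(2) by (simp add: R'_def Let_def)
  have cnt': "cnt (R' # T) r m = cnt (R # T) r m + of_bool (r = 0 \<and> m = 2 * p + 2)" for r m
    using R'(5) by (cases r) auto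
  have J: "(\<forall>Q \<in> set (jeu_de_taquin 0 0 (R' # T)). sorted Q \<and> Q \<noteq> [])
    \<and> (\<forall>q m. cnt (jeu_de_taquin 0 0 (R' # T)) q m
        = cnt (R' # T) q m - of_bool (2 * p + 2 \<le> m \<and> d m = q))"
  proof (rule jeu_de_taquin_cnt[OF R'(1)])
    show "d (2 * p + 2) = 0" by (simp add: d_def)
    show "2 * p + 2 = letter_rank ((R' # T) ! 0 ! 0)" using R'(4) by simp
    fix m assume m: "2 * p + 2 \<le> m"
    show "d (Suc m) = (if cnt (R' # T) (Suc (d m)) (Suc m) = cnt (R' # T) (d m) m
      then Suc (d m) else d m)"
    proof (cases "m = 2 * p + 2")
      case True
      \<comment> \<open>The hole cannot move down on its first level: by the King bound the next row
        contains only letters of rank at least \<open>2 * p + 4\<close>.\<close>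
      have "cnt (R # T) (Suc 0) (2 * p + 3) = 0"
      proof -
        have "count_le (2 * p + 3) (T ! 0) = 0" if "0 < length T"
          unfolding count_le_def length_0_conv filter_empty_conv
        proof
          fix y assume "y \<in> set (T ! 0)"
          then have "2 * (p + 1) + 2 \<le> letter_rank y" using bound[of 1 y] that by simp
          then show "\<not> letter_rank y \<le> 2 * p + 3" by simp
        qed
        then show ?thesis by (simp add: cnt_def)
      qed
      moreover have "s (2 * p + 3) = Deleted p"
        using s by (simp add: numeral_3_eq_3)
      then have "d (2 * p + 3) = 0" by (simp add: d_def)
      moreover have "d (2 * p + 2) = 0" by (simp add: d_def)
      moreover have "Suc (2 * p + 2) = 2 * p + 3" by simp
      ultimately show ?thesis using True cnt'[of 0 m] cnt'[of 1 "2 * p + 3"] by (simp add: numeral_3_eq_3)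
    next
      case False
      then have m: "2 * p + 3 \<le> m" using m by simp
      have "cnt (R' # T) q m = F (p + q) m" "cnt (R' # T) q (Suc m) = F (p + q) (Suc m)" for q
        using m by (simp_all add: cnt' F)
      moreover have "s (Suc m) = advance F m (Deleted (p + d m))"
        using s(2)[of m] del[OF m] m by simp
      then have "Deleted (p + d (Suc m)) = advance F m (Deleted (p + d m))"
        using del[of "Suc m"] m by simp
      ultimately show ?thesis by (simp del: cnt_Cons split: if_splits)
    qed
  qed (use R'(3) in auto)
  have "cnt (R' # T) r m - of_bool (2 * p + 2 \<le> m \<and> d m = r)
      = (if m < 2 * p + 2 then cnt (R # T) r m else shift (s m) (\<lambda>q. F q m) (p + r))" for r m
  proof -
    consider "m < 2 * p + 2" | "m = 2 * p + 2" | "2 * p + 3 \<le> m" by linarith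
    then show ?thesis
    proof cases
      case 1
      then show ?thesis by (simp add: cnt')
    next
      case 2
      then have "s m = Pending p" "d m = 0" using s by (simp_all add: d_def)
      then show ?thesis using 2 by (simp add: cnt' F)
    next
      case 3
      then show ?thesis using del[OF 3] by (auto simp: cnt' F)
    qed
  qed
  then show ?thesis using J unfolding ins by simp
qed

text \<open>The tableau \<open>T\<close> consists of the rows \<open>p, p + 1, \<dots>\<close> of the tableau with level function \<open>F\<close>.\<close>
lemma insert_from_cnt:
  assumes "semistandard_from 0 T"
    "\<And>r y. r < length T \<Longrightarrow> y \<in> set (T ! r) \<Longrightarrow> 2 * (p + r) + 2 \<le> letter_rank y"
    "\<And>r m. F (p + r) m = cnt T r m"
    "s (letter_rank x) = enter F p (letter_rank x)"
    "\<And>m. letter_rank x \<le> m \<Longrightarrow> s (Suc m) = advance F m (s m)"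
  shows "(\<forall>R \<in> set (insert_from (Suc p) T x). sorted R \<and> R \<noteq> [])
    \<and> (\<forall>r m. cnt (insert_from (Suc p) T x) r m
        = (if m < letter_rank x then cnt T r m else shift (s m) (\<lambda>q. F q m) (p + r)))"
  using assms
proof (induction T arbitrary: p x)
  case Nil
  note F = Nil(3) and s = Nil(4,5)
  have F0: "F p m = 0" for m using F[of 0 m] by simp
  then have "s (letter_rank x) = Added p" using s(1) by (simp add: enter_def)
  then have "s m = Added p" if "letter_rank x \<le> m" for m
    using added_until[of s _ p F "Suc m", OF _ s(2)] F0 that by simp
  moreover have "cnt [[x]] r m = of_bool (r = 0 \<and> letter_rank x \<le> m)" for r m
    by (cases r) auto
  ultimately show ?case using F F0 by (auto simp: Nil(3))
next
  case (Cons R T)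
  note IH = Cons(1) and ss = Cons(2) and bound = Cons(3) and F = Cons(4) and s = Cons(5,6)
  let ?x = "letter_rank x"
  have sR: "sorted R" "R \<noteq> []" using ss by (simp_all add: semistandard_from_def)
  have F0: "F p m = count_le m R" for m using F[of 0 m] by simp
  show ?case
  proof (cases "x = Plain (Suc p) \<and> Barred (Suc p) \<in> set R")
    case True
    then have x: "x = Plain (Suc p)" and B: "Barred (Suc p) \<in> set R" by auto
    have "F p (2 * p + 2) < F p (Suc (2 * p + 2))"
      unfolding F0 count_le_Suc using B by (intro bexI[of _ "Barred (Suc p)"]) auto
    then have "s (2 * p + 2) = Pending p" using s(1) by (simp add: x enter_def)
    then show ?thesis
      using insert_from_cancel_cnt[OF ss bound B F, of s] s(2) unfolding x by simp
  next
    case nc: False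
    \<comment> \<open>The levelwise test of \<open>enter\<close> agrees with the test on letters in
      \<open>insert_from\<close>: row \<open>p\<close> grows from level \<open>2 * p + 2\<close> to
      the next exactly when it contains \<open>Barred (Suc p)\<close>.\<close>
    have "\<not> (?x = 2 * p + 2 \<and> F p ?x < F p (Suc ?x))"
    proof
      assume a: "?x = 2 * p + 2 \<and> F p ?x < F p (Suc ?x)"
      then have "x = Plain (Suc p)" using letter_rank_eq_iff(1)[of x "Suc p"] by simp
      moreover obtain y where y: "y \<in> set R" "letter_rank y = Suc ?x"
        using a unfolding F0 count_le_Suc by blast
      have "letter_rank y = Suc (2 * Suc p)" using a y(2) by simp
      then have "Barred (Suc p) \<in> set R" using y(1) unfolding letter_rank_eq_iff(2) by simp
      ultimately show False using nc by blast
    qed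
    then have sx: "s ?x = Added p" unfolding s(1) enter_def by (rule if_not_P)
    show ?thesis
    proof (cases "\<exists>y \<in> set R. x < y")
      case False
      have "count_le m R = length R" if "?x \<le> m" for m
      proof (rule count_le_eqI[OF sR(1)])
        fix c assume "c < length R"
        then have "\<not> x < R ! c" using False by auto
        then show "letter_rank (R ! c) \<le> m" using that by (simp add: less_letter_def)
      qed auto
      then have sA: "s m = Added p" if "?x \<le> m" for m
        using added_until[of s ?x p F "Suc m", OF sx s(2)] F0 that by simp
      have "cnt ((R @ [x]) # T) r m
        = (if m < ?x then cnt (R # T) r m else shift (s m) (\<lambda>q. F q m) (p + r))" for r m
        using sA[of m] F[of r m] by (cases r) auto
      moreover have "sorted (R @ [x])" using sR False by (auto simp: sorted_append not_less)
      moreover have "insert_from (Suc p) (R # T) x = (R @ [x]) # T"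
        unfolding insert_from.simps if_not_P[OF nc] if_not_P[OF False] ..
      ultimately show ?thesis using ss by (auto simp: semistandard_from_def)
    next
      case True
      define j where "j = first_index (\<lambda>y. x < y) R"
      note j = first_index[OF True, folded j_def]
      define z where "z = R ! j"
      let ?z = "letter_rank z"
      have xz: "?x < ?z" using j(2) by (simp add: less_letter_def z_def)
      have before: "letter_rank (R ! i) \<le> ?x" if "i < j" for i
        using j(3)[OF that] by (simp add: less_letter_def)
      have cj: "F p m = j" if "?x \<le> m" "m < ?z" for m
        unfolding F0
      proof (rule count_le_eqI[OF sR(1)])
        show "letter_rank (R ! c) \<le> m" if "c < j" for c
          using before[OF that] \<open>?x \<le> m\<close> by simp
      qed (use j(1) \<open>m < ?z\<close> in \<open>auto simp: z_def\<close>)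
      have sA: "s m = Added p" if "?x \<le> m" "m < ?z" for m
        using added_until[of s ?x p F ?z, OF sx s(2)] cj that by simp
      obtain m0 where m0: "?z = Suc m0" "?x \<le> m0"
        using xz by (metis Suc_pred less_Suc_eq_le not_less0 gr0I)
      have "F p m0 < F p (Suc m0)"
        unfolding F0 count_le_Suc using j(1) m0 by (intro bexI[of _ z]) (auto simp: z_def)
      then have sz: "s ?z = enter F (Suc p) ?z"
        using s(2)[of m0] sA[of m0] m0 by simp
      have I: "(\<forall>R \<in> set (insert_from (Suc (Suc p)) T z). sorted R \<and> R \<noteq> [])
        \<and> (\<forall>r m. cnt (insert_from (Suc (Suc p)) T z) r m
            = (if m < ?z then cnt T r m else shift (s m) (\<lambda>q. F q m) (Suc p + r)))"
      proof (rule IH)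
        show "semistandard_from 0 T" using ss by (rule semistandard_from_Cons)
        show "2 * (Suc p + r) + 2 \<le> letter_rank y" if "r < length T" "y \<in> set (T ! r)" for r y
          using bound[of "Suc r" y] that by simp
        show "F (Suc p + r) m = cnt T r m" for r m using F[of "Suc r" m] by simp
        show "s ?z = enter F (Suc p) ?z" by (rule sz)
        show "s (Suc m) = advance F m (s m)" if "?z \<le> m" for m using s(2) xz that by simp
      qed
      have ins: "insert_from (Suc p) (R # T) x = R[j := x] # insert_from (Suc (Suc p)) T z"
        unfolding insert_from.simps if_not_P[OF nc] if_P[OF True] Let_def j_def z_def ..
      \<comment> \<open>From the rank of \<open>z\<close> on, the change happens strictly below row
        \<open>p\<close>: there \<open>x\<close> has merely taken the place of \<open>z\<close>, and
        both are counted on these levels.\<close>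
      have late: "Suc p \<le> state_row (s m)" if "?z \<le> m" for m
      proof -
        have "state_row (s ?z) \<le> state_row (s m) \<and> s m \<noteq> Unchanged"
          using state_row_mono[of s ?z F m] sz s(2) xz that by simp
        then show ?thesis using sz by simp
      qed
      have cR: "count_le m (R[j := x]) = (if m < ?x then count_le m R
          else shift (s m) (\<lambda>q. F q m) p)" for m
      proof -
        have *: "count_le m (R[j := x]) + of_bool (?z \<le> m) = count_le m R + of_bool (?x \<le> m)"
          using count_le_update[OF j(1), of m x] by (simp add: z_def)
        consider "m < ?x" | "?x \<le> m" "m < ?z" | "?z \<le> m" by linarith
        then show ?thesis
        proof cases
          case 3
          then have "state_row (s m) \<noteq> p" using late[of m] by simp
          then show ?thesis using * 3 xz F0 by (simp add: shift_other)
        qed (use * xz sA F0 in auto)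
      qed
      have "cnt (R[j := x] # insert_from (Suc (Suc p)) T z) r m
          = (if m < ?x then cnt (R # T) r m else shift (s m) (\<lambda>q. F q m) (p + r))" for r m
      proof (cases r)
        case 0
        then show ?thesis using cR by simp
      next
        case (Suc q)
        show ?thesis
        proof (cases "m < ?z")
          case True
          then show ?thesis using I sA[of m] F[of r m] xz Suc by auto
        next
          case False
          then show ?thesis using I xz Suc by simp
        qed
      qed
      moreover have "sorted (R[j := x])"
      proof (rule sorted_update[OF sR(1)])
        show "R ! i \<le> x" if "i < j" for i using before[OF that] by (simp add: less_eq_letter_def)
        show "x \<le> R ! Suc j" if "Suc j < length R"
        proof -
          have "z \<le> R ! Suc j" using sR(1) that by (simp add: z_def sorted_iff_nth_mono)
          then show ?thesis using xz by (simp add: less_eq_letter_def)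
        qed
      qed
      moreover have "R[j := x] \<noteq> []" using sR(2) by simp
      ultimately show ?thesis using I unfolding ins by simp
    qed
  qed
qed

section \<open>King tableaux and their level functions\<close>

text \<open>The King tableaux of all partition shapes at once, described by level functions so that
  the results on \<open>grow\<close> apply; \<open>KT_eq\<close> gives the link with
  \<open>KT\<close>.\<close>

definition tableaux :: "nat \<Rightarrow> tableau set" where
  "tableaux k = {T. semistandard_from 0 T \<and> king k (cnt T)}"

definition row :: "nat list \<Rightarrow> nat \<Rightarrow> nat" where
  "row \<mu> r = (if r < length \<mu> then \<mu> ! r else 0)"

lemma letters_iff: "y \<in> letters k \<longleftrightarrow> 2 \<le> letter_rank y \<and> letter_rank y \<le> 2 * k + 1"
  by (cases y) (auto simp: letters_def)

lemma count_le_mono: "m \<le> n \<Longrightarrow> count_le m R \<le> count_le n R"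
  by (induction R) auto

lemma count_le_full: "(\<And>y. y \<in> set R \<Longrightarrow> letter_rank y \<le> m) \<Longrightarrow> count_le m R = length R"
  by (simp add: count_le_def filter_id_conv)

lemma count_le_inject:
  assumes "sorted R" "sorted R'" "\<And>m. count_le m R = count_le m R'"
  shows "R = R'"
proof (rule nth_equalityI)
  have "length R \<le> length R'" if "\<And>m. count_le m R = count_le m R'" for R R'
  proof -
    obtain m where "\<forall>y \<in> letter_rank ` set R. y \<le> m"
      using finite_nat_set_iff_bounded_le[of "letter_rank ` set R"] by auto
    then have "count_le m R = length R" by (intro count_le_full) auto
    then show ?thesis using that[of m] count_le_length[of m R'] by simp
  qed
  from this[of R R'] this[of R' R] assms(3) show len: "length R = length R'" by auto
  fix c assume c: "c < length R"
  then have "letter_rank (R ! c) \<le> m \<longleftrightarrow> letter_rank (R' ! c) \<le> m" for m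
    using less_count_le_iff[OF assms(1), of c m] less_count_le_iff[OF assms(2), of c m] assms(3) len
    by simp
  then have "letter_rank (R ! c) = letter_rank (R' ! c)" by (meson order_antisym order_refl)
  then show "R ! c = R' ! c" by (simp add: letter_rank_inject)
qed

lemma cnt_inject:
  assumes "semistandard_from 0 T" "semistandard_from 0 T'" "cnt T = cnt T'"
  shows "T = T'"
proof (rule nth_equalityI)
  have "length T \<le> length T'" if T: "semistandard_from 0 T" and eq: "cnt T = cnt T'" for T T'
  proof (rule ccontr)
    assume l: "\<not> ?thesis"
    then have ne: "T ! length T' \<noteq> []" using T by (auto simp: semistandard_from_def)
    obtain y where "y \<in> set (T ! length T')" using ne by (cases "T ! length T'") auto
    then have "count_le (letter_rank y) (T ! length T') \<noteq> 0"
      by (auto simp: count_le_def filter_empty_conv)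
    then have "cnt T (length T') (letter_rank y) \<noteq> cnt T' (length T') (letter_rank y)"
      using l by (simp add: cnt_def)
    then show False using eq by simp
  qed
  from this[of T T'] this[of T' T] assms show len: "length T = length T'" by auto
  fix r assume r: "r < length T"
  show "T ! r = T' ! r"
  proof (rule count_le_inject)
    show "sorted (T ! r)" "sorted (T' ! r)" using assms(1,2) r len by (simp_all add: semistandard_from_def)
    show "count_le m (T ! r) = count_le m (T' ! r)" for m
      using fun_cong[OF fun_cong[OF assms(3), of r], of m] r len by (simp add: cnt_def)
  qed
qed

text \<open>Column strictness results from interlacing at the rank of an entry, one level lower in
  the row above. Vanishing on level 0 ensures that this rank is a successor.\<close>

lemma semistandard_from_cnt:
  assumes rows: "\<forall>R \<in> set T. sorted R \<and> R \<noteq> []"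
    and interlace: "\<And>r m. cnt T (Suc r) (Suc m) \<le> cnt T r m" and zero: "\<And>r. cnt T r 0 = 0"
  shows "semistandard_from 0 T"
  unfolding semistandard_from_def
proof (intro conjI allI impI)
  show "\<forall>R \<in> set T. sorted R \<and> R \<noteq> []" by (rule rows)
  fix q c assume q: "Suc q < length T" "c < length (T ! Suc q)"
  then have s: "sorted (T ! q)" "sorted (T ! Suc q)" using rows by simp_all
  let ?m = "letter_rank (T ! Suc q ! c)"
  have "c < cnt T (Suc q) ?m" using less_count_le_iff[OF s(2) q(2), of ?m] q by (simp add: cnt_def)
  moreover from this obtain m where m: "?m = Suc m" using zero[of "Suc q"] by (cases ?m) auto
  ultimately have *: "c < count_le m (T ! q)" using interlace[of q m] q by (simp add: cnt_def)
  then show c: "c < length (T ! q)" using count_le_length[of m "T ! q"] by simp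
  show "T ! q ! c < T ! Suc q ! c"
    using less_count_le_iff[OF s(1) c, of m] * m by (simp add: less_letter_def)
qed

lemma tableaux_entry:
  assumes T: "T \<in> tableaux k" and r: "r < length T" and y: "y \<in> set (T ! r)"
  shows "2 * r + 2 \<le> letter_rank y" "letter_rank y \<le> 2 * k + 1"
proof -
  have s: "sorted (T ! r)" and f: "king k (cnt T)"
    using T r by (simp_all add: tableaux_def semistandard_from_def)
  obtain c where c: "c < length (T ! r)" "y = T ! r ! c" using y by (auto simp: in_set_conv_nth)
  let ?m = "letter_rank y"
  have *: "c < cnt T r ?m" using less_count_le_iff[OF s c(1), of ?m] c(2) r by (simp add: cnt_def)
  then show "2 * r + 2 \<le> ?m" using king_pos[OF f, of r ?m] by simp
  show "?m \<le> 2 * k + 1"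
  proof (rule ccontr)
    assume a: "\<not> ?m \<le> 2 * k + 1"
    then have "cnt T r ?m = cnt T r (2 * k + 1)" by (intro kingD(4)[OF f]) simp
    then have "c < count_le (2 * k + 1) (T ! r)" using * r by (simp add: cnt_def)
    then show False using less_count_le_iff[OF s c(1), of "2 * k + 1"] c(2) a by simp
  qed
qed

lemma cnt_final: "T \<in> tableaux k \<Longrightarrow> cnt T r (2 * k + 1) = row (shape T) r"
  using tableaux_entry(2)[of T k r]
  by (auto simp: cnt_def row_def shape_def intro!: count_le_full simp del: One_nat_def)

lemma tableaux_shape:
  assumes T: "T \<in> tableaux k"
  shows "is_partition (shape T)" "length (shape T) \<le> k"
proof -
  have s: "semistandard_from 0 T" using T by (simp add: tableaux_def)
  have rows: "\<forall>R \<in> set T. R \<noteq> []" using s by (simp add: semistandard_from_def)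
  have "length (T ! Suc q) \<le> length (T ! q)" if "Suc q < length T" for q
    using s that unfolding semistandard_from_def
    by (metis le0 less_Suc_eq_le less_le_not_le linorder_not_le)
  then have "sorted_wrt (\<ge>) (shape T)"
    unfolding shape_def by (intro iffD2[OF sorted_wrt_iff_nth_Suc_transp]) (auto simp: transp_def)
  then show "is_partition (shape T)" using rows by (auto simp: is_partition_def shape_def)
  show "length (shape T) \<le> k"
  proof (cases "length T")
    case (Suc n)
    then have "T ! n \<noteq> []" using rows by simp
    then obtain y where "y \<in> set (T ! n)" by (cases "T ! n") auto
    then show ?thesis using tableaux_entry[OF T, of n y] Suc by (simp add: shape_def)
  qed (simp add: shape_def)
qed

lemma KT_eq:
  assumes \<mu>: "is_partition \<mu>"
  shows "KT k \<mu> = {T \<in> tableaux k. shape T = \<mu>}"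
proof (intro set_eqI iffI)
  fix T assume T: "T \<in> KT k \<mu>"
  then have sh: "shape T = \<mu>" and lets: "\<forall>R \<in> set T. set R \<subseteq> letters k" and so: "\<forall>R \<in> set T. sorted R"
    and col: "\<And>r c. Suc r < length T \<Longrightarrow> c < length (T ! Suc r) \<Longrightarrow> T ! r ! c < T ! Suc r ! c"
    and bd: "\<And>r x. r < length T \<Longrightarrow> x \<in> set (T ! r) \<Longrightarrow> Plain (Suc r) \<le> x"
    by (auto simp: KT_def)
  have ne: "\<forall>R \<in> set T. R \<noteq> []" using \<mu> sh by (auto simp: is_partition_def shape_def)
  have len: "length (T ! Suc q) \<le> length (T ! q)" if "Suc q < length T" for q
    using \<mu> that unfolding sh[symmetric] is_partition_def shape_def
    by (auto dest!: sorted_wrt_nth_less[of _ _ q "Suc q"])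
  have ss: "semistandard_from 0 T"
    unfolding semistandard_from_def using so ne col len by (meson less_le_trans)
  moreover have "king k (cnt T)"
    unfolding king_def
  proof (intro conjI allI impI)
    fix r m
    show "cnt T r m \<le> cnt T r (Suc m)" by (simp add: cnt_def count_le_mono)
    show "cnt T (Suc r) (Suc m) \<le> cnt T r m"
    proof (rule ccontr)
      assume a: "\<not> ?thesis"
      define c where "c = cnt T r m"
      have r: "Suc r < length T" using a by (auto simp: cnt_def split: if_splits)
      have s: "sorted (T ! r)" "sorted (T ! Suc r)" using so r by simp_all
      have c1: "c < count_le (Suc m) (T ! Suc r)" using a r by (simp add: c_def cnt_def)
      then have c2: "c < length (T ! Suc r)" using count_le_length[of "Suc m" "T ! Suc r"] by simp
      then have c3: "c < length (T ! r)" using len[OF r] by simp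
      have "letter_rank (T ! Suc r ! c) \<le> Suc m" using less_count_le_iff[OF s(2) c2] c1 by simp
      then have "letter_rank (T ! r ! c) \<le> m" using col[OF r c2] by (simp add: less_letter_def)
      then have "c < count_le m (T ! r)" using less_count_le_iff[OF s(1) c3] by simp
      then show False using r by (simp add: c_def cnt_def)
    qed
    show "cnt T r m = 0" if "m < 2 * r + 2"
      using bd[of r] that by (fastforce simp: cnt_def count_le_def filter_empty_conv less_eq_letter_def)
    have "count_le n R = length R" if "2 * k + 1 \<le> n" "R \<in> set T" for n R
      using lets that by (intro count_le_full) (force simp: letters_iff)
    then show "cnt T r m = cnt T r (2 * k + 1)" if "2 * k + 1 \<le> m"
      using that by (simp add: cnt_def)
  qed
  ultimately show "T \<in> {T \<in> tableaux k. shape T = \<mu>}" using sh by (simp add: tableaux_def)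
next
  fix T assume "T \<in> {T \<in> tableaux k. shape T = \<mu>}"
  then have T: "T \<in> tableaux k" and sh: "shape T = \<mu>" by auto
  have ss: "semistandard_from 0 T" using T by (simp add: tableaux_def)
  have "set R \<subseteq> letters k" if "R \<in> set T" for R
  proof
    fix y assume y: "y \<in> set R"
    obtain r where "r < length T" "R = T ! r" using \<open>R \<in> set T\<close> unfolding in_set_conv_nth by blast
    then show "y \<in> letters k" using tableaux_entry[OF T, of r y] y by (simp add: letters_iff)
  qed
  moreover have "Plain (Suc r) \<le> y" if "r < length T" "y \<in> set (T ! r)" for r y
    using tableaux_entry(1)[OF T that] by (simp add: less_eq_letter_def)
  ultimately show "T \<in> KT k \<mu>"
    using ss sh unfolding KT_def semistandard_from_def by simp
qed

section \<open>Tableaux with a prescribed level function\<close>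

text \<open>Letters are appended in order of rank, \<open>h (Suc n) - h n\<close> copies of the
  letter of rank \<open>Suc n\<close>; the parity of the rank tells whether it is plain or
  barred.\<close>

primrec row_word :: "(nat \<Rightarrow> nat) \<Rightarrow> nat \<Rightarrow> letter list" where
  "row_word h 0 = []"
| "row_word h (Suc n) = row_word h n @ replicate (h (Suc n) - h n)
     (if even (Suc n) then Plain (Suc n div 2) else Barred (Suc n div 2))"

lemma row_word:
  assumes "h 0 = 0" "\<And>m. h m \<le> h (Suc m)"
  shows "sorted (row_word h n) \<and> (\<forall>y \<in> set (row_word h n). letter_rank y \<le> n)
    \<and> count_le m (row_word h n) = h (min m n)"
proof (induction n)
  case 0
  then show ?case using assms(1) by simp
next
  case (Suc n)
  let ?y = "if even (Suc n) then Plain (Suc n div 2) else Barred (Suc n div 2)"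
  have y: "letter_rank ?y = Suc n"
    by (cases "even (Suc n)") (auto elim!: oddE evenE)
  have c: "count_le m (replicate a ?y) = (if Suc n \<le> m then a else 0)" for a
    unfolding count_le_def using y by (simp add: filter_replicate del: letter_rank.simps)
  have "z \<le> ?y" if "z \<in> set (row_word h n)" for z
    using Suc that y unfolding less_eq_letter_def by force
  then have "sorted (row_word h (Suc n))"
    using Suc by (auto simp: sorted_append)
  moreover have "\<forall>y \<in> set (row_word h (Suc n)). letter_rank y \<le> Suc n"
    using Suc y by (auto simp del: letter_rank.simps)
  moreover have "count_le m (row_word h (Suc n)) = h (min m (Suc n))"
    using Suc c[of "h (Suc n) - h n"] assms(2)[of n] by (auto simp: min_def le_Suc_eq)
  ultimately show ?case by blast
qed

lemma king_tableau:
  assumes f: "king k f"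
  obtains T where "T \<in> tableaux k" "cnt T = f"
proof -
  note kd = kingD[OF f]
  let ?K = "2 * k + 1"
  define N where "N = (LEAST r. f r ?K = 0)"
  \<comment> \<open>Row \<open>k\<close> is empty since its letters would have rank at least
    \<open>2 * k + 2\<close>; so \<open>N\<close>, the number of nonempty rows, is well
    defined.\<close>
  have "f k ?K = 0" by (rule kd(3)) simp
  then have N: "f N ?K = 0" unfolding N_def by (rule LeastI)
  have pos: "0 < f r ?K" if "r < N" for r using not_less_Least that unfolding N_def by blast
  have le: "f r m \<le> f r ?K" for r m
  proof (cases "m \<le> ?K")
    case True
    then show ?thesis using kd(1) by (rule lift_Suc_mono_le[rotated])
  qed (use kd(4)[of m r] in simp)
  have "f r ?K \<le> f N ?K" if "N \<le> r" for r
    using that by (rule lift_Suc_antimono_le[of "\<lambda>r. f r ?K", rotated]) (rule kd(5))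
  then have zero: "f r m = 0" if "N \<le> r" for r m using that le[of r m] N by (metis le_zero_eq)
  define T where "T = map (\<lambda>r. row_word (f r) ?K) [0..<N]"
  have len: "length T = N" and nth: "r < N \<Longrightarrow> T ! r = row_word (f r) ?K" for r
    by (simp_all add: T_def)
  have f0: "f r 0 = 0" for r by (rule kd(3)) simp
  note rw = row_word[of "f r" for r, OF f0 kd(1)]
  have min: "f r (min m ?K) = f r m" for r m
    using kd(4)[of m r] by (auto simp: min_def)
  have "cnt T r m = f r m" for r m
    using rw[of r ?K m] min[of r m] zero[of r m] by (simp add: cnt_def len nth)
  then have cnt: "cnt T = f" by blast
  have "\<forall>R \<in> set T. sorted R \<and> R \<noteq> []"
  proof
    fix R assume "R \<in> set T"
    then obtain r where r: "r < N" "R = row_word (f r) ?K" by (auto simp: T_def)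
    then show "sorted R \<and> R \<noteq> []"
      using rw[of r ?K ?K] pos[of r] by (auto simp del: row_word.simps)
  qed
  then have "semistandard_from 0 T"
    by (rule semistandard_from_cnt) (simp_all add: cnt kd f0)
  then show ?thesis using that[of T] f cnt by (simp add: tableaux_def)
qed

section \<open>Berele insertion as growth of level functions\<close>

lemma cnt_berele_insert:
  assumes T: "T \<in> tableaux k" and x: "x \<in> letters k"
  shows "cnt (berele_insert T x) = grow (cnt T) (letter_rank x)" "berele_insert T x \<in> tableaux k"
proof -
  have f: "king k (cnt T)" and ss: "semistandard_from 0 T" using T by (auto simp: tableaux_def)
  have x2: "2 \<le> letter_rank x" "letter_rank x \<le> 2 * k + 1" using x by (auto simp: letters_iff)
  let ?s = "trace (cnt T) (letter_rank x)"
  have I: "(\<forall>R \<in> set (insert_from (Suc 0) T x). sorted R \<and> R \<noteq> [])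
    \<and> (\<forall>r m. cnt (insert_from (Suc 0) T x) r m
        = (if m < letter_rank x then cnt T r m else shift (?s m) (\<lambda>q. cnt T q m) (0 + r)))"
  proof (rule insert_from_cnt[OF ss])
    show "2 * (0 + r) + 2 \<le> letter_rank y" if "r < length T" "y \<in> set (T ! r)" for r y
      using tableaux_entry(1)[OF T that] by simp
    obtain n where "letter_rank x = Suc n" using x2 by (cases "letter_rank x") auto
    then show "?s (letter_rank x) = enter (cnt T) 0 (letter_rank x)" by (simp add: trace.simps(2))
    show "?s (Suc m) = advance (cnt T) m (?s m)" if "letter_rank x \<le> m" for m
      using that by (simp add: trace.simps(2))
  qed simp
  have "cnt (berele_insert T x) r m = grow (cnt T) (letter_rank x) r m" for r m
    using I trace_Unchanged[OF x2(1), of "cnt T" m]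
    by (cases "m < letter_rank x") (simp_all add: berele_insert_def grow_def)
  then show cnt: "cnt (berele_insert T x) = grow (cnt T) (letter_rank x)" by blast
  have g: "king k (cnt (berele_insert T x))" unfolding cnt by (rule king_grow[OF f x2])
  have "\<forall>R \<in> set (berele_insert T x). sorted R \<and> R \<noteq> []"
    using I by (simp add: berele_insert_def)
  then have "semistandard_from 0 (berele_insert T x)"
    using kingD(2)[OF g] kingD(3)[OF g, of 0] by (rule semistandard_from_cnt) simp
  then show "berele_insert T x \<in> tableaux k" using g by (simp add: tableaux_def)
qed

definition change :: "nat \<Rightarrow> tableau \<Rightarrow> letter \<Rightarrow> state" where
  "change k T x = trace (cnt T) (letter_rank x) (2 * k + 1)"

text \<open>The last level \<open>2 * k + 1\<close> is odd, whereas \<open>Pending\<close> occurs on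
  even levels only; so the insertion has either gained or lost a box by then.\<close>

lemma change_cases:
  assumes T: "T \<in> tableaux k" and x: "x \<in> letters k"
  obtains r where "change k T x = Added r" | r where "change k T x = Deleted r" "0 < row (shape T) r"
proof -
  have f: "king k (cnt T)" using T by (auto simp: tableaux_def)
  have x2: "2 \<le> letter_rank x" "letter_rank x \<le> 2 * k + 1" using x by (auto simp: letters_iff)
  have "change k T x \<noteq> Unchanged" unfolding change_def trace_Unchanged[OF x2(1)] using x2 by simp
  moreover have adm: "admissible (cnt T) (2 * k + 1) (trace (cnt T) (letter_rank x) (2 * k)) (change k T x)"
    using trace_admissible[OF f x2(1), of "2 * k + 1"] by (simp add: change_def)
  have "change k T x \<noteq> Pending r" for r
  proof
    assume "change k T x = Pending r"
    then have "2 * k + 1 = 2 * r + 2" using adm by simp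
    then show False by presburger
  qed
  moreover have "0 < row (shape T) r" if "change k T x = Deleted r" for r
    using adm cnt_final[OF T, of r] unfolding that by simp
  ultimately show ?thesis using that by (cases "change k T x") auto
qed

lemma row_shape_berele_insert:
  assumes T: "T \<in> tableaux k" and x: "x \<in> letters k"
  shows "row (shape (berele_insert T x)) = shift (change k T x) (row (shape T))"
proof
  fix r
  have "row (shape (berele_insert T x)) r = grow (cnt T) (letter_rank x) r (2 * k + 1)"
    using cnt_final[OF cnt_berele_insert(2)[OF T x]] cnt_berele_insert(1)[OF T x] by simp
  then show "row (shape (berele_insert T x)) r = shift (change k T x) (row (shape T)) r"
    using cnt_final[OF T] by (simp add: grow_def change_def)
qed

lemma berele_insert_inject:
  assumes T: "T \<in> tableaux k" "x \<in> letters k" and T': "T' \<in> tableaux k" "x' \<in> letters k"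
    and eq: "berele_insert T x = berele_insert T' x'" "change k T x = change k T' x'"
  shows "T = T' \<and> x = x'"
proof -
  have "cnt T = cnt T' \<and> letter_rank x = letter_rank x'"
    using T T' eq cnt_berele_insert(1)[OF T] cnt_berele_insert(1)[OF T']
    by (intro grow_inject[of k]) (auto simp: tableaux_def letters_iff change_def)
  then show ?thesis using cnt_inject[of T T'] T T' by (auto simp: tableaux_def letter_rank_inject)
qed

text \<open>The side conditions say that row \<open>r\<close> ends in a removable corner, or that a
  box can be attached to row \<open>r\<close>. In the latter case \<open>r < k\<close> provides
  letters that are allowed in that row.\<close>

lemma berele_insert_surj:
  assumes T': "T' \<in> tableaux k"
    and s: "s = Added r \<and> row (shape T') (Suc r) < row (shape T') r
      \<or> s = Deleted r \<and> r < k \<and> (\<forall>q. r = Suc q \<longrightarrow> row (shape T') r < row (shape T') q)"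
  obtains T x where "T \<in> tableaux k" "x \<in> letters k" "berele_insert T x = T'" "change k T x = s"
proof -
  have g: "king k (cnt T')" and ss: "semistandard_from 0 T'" using T' by (auto simp: tableaux_def)
  have sp: "s = Added r \<or> s = Deleted r" using s by blast
  have K: "cnt T' r (Suc (2 * k + 1)) = cnt T' r (2 * k + 1)" for r by (rule kingD(4)[OF g]) simp
  have "0 < row (shape T') r \<Longrightarrow> 2 * r + 2 \<le> 2 * k + 1"
    using king_pos[OF g, of r "2 * k + 1"] cnt_final[OF T', of r] by simp
  then have "coadmissible (cnt T') (2 * k + 1) s s"
    using s K cnt_final[OF T'] by auto
  from grow_surj[OF g this sp] obtain f n where f: "king k f" "2 \<le> n" "n \<le> 2 * k + 1"
    "grow f n = cnt T'" "trace f n (2 * k + 1) = s" by blast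
  obtain T where T: "T \<in> tableaux k" "cnt T = f" using king_tableau[OF f(1)] .
  define x where "x = (if even n then Plain (n div 2) else Barred (n div 2))"
  have xn: "letter_rank x = n" by (auto simp: x_def)
  have x: "x \<in> letters k" using f(2,3) xn by (simp add: letters_iff)
  have "cnt (berele_insert T x) = cnt T'"
    unfolding cnt_berele_insert(1)[OF T(1) x] T(2) xn by (rule f(4))
  moreover have "semistandard_from 0 (berele_insert T x)"
    using cnt_berele_insert(2)[OF T(1) x] by (simp add: tableaux_def)
  ultimately have "berele_insert T x = T'" using cnt_inject ss by blast
  moreover have "change k T x = s" unfolding change_def T(2) xn by (rule f(5))
  ultimately show ?thesis using that[OF T(1) x] by blast
qed

text \<open>The two invariants cannot both hold for last states, since these are never
  \<open>Unchanged\<close> or \<open>Pending\<close>; hence the invariant for \<open>y < x\<close>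
  yields the converse implication.\<close>

lemma le_iff_in_order:
  assumes T: "T \<in> tableaux k" and x: "x \<in> letters k" and y: "y \<in> letters k"
  shows "x \<le> y \<longleftrightarrow> in_order (change k T x) (change k (berele_insert T x) y)"
proof -
  have f: "king k (cnt T)" using T by (auto simp: tableaux_def)
  have x2: "2 \<le> letter_rank x" "letter_rank x \<le> 2 * k + 1" using x by (auto simp: letters_iff)
  have y2: "2 \<le> letter_rank y" using y by (auto simp: letters_iff)
  note T' = cnt_berele_insert[OF T x]
  have "in_order (change k T x) (change k (berele_insert T x) y)" if "x \<le> y"
    using in_order_trace[OF f x2 _ T'(1)] that by (simp add: change_def less_eq_letter_def)
  moreover have "out_of_order (change k T x) (change k (berele_insert T x) y)" if "\<not> x \<le> y"
    using out_of_order_trace[OF f x2 _ y2 T'(1)] that by (simp add: change_def less_eq_letter_def)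
  moreover have "\<not> (in_order (change k T x) (change k (berele_insert T x) y)
    \<and> out_of_order (change k T x) (change k (berele_insert T x) y))"
    by (cases rule: change_cases[OF T x]; cases rule: change_cases[OF T'(2) y]) auto
  ultimately show ?thesis by blast
qed

section \<open>Oscillating tableaux and arrays\<close>

lemma mem_diagram: "(r, c) \<in> diagram \<mu> \<longleftrightarrow> c < row \<mu> r"
  by (auto simp: diagram_def row_def)

lemma row_inject:
  assumes "is_partition \<mu>" "is_partition \<nu>" "row \<mu> = row \<nu>"
  shows "\<mu> = \<nu>"
  using assms(1,2)
proof (rule diagram_inject)
  show "diagram \<mu> = diagram \<nu>"
    using assms(3) by (auto simp: mem_diagram set_eq_iff)
qed

lemma row_Suc_le: "is_partition \<mu> \<Longrightarrow> row \<mu> (Suc r) \<le> row \<mu> r"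
  by (auto simp: row_def is_partition_def dest!: sorted_wrt_nth_less[of _ _ r "Suc r"])

lemma row_Nil [simp]: "row [] r = 0"
  by (simp add: row_def)

lemma is_partition_Nil [simp]: "is_partition []"
  by (simp add: is_partition_def)

text \<open>A horizontal strip in terms of row lengths: the rows of the two shapes
  interlace.\<close>

definition strip :: "nat list \<Rightarrow> nat list \<Rightarrow> bool" where
  "strip \<nu> \<mu> \<longleftrightarrow> (\<forall>r. row \<nu> r \<le> row \<mu> r \<and> row \<mu> (Suc r) \<le> row \<nu> r)"

lemma strip_refl: "is_partition \<mu> \<Longrightarrow> strip \<mu> \<mu>"
  by (simp add: strip_def row_Suc_le)

lemma strip_iff:
  assumes "is_partition \<mu>" "is_partition \<nu>"
  shows "strip \<nu> \<mu> \<longleftrightarrow> diagram \<nu> \<subseteq> diagram \<mu> \<and> horizontal_strip (diagram \<mu> - diagram \<nu>)"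
proof -
  have sub: "diagram \<nu> \<subseteq> diagram \<mu> \<longleftrightarrow> (\<forall>r. row \<nu> r \<le> row \<mu> r)"
  proof
    assume s: "diagram \<nu> \<subseteq> diagram \<mu>"
    show "\<forall>r. row \<nu> r \<le> row \<mu> r"
    proof
      fix r
      have "(r, row \<mu> r) \<notin> diagram \<nu>" using s mem_diagram[of r "row \<mu> r" \<mu>] by auto
      then show "row \<nu> r \<le> row \<mu> r" by (simp add: mem_diagram)
    qed
  next
    assume "\<forall>r. row \<nu> r \<le> row \<mu> r"
    then show "diagram \<nu> \<subseteq> diagram \<mu>" by (auto simp: mem_diagram) (meson less_le_trans)
  qed
  have "horizontal_strip (diagram \<mu> - diagram \<nu>) \<longleftrightarrow> (\<forall>r. row \<mu> (Suc r) \<le> row \<nu> r)"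
  proof
    assume h: "horizontal_strip (diagram \<mu> - diagram \<nu>)"
    show "\<forall>r. row \<mu> (Suc r) \<le> row \<nu> r"
    proof (rule ccontr)
      assume "\<not> ?thesis"
      then obtain r where r: "row \<nu> r < row \<mu> (Suc r)" by (auto simp: not_le)
      moreover have "row \<mu> (Suc r) \<le> row \<mu> r" "row \<nu> (Suc r) \<le> row \<nu> r"
        using assms by (simp_all add: row_Suc_le)
      ultimately have *: "(r, row \<nu> r) \<in> diagram \<mu> - diagram \<nu>" "(Suc r, row \<nu> r) \<in> diagram \<mu> - diagram \<nu>"
        by (auto simp: mem_diagram)
      from h[unfolded horizontal_strip_def, rule_format, OF *] show False by simp
    qed
  next
    assume h: "\<forall>r. row \<mu> (Suc r) \<le> row \<nu> r"
    have no: False if "r < r'" "c < row \<mu> r'" "\<not> c < row \<nu> r" for r r' c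
    proof -
      have "row \<mu> r' \<le> row \<mu> (Suc r)"
        by (rule lift_Suc_antimono_le[of "row \<mu>"]) (use row_Suc_le[OF assms(1)] that(1) in simp_all)
      moreover have "row \<mu> (Suc r) \<le> row \<nu> r" using h by blast
      ultimately show False using that(2,3) by linarith
    qed
    show "horizontal_strip (diagram \<mu> - diagram \<nu>)"
      unfolding horizontal_strip_def mem_diagram Diff_iff
    proof (intro allI impI)
      fix r r' c
      assume a: "c < row \<mu> r \<and> \<not> c < row \<nu> r" "c < row \<mu> r' \<and> \<not> c < row \<nu> r'"
      show "r = r'"
        using no[of r r' c] no[of r' r c] a by (cases r r' rule: linorder_cases) blast+
    qed
  qed
  then show ?thesis unfolding strip_def sub by blast
qed

text \<open>\<open>S'^1\<close> is not stored in the list, so the first step appends a single shape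
  and every later one two. Step 0 is included as the start of inductions: \<open>SSOT 0\<close> has
  the empty list as its only member, with empty final shape.\<close>

definition ssot_extend :: "nat list list \<Rightarrow> nat list \<Rightarrow> nat list \<Rightarrow> nat list list" where
  "ssot_extend S \<nu> \<mu> = (if S = [] then [\<mu>] else S @ [\<nu>, \<mu>])"

lemma SSOT_0: "S \<in> SSOT 0 \<mu> \<longleftrightarrow> S = [] \<and> \<mu> = []"
  by (auto simp: SSOT_def ssot_S_def)

lemma SSOT_partition: "S \<in> SSOT i \<kappa> \<Longrightarrow> is_partition \<kappa>"
  by (cases i) (auto simp: SSOT_0, auto simp: SSOT_def ssot_S_def)

lemma ssot_extend_nth:
  assumes S: "S \<in> SSOT i \<kappa>" and \<nu>: "i = 0 \<longrightarrow> \<nu> = []"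
  shows "ssot_S (ssot_extend S \<nu> \<mu>) (Suc i) = \<mu>" "ssot_S' (ssot_extend S \<nu> \<mu>) (Suc i) = \<nu>"
    "j \<le> i \<Longrightarrow> ssot_S (ssot_extend S \<nu> \<mu>) j = ssot_S S j"
    "j \<le> i \<Longrightarrow> ssot_S' (ssot_extend S \<nu> \<mu>) j = ssot_S' S j"
proof -
  have len: "length S = 2 * i - 1" using S by (simp add: SSOT_def)
  have "ssot_S (ssot_extend S \<nu> \<mu>) (Suc i) = \<mu> \<and> ssot_S' (ssot_extend S \<nu> \<mu>) (Suc i) = \<nu>
    \<and> (j \<le> i \<longrightarrow> ssot_S (ssot_extend S \<nu> \<mu>) j = ssot_S S j)
    \<and> (j \<le> i \<longrightarrow> ssot_S' (ssot_extend S \<nu> \<mu>) j = ssot_S' S j)"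
  proof (cases i)
    case 0
    then show ?thesis using len \<nu> by (simp add: ssot_extend_def ssot_S_def ssot_S'_def)
  next
    case (Suc n)
    then have ne: "ssot_extend S \<nu> \<mu> = S @ [\<nu>, \<mu>]" using len by (auto simp: ssot_extend_def)
    show ?thesis using len Suc unfolding ne
      by (auto simp: ssot_S_def ssot_S'_def nth_append)
  qed
  then show "ssot_S (ssot_extend S \<nu> \<mu>) (Suc i) = \<mu>" "ssot_S' (ssot_extend S \<nu> \<mu>) (Suc i) = \<nu>"
    "j \<le> i \<Longrightarrow> ssot_S (ssot_extend S \<nu> \<mu>) j = ssot_S S j"
    "j \<le> i \<Longrightarrow> ssot_S' (ssot_extend S \<nu> \<mu>) j = ssot_S' S j" by blast+
qed

lemma ssot_S_last: "S \<in> SSOT i \<kappa> \<Longrightarrow> ssot_S S i = \<kappa>"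
  by (simp add: SSOT_def)

lemma SSOT_strip:
  assumes "S \<in> SSOT i \<mu>"
  shows "j \<in> {1..<i} \<Longrightarrow> strip (ssot_S' S (Suc j)) (ssot_S S j)"
    "j \<in> {1..i} \<Longrightarrow> strip (ssot_S' S j) (ssot_S S j)"
proof -
  have len: "length S = 2 * i - 1" and p: "\<forall>\<nu> \<in> set S. is_partition \<nu>"
    using assms by (simp_all add: SSOT_def)
  have pS: "is_partition (ssot_S S j)" "is_partition (ssot_S' S j)" if "j \<le> i" for j
    using p len that by (auto simp: ssot_S_def ssot_S'_def)
  show "strip (ssot_S' S (Suc j)) (ssot_S S j)" if "j \<in> {1..<i}"
    using that assms strip_iff[OF pS(1) pS(2), of j "Suc j"] by (simp add: SSOT_def)
  show "strip (ssot_S' S j) (ssot_S S j)" if "j \<in> {1..i}"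
    using that assms strip_iff[OF pS(1) pS(2), of j j] by (simp add: SSOT_def)
qed

lemma strip_Nil: "is_partition \<nu> \<Longrightarrow> strip \<nu> [] \<Longrightarrow> \<nu> = []"
  by (rule row_inject) (auto simp: strip_def)

lemma ssot_extend_SSOT:
  assumes S: "S \<in> SSOT i \<kappa>" and p: "is_partition \<nu>" "is_partition \<mu>"
    and st: "strip \<nu> \<kappa>" "strip \<nu> \<mu>"
  shows "ssot_extend S \<nu> \<mu> \<in> SSOT (Suc i) \<mu>"
proof -
  have \<nu>: "i = 0 \<longrightarrow> \<nu> = []" using S st p strip_Nil by (auto simp: SSOT_0)
  note n = ssot_extend_nth[OF S \<nu>, where \<mu> = \<mu>]
  have len: "length S = 2 * i - 1" and pp: "\<forall>\<nu> \<in> set S. is_partition \<nu>"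
    using S by (simp_all add: SSOT_def)
  have p\<kappa>: "is_partition \<kappa>" using S by (rule SSOT_partition)
  have "length (ssot_extend S \<nu> \<mu>) = 2 * Suc i - 1"
    using len by (cases i) (auto simp: ssot_extend_def)
  moreover have "\<forall>\<nu> \<in> set (ssot_extend S \<nu> \<mu>). is_partition \<nu>"
    using pp p by (auto simp: ssot_extend_def)
  moreover have "diagram (ssot_S' (ssot_extend S \<nu> \<mu>) (Suc j)) \<subseteq> diagram (ssot_S (ssot_extend S \<nu> \<mu>) j)
      \<and> horizontal_strip (diagram (ssot_S (ssot_extend S \<nu> \<mu>) j)
          - diagram (ssot_S' (ssot_extend S \<nu> \<mu>) (Suc j)))" if "j \<in> {1..<Suc i}" for j
  proof (cases "j = i")
    case True
    then show ?thesis using n(2) ssot_S_last[OF S] n(3)[of j] strip_iff[OF p\<kappa> p(1)] st by simp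
  next
    case False
    then have j: "j \<in> {1..<i}" "Suc j \<le> i" using that by auto
    then show ?thesis using S n(3)[of j] n(4)[of "Suc j"] by (simp add: SSOT_def)
  qed
  moreover have "diagram (ssot_S' (ssot_extend S \<nu> \<mu>) j) \<subseteq> diagram (ssot_S (ssot_extend S \<nu> \<mu>) j)
      \<and> horizontal_strip (diagram (ssot_S (ssot_extend S \<nu> \<mu>) j)
          - diagram (ssot_S' (ssot_extend S \<nu> \<mu>) j))" if "j \<in> {1..Suc i}" for j
  proof (cases "j = Suc i")
    case True
    then show ?thesis using n(1,2) strip_iff[OF p(2) p(1)] st by simp
  next
    case False
    then have j: "j \<in> {1..i}" using that by auto
    then show ?thesis using S n(3)[of j] n(4)[of j] by (simp add: SSOT_def)
  qed
  ultimately show ?thesis using n(1) unfolding SSOT_def by blast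
qed

lemma SSOT_Suc_cases:
  assumes U: "U \<in> SSOT (Suc i) \<mu>"
  obtains S \<kappa> \<nu> where "U = ssot_extend S \<nu> \<mu>" "S \<in> SSOT i \<kappa>" "is_partition \<nu>"
    "strip \<nu> \<kappa>" "strip \<nu> \<mu>"
proof -
  have len: "length U = Suc (2 * i)" and p: "\<forall>\<nu> \<in> set U. is_partition \<nu>" and last: "U ! (2 * i) = \<mu>"
    using U by (simp_all add: SSOT_def ssot_S_def)
  show ?thesis
  proof (cases i)
    case 0
    then have U1: "U = [\<mu>]" using len last by (cases U) auto
    moreover have "strip (ssot_S' U 1) (ssot_S U 1)" by (rule SSOT_strip(2)[OF U]) simp
    then have "strip [] \<mu>" using U1 by (simp add: ssot_S_def ssot_S'_def)
    ultimately show ?thesis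
      using that[of "[]" "[]" "[]"] 0 by (simp add: ssot_extend_def SSOT_0 strip_refl)
  next
    case (Suc n)
    define S where "S = take (2 * i - 1) U"
    define \<nu> where "\<nu> = U ! (2 * i - 1)"
    have lenS: "length S = 2 * i - 1" using len by (simp add: S_def)
    have "U = S @ [\<nu>, \<mu>]"
    proof (rule nth_equalityI)
      show "length U = length (S @ [\<nu>, \<mu>])" using len lenS Suc by simp
      fix j assume j: "j < length U"
      then consider "j < 2 * i - 1" | "j = 2 * i - 1" | "j = 2 * i" using len by linarith
      then show "U ! j = (S @ [\<nu>, \<mu>]) ! j"
      proof cases
        case 3
        then show ?thesis using lenS last Suc by (simp add: nth_append)
      qed (use lenS in \<open>simp_all add: nth_append S_def \<nu>_def\<close>)
    qed
    moreover have "S \<noteq> []" using lenS Suc by auto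
    ultimately have ext: "U = ssot_extend S \<nu> \<mu>" by (simp add: ssot_extend_def)
    have eq: "ssot_S U j = ssot_S S j" "ssot_S' U j = ssot_S' S j" if "j \<le> i" for j
      using \<open>U = S @ [\<nu>, \<mu>]\<close> lenS that Suc by (auto simp: ssot_S_def ssot_S'_def nth_append)
    define \<kappa> where "\<kappa> = ssot_S S i"
    have hU: "\<forall>j \<in> {1..<Suc i}. diagram (ssot_S' U (Suc j)) \<subseteq> diagram (ssot_S U j)
        \<and> horizontal_strip (diagram (ssot_S U j) - diagram (ssot_S' U (Suc j)))"
      "\<forall>j \<in> {1..Suc i}. diagram (ssot_S' U j) \<subseteq> diagram (ssot_S U j)
        \<and> horizontal_strip (diagram (ssot_S U j) - diagram (ssot_S' U j))"
      using U unfolding SSOT_def by blast+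
    have "diagram (ssot_S' S (Suc j)) \<subseteq> diagram (ssot_S S j)
        \<and> horizontal_strip (diagram (ssot_S S j) - diagram (ssot_S' S (Suc j)))" if "j \<in> {1..<i}" for j
      using bspec[OF hU(1), of j] that eq(1)[of j] eq(2)[of "Suc j"] by simp
    moreover have "diagram (ssot_S' S j) \<subseteq> diagram (ssot_S S j)
        \<and> horizontal_strip (diagram (ssot_S S j) - diagram (ssot_S' S j))" if "j \<in> {1..i}" for j
      using bspec[OF hU(2), of j] that eq(1)[of j] eq(2)[of j] by simp
    moreover have "\<forall>\<nu> \<in> set S. is_partition \<nu>" using p \<open>U = S @ [\<nu>, \<mu>]\<close> by simp
    ultimately have "S \<in> SSOT i \<kappa>"
      using lenS unfolding SSOT_def \<kappa>_def by blast
    moreover have "is_partition \<nu>" using p len Suc by (simp add: \<nu>_def)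
    moreover have "ssot_S' U (Suc i) = \<nu>" "ssot_S U (Suc i) = \<mu>"
      using last Suc by (simp_all add: ssot_S'_def \<nu>_def ssot_S_def)
    moreover have "strip (ssot_S' U (Suc i)) (ssot_S U i)" "strip (ssot_S' U (Suc i)) (ssot_S U (Suc i))"
      using SSOT_strip[OF U] Suc by simp_all
    ultimately show ?thesis using that[OF ext] eq(1)[of i] by (simp add: \<kappa>_def)
  qed
qed

text \<open>A step adds at most one row, because a horizontal strip on \<open>\<nu>\<close> reaches
  only one row below it. This confines the deletions of the next step to the first \<open>i\<close>
  rows, where inverse insertions are available.\<close>

lemma SSOT_row: "S \<in> SSOT i \<kappa> \<Longrightarrow> i \<le> r \<Longrightarrow> row \<kappa> r = 0"
proof (induction i arbitrary: S \<kappa> r)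
  case (Suc i)
  from Suc(2) obtain S' \<kappa>' \<nu> where "S' \<in> SSOT i \<kappa>'" "strip \<nu> \<kappa>'" "strip \<nu> \<kappa>"
    by (rule SSOT_Suc_cases)
  moreover obtain q where "r = Suc q" "i \<le> q" using Suc(3) by (cases r) auto
  ultimately show ?case using Suc(1)[of S' \<kappa>' q] unfolding strip_def
    by (metis le_zero_eq)
qed (simp add: SSOT_0)

text \<open>The contribution of one half of step \<open>n\<close>, deletions or additions, to the
  recorded tableau.\<close>

definition marks :: "nat \<Rightarrow> nat list \<Rightarrow> nat list \<Rightarrow> mtableau" where
  "marks n \<mu> \<nu> b = (if b \<in> diagram \<mu> - diagram \<nu> then {#n#} else {#})"

lemma marks_same [simp]: "marks n \<mu> \<mu> b = {#}"
  by (simp add: marks_def)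

lemma ssot_tableau_extend:
  assumes S: "S \<in> SSOT i \<kappa>" and \<nu>: "i = 0 \<longrightarrow> \<nu> = []"
  shows "ssot_tableau (Suc i) (ssot_extend S \<nu> \<mu>) b
    = ssot_tableau i S b + marks (Suc i) \<kappa> \<nu> b + marks (Suc i) \<mu> \<nu> b"
proof -
  note n = ssot_extend_nth[OF S \<nu>, where \<mu> = \<mu>]
  have "(\<Sum>j = 1..i. (if b \<in> diagram (ssot_S (ssot_extend S \<nu> \<mu>) (j - 1))
          - diagram (ssot_S' (ssot_extend S \<nu> \<mu>) j) then {#j#} else {#})
     + (if b \<in> diagram (ssot_S (ssot_extend S \<nu> \<mu>) j)
          - diagram (ssot_S' (ssot_extend S \<nu> \<mu>) j) then {#j#} else {#})) = ssot_tableau i S b"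
    unfolding ssot_tableau_def by (rule sum.cong) (use n(3,4) in auto)
  then show ?thesis
    using n(1,2) ssot_S_last[OF S] n(3)[of i] by (simp add: ssot_tableau_def[of "Suc i"] marks_def add.assoc)
qed

section \<open>Appending a column to an array\<close>

lemma P_seq_append: "j \<le> length w \<Longrightarrow> P_seq (w @ z) j = P_seq w j"
  by (induction j) (auto simp: nth_append)

lemma Q_seq_append: "j \<le> length w \<Longrightarrow> Q_seq (w @ z) j = Q_seq w j"
proof (induction j)
  case (Suc j)
  then show ?case
    using P_seq_append[of j w z] P_seq_append[of "Suc j" w z] by (auto simp: nth_append)
qed simp

lemma P_C_snoc: "P_C (w @ [(u, v)]) = berele_insert (P_C w) v"
  using P_seq_append[of "length w" w "[(u, v)]"] by (simp add: P_C_def)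

lemma Q_C_snoc: "Q_C (w @ [(u, v)]) b
  = (if b \<in> changed_boxes (P_C w) (berele_insert (P_C w) v) then add_mset u (Q_C w b) else Q_C w b)"
  using P_seq_append[of "length w" w "[(u, v)]"] Q_seq_append[of "length w" w "[(u, v)]"]
  by (simp add: P_C_def Q_C_def)

lemma P_C_Nil [simp]: "P_C [] = []" and Q_C_Nil [simp]: "Q_C [] b = {#}"
  by (simp_all add: P_C_def Q_C_def)

definition arrays_upto :: "nat \<Rightarrow> nat \<Rightarrow> two_line set" where
  "arrays_upto k i = {w \<in> arrays k. \<forall>a \<in> set w. fst a \<le> i}"

lemma arrays_snoc: "w @ [(u, v)] \<in> arrays k \<longleftrightarrow> w \<in> arrays k \<and> u \<in> {1..k} \<and> v \<in> letters k
  \<and> (w \<noteq> [] \<longrightarrow> fst (last w) \<le> u \<and> (fst (last w) = u \<longrightarrow> snd (last w) \<le> v))"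
proof -
  have "(\<forall>j. Suc j < length (w @ [a]) \<longrightarrow> P ((w @ [a]) ! j) ((w @ [a]) ! Suc j))
    \<longleftrightarrow> (\<forall>j. Suc j < length w \<longrightarrow> P (w ! j) (w ! Suc j)) \<and> (w \<noteq> [] \<longrightarrow> P (last w) a)" for P a
  proof (cases w rule: rev_cases)
    case (snoc z b)
    show ?thesis
    proof (intro iffI conjI allI impI)
      fix j assume h: "\<forall>j. Suc j < length (w @ [a]) \<longrightarrow> P ((w @ [a]) ! j) ((w @ [a]) ! Suc j)"
      show "P (w ! j) (w ! Suc j)" if "Suc j < length w"
        using h[rule_format, of j] that by (simp add: nth_append)
      show "P (last w) a" using h[rule_format, of "length z"] snoc by (simp add: nth_append)
    next
      fix j assume h: "(\<forall>j. Suc j < length w \<longrightarrow> P (w ! j) (w ! Suc j)) \<and> (w \<noteq> [] \<longrightarrow> P (last w) a)"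
        and j: "Suc j < length (w @ [a])"
      show "P ((w @ [a]) ! j) ((w @ [a]) ! Suc j)"
      proof (cases "Suc j < length w")
        case True
        then show ?thesis using h by (simp add: nth_append)
      next
        case False
        then have "j = length z" using j snoc by simp
        then show ?thesis using h snoc by (simp add: nth_append)
      qed
    qed
  qed simp
  from this[of "(u, v)" "\<lambda>a b. fst a \<le> fst b \<and> (fst a = fst b \<longrightarrow> snd a \<le> snd b)"]
  show ?thesis unfolding arrays_def mem_Collect_eq by auto
qed

lemma Nil_arrays [simp]: "[] \<in> arrays k"
  by (simp add: arrays_def)

lemma arrays_fst_le_last: "w \<in> arrays k \<Longrightarrow> a \<in> set w \<Longrightarrow> fst a \<le> fst (last w)"
proof (induction w rule: rev_induct)
  case (snoc b w)
  then show ?case by (cases b) (force simp: arrays_snoc)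
qed simp

lemma Nil_tableaux: "[] \<in> tableaux k"
  by (simp add: tableaux_def semistandard_from_def king_def)

lemma P_C_tableaux: "w \<in> arrays k \<Longrightarrow> P_C w \<in> tableaux k"
proof (induction w rule: rev_induct)
  case (snoc a w)
  then show ?case
    by (cases a) (auto simp: arrays_snoc P_C_snoc intro: cnt_berele_insert(2))
qed (simp add: Nil_tableaux)

lemma mem_changed_boxes: "(r, c) \<in> changed_boxes T T'
  \<longleftrightarrow> (c < row (shape T) r) \<noteq> (c < row (shape T') r)"
  by (auto simp: changed_boxes_def mem_diagram)

text \<open>The deleted box lies in \<open>\<mu>\<close>, hence in \<open>\<kappa>\<close> but not
  yet in the difference; so it receives exactly one mark in this half step.\<close>

lemma marks_Deleted:
  assumes le: "\<And>r. row \<mu> r \<le> row \<kappa> r" and \<mu>': "row (shape T') = shift (Deleted q) (row (shape T))"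
    and pos: "0 < row (shape T) q" and \<mu>: "\<mu> = shape T"
  shows "marks n \<kappa> (shape T') b
    = (if b \<in> changed_boxes T T' then add_mset n (marks n \<kappa> \<mu> b) else marks n \<kappa> \<mu> b)"
proof (cases b)
  case (Pair r c)
  then show ?thesis using le[of r] pos unfolding \<mu>
    by (cases "r = q") (auto simp: marks_def mem_changed_boxes mem_diagram \<mu>')
qed

lemma marks_Added:
  assumes le: "\<And>r. row \<nu> r \<le> row \<mu> r" and \<mu>': "row (shape T') = shift (Added q) (row (shape T))"
    and \<mu>: "\<mu> = shape T"
  shows "marks n (shape T') \<nu> b
    = (if b \<in> changed_boxes T T' then add_mset n (marks n \<mu> \<nu> b) else marks n \<mu> \<nu> b)"
proof (cases b)
  case (Pair r c)
  then show ?thesis using le[of r] unfolding \<mu>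
    by (cases "r = q") (auto simp: marks_def mem_changed_boxes mem_diagram \<mu>')
qed

section \<open>The recording tableau\<close>

lemma arrays_upto_snoc: "w @ [(u, v)] \<in> arrays_upto k i \<Longrightarrow> w \<in> arrays_upto k i"
  by (auto simp: arrays_upto_def arrays_snoc)

definition last_change :: "nat \<Rightarrow> two_line \<Rightarrow> state" where
  "last_change k w = change k (P_C (butlast w)) (snd (last w))"

text \<open>
  The last insertion of an array is determined by the shapes \<open>\<kappa> \<supseteq> \<nu> \<subseteq> \<mu>\<close> of its last step: deletions
  proceed downwards and additions upwards, so it acts on the lowest row that has been shortened or on the
  topmost row that has been lengthened.
\<close>
definition last_step :: "nat \<Rightarrow> nat \<Rightarrow> two_line \<Rightarrow> nat list \<Rightarrow> nat list \<Rightarrow> bool" where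
  "last_step k i w \<kappa> \<nu> \<longleftrightarrow>
    (if w = [] \<or> fst (last w) \<le> i then \<kappa> = \<nu> \<and> shape (P_C w) = \<nu>
     else case last_change k w of
       Deleted q \<Rightarrow> shape (P_C w) = \<nu> \<and> row \<nu> q < row \<kappa> q \<and> (\<forall>r > q. row \<kappa> r = row \<nu> r)
     | Added q \<Rightarrow> row \<nu> q < row (shape (P_C w)) q \<and> (\<forall>r < q. row (shape (P_C w)) r = row \<nu> r)
     | _ \<Rightarrow> False)"

text \<open>The invariant while the columns of step \<open>Suc i\<close> are inserted:
  \<open>\<kappa>\<close> is the shape before the step, \<open>\<nu>\<close> the smallest shape
  reached so far, and the shape of \<open>P_C w\<close> the current one. As long as boxes are
  deleted, \<open>\<nu>\<close> follows the current shape; afterwards it is fixed.\<close>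

definition block :: "nat \<Rightarrow> nat \<Rightarrow> two_line \<Rightarrow> nat list list \<Rightarrow> nat list \<Rightarrow> nat list \<Rightarrow> bool" where
  "block k i w S \<kappa> \<nu> \<longleftrightarrow> S \<in> SSOT i \<kappa> \<and> is_partition \<nu> \<and> strip \<nu> \<kappa> \<and> strip \<nu> (shape (P_C w))
     \<and> (\<forall>b. Q_C w b = ssot_tableau i S b + marks (Suc i) \<kappa> \<nu> b + marks (Suc i) (shape (P_C w)) \<nu> b)
     \<and> last_step k i w \<kappa> \<nu>"

lemma last_change_cases:
  assumes "w \<in> arrays k" "w \<noteq> []"
  obtains r where "last_change k w = Added r" | r where "last_change k w = Deleted r"
proof -
  obtain z u v where w: "w = z @ [(u, v)]" using assms(2) by (metis rev_exhaust surj_pair)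
  have "z \<in> arrays k" "v \<in> letters k" using assms(1) unfolding w arrays_snoc by blast+
  from change_cases[OF P_C_tableaux[OF this(1)] this(2)] show ?thesis
    using that unfolding last_change_def w by auto
qed

lemma in_order_last_change:
  assumes w: "w \<in> arrays k" "w \<noteq> []" and v: "v \<in> letters k"
  shows "snd (last w) \<le> v \<longleftrightarrow> in_order (last_change k w) (change k (P_C w) v)"
proof -
  obtain z a b where wz: "w = z @ [(a, b)]" using w(2) by (metis rev_exhaust surj_pair)
  then have "z \<in> arrays k" "b \<in> letters k" using w(1) by (simp_all add: arrays_snoc)
  then show ?thesis
    using le_iff_in_order[OF P_C_tableaux, of z k b v] v by (simp add: wz last_change_def P_C_snoc)
qed

lemma block_idle:
  assumes S: "S \<in> SSOT i (shape (P_C w))" and Q: "Q_C w = ssot_tableau i S"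
    and w: "w = [] \<or> fst (last w) \<le> i"
  shows "block k i w S (shape (P_C w)) (shape (P_C w))"
  using S Q w SSOT_partition[OF S] by (simp add: block_def strip_refl last_step_def)

text \<open>A deletion after an addition would be out of order. So at a deletion the current shape
  is still \<open>\<nu>\<close>, which is replaced by the new shape; at an addition
  \<open>\<nu>\<close> is kept.\<close>

lemma block_snoc:
  assumes B: "block k i w S \<kappa> \<nu>" and wv: "w @ [(Suc i, v)] \<in> arrays k"
  shows "\<exists>\<nu>. block k i (w @ [(Suc i, v)]) S \<kappa> \<nu>"
proof -
  let ?T = "P_C w" and ?T' = "P_C (w @ [(Suc i, v)])"
  let ?\<mu> = "shape ?T" and ?\<mu>' = "shape ?T'"
  have w: "w \<in> arrays k" and v: "v \<in> letters k"
    and ord: "w \<noteq> [] \<Longrightarrow> \<not> fst (last w) \<le> i \<Longrightarrow> snd (last w) \<le> v"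
    using wv by (auto simp: arrays_snoc)
  have T: "?T \<in> tableaux k" by (rule P_C_tableaux[OF w])
  have T': "?T' \<in> tableaux k" by (rule P_C_tableaux[OF wv])
  have p: "is_partition ?\<mu>" "is_partition ?\<mu>'" using tableaux_shape(1) T T' by blast+
  have S: "S \<in> SSOT i \<kappa>" and \<nu>: "is_partition \<nu>"
    and st: "\<And>r. row \<nu> r \<le> row \<kappa> r" "\<And>r. row \<kappa> (Suc r) \<le> row \<nu> r"
      "\<And>r. row \<nu> r \<le> row ?\<mu> r" "\<And>r. row ?\<mu> (Suc r) \<le> row \<nu> r"
    and Q: "\<And>b. Q_C w b = ssot_tableau i S b + marks (Suc i) \<kappa> \<nu> b + marks (Suc i) ?\<mu> \<nu> b"
    and last: "last_step k i w \<kappa> \<nu>"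
    using B by (auto simp: block_def strip_def)
  have row': "row ?\<mu>' = shift (change k ?T v) (row ?\<mu>)"
    unfolding P_C_snoc by (rule row_shape_berele_insert[OF T v])
  have lc: "last_change k (w @ [(Suc i, v)]) = change k ?T v"
    by (simp add: last_change_def)
  have io: "in_order (last_change k w) (change k ?T v)" if "w \<noteq> []" "\<not> fst (last w) \<le> i"
    using in_order_last_change[OF w that(1) v] ord[OF that] by blast
  have Q': "Q_C (w @ [(Suc i, v)]) b = (if b \<in> changed_boxes ?T ?T' then add_mset (Suc i) (Q_C w b) else Q_C w b)" for b
    unfolding Q_C_snoc P_C_snoc ..
  show ?thesis
  proof (cases rule: change_cases[OF T v])
    case (2 q)
    have *: "?\<mu> = \<nu> \<and> (\<forall>r > q. row \<kappa> r = row \<nu> r)"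
    proof (cases "w = [] \<or> fst (last w) \<le> i")
      case True
      then show ?thesis using last by (simp add: last_step_def)
    next
      case False
      then have "w \<noteq> []" by simp
      from last_change_cases[OF w this] show ?thesis
        using io False last 2(1) by cases (auto simp: last_step_def)
    qed
    then have \<mu>: "?\<mu> = \<nu>" and beyond: "\<And>r. q < r \<Longrightarrow> row \<kappa> r = row \<nu> r" by auto
    have r': "row ?\<mu>' = (row \<nu>)(q := row \<nu> q - 1)" using row' 2(1) \<mu> by simp
    have "strip ?\<mu>' \<kappa>"
      unfolding strip_def
    proof (intro allI conjI)
      fix r
      show "row ?\<mu>' r \<le> row \<kappa> r" using st(1)[of r] by (cases "r = q") (auto simp: r')
      show "row \<kappa> (Suc r) \<le> row ?\<mu>' r"
      proof (cases "r = q")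
        case True
        \<comment> \<open>Below row \<open>q\<close> nothing has been deleted in this step, so the
          strip condition at row \<open>q\<close> reduces to the new shape being a
          partition.\<close>
        have "row \<kappa> (Suc q) = row \<nu> (Suc q)" using beyond by simp
        also have "\<dots> = row ?\<mu>' (Suc q)" by (simp add: r')
        also have "\<dots> \<le> row ?\<mu>' q" by (rule row_Suc_le[OF p(2)])
        finally show ?thesis using True by simp
      qed (use st(2)[of r] in \<open>simp add: r'\<close>)
    qed
    moreover have "last_step k i (w @ [(Suc i, v)]) \<kappa> ?\<mu>'"
    proof -
      have "row ?\<mu>' q < row \<kappa> q" using 2(2) st(1)[of q] \<mu> by (simp add: r')
      moreover have "\<forall>r > q. row \<kappa> r = row ?\<mu>' r" using beyond by (simp add: r')
      ultimately show ?thesis by (simp add: last_step_def lc 2(1))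
    qed
    moreover have "marks (Suc i) \<kappa> ?\<mu>' b = (if b \<in> changed_boxes ?T ?T'
        then add_mset (Suc i) (marks (Suc i) \<kappa> \<nu> b) else marks (Suc i) \<kappa> \<nu> b)" for b
      by (rule marks_Deleted[of _ _ _ q]) (use st(1) \<mu> 2 row' in auto)
    ultimately have "block k i (w @ [(Suc i, v)]) S \<kappa> ?\<mu>'"
      using S p(2) strip_refl[OF p(2)] Q \<mu> by (simp add: block_def Q')
    then show ?thesis by blast
  next
    case (1 q)
    have before: "\<forall>r < q. row ?\<mu> r = row \<nu> r"
    proof (cases "w = [] \<or> fst (last w) \<le> i")
      case True
      then show ?thesis using last by (simp add: last_step_def)
    next
      case False
      then have "w \<noteq> []" by simp
      from last_change_cases[OF w this] show ?thesis
        using io False last 1(1) by cases (auto simp: last_step_def)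
    qed
    have r': "row ?\<mu>' = (row ?\<mu>)(q := Suc (row ?\<mu> q))" using row' 1(1) by simp
    have "strip \<nu> ?\<mu>'"
      unfolding strip_def
    proof (intro allI conjI)
      fix r
      show "row \<nu> r \<le> row ?\<mu>' r" using st(3)[of r] by (cases "r = q") (auto simp: r')
      show "row ?\<mu>' (Suc r) \<le> row \<nu> r"
      proof (cases "Suc r = q")
        case True
        \<comment> \<open>Dually, above row \<open>q\<close> nothing has been added, so the strip
          condition again reduces to the new shape being a partition.\<close>
        have "row ?\<mu>' (Suc r) \<le> row ?\<mu>' r" by (rule row_Suc_le[OF p(2)])
        also have "\<dots> = row \<nu> r" using before True by (simp add: r')
        finally show ?thesis .
      qed (use st(4)[of r] in \<open>simp add: r'\<close>)
    qed
    moreover have "last_step k i (w @ [(Suc i, v)]) \<kappa> \<nu>"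
    proof -
      have "row \<nu> q < row ?\<mu>' q" using st(3)[of q] by (simp add: r')
      moreover have "\<forall>r < q. row ?\<mu>' r = row \<nu> r" using before by (simp add: r')
      ultimately show ?thesis by (simp add: last_step_def lc 1(1))
    qed
    moreover have "marks (Suc i) ?\<mu>' \<nu> b = (if b \<in> changed_boxes ?T ?T'
        then add_mset (Suc i) (marks (Suc i) ?\<mu> \<nu> b) else marks (Suc i) ?\<mu> \<nu> b)" for b
      by (rule marks_Added[of _ _ _ q]) (use st(3) 1 row' in auto)
    ultimately have "block k i (w @ [(Suc i, v)]) S \<kappa> \<nu>"
      using S \<nu> st(1,2) Q by (simp add: block_def Q' strip_def[of \<nu> \<kappa>])
    then show ?thesis by blast
  qed
qed

lemma array_block:
  assumes IH: "\<And>w. w \<in> arrays_upto k i \<Longrightarrow> \<exists>S \<in> SSOT i (shape (P_C w)). Q_C w = ssot_tableau i S"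
  shows "w \<in> arrays_upto k (Suc i) \<Longrightarrow> \<exists>S \<kappa> \<nu>. block k i w S \<kappa> \<nu>"
proof (induction w rule: rev_induct)
  case Nil
  have "[] \<in> arrays_upto k i" by (simp add: arrays_upto_def)
  from IH[OF this] obtain S where "S \<in> SSOT i (shape (P_C []))" "Q_C [] = ssot_tableau i S" by blast
  from block_idle[OF this] show ?case by blast
next
  case (snoc a w)
  obtain u v where a: "a = (u, v)" by fastforce
  note wa = snoc(2)[unfolded a]
  have arr: "w @ [(u, v)] \<in> arrays k" and u: "u \<le> Suc i" using wa by (auto simp: arrays_upto_def)
  show ?case
  proof (cases "u \<le> i")
    case True
    have "fst b \<le> i" if "b \<in> set (w @ [(u, v)])" for b
      using arrays_fst_le_last[OF arr that] True by simp
    then have "w @ [(u, v)] \<in> arrays_upto k i" using arr by (simp add: arrays_upto_def)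
    from IH[OF this] obtain S where "S \<in> SSOT i (shape (P_C (w @ [(u, v)])))"
      "Q_C (w @ [(u, v)]) = ssot_tableau i S" by blast
    from block_idle[OF this] True show ?thesis unfolding a by fastforce
  next
    case False
    then have "u = Suc i" using u by simp
    moreover obtain S \<kappa> \<nu> where "block k i w S \<kappa> \<nu>"
      using snoc(1)[OF arrays_upto_snoc[OF wa]] by blast
    ultimately show ?thesis using block_snoc arr unfolding a by blast
  qed
qed

lemma block_ssot:
  assumes "block k i w S \<kappa> \<nu>" "w \<in> arrays k"
  shows "ssot_extend S \<nu> (shape (P_C w)) \<in> SSOT (Suc i) (shape (P_C w))"
    "Q_C w = ssot_tableau (Suc i) (ssot_extend S \<nu> (shape (P_C w)))"
proof -
  have S: "S \<in> SSOT i \<kappa>" and \<nu>: "is_partition \<nu>" "strip \<nu> \<kappa>" "strip \<nu> (shape (P_C w))"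
    and Q: "\<And>b. Q_C w b = ssot_tableau i S b + marks (Suc i) \<kappa> \<nu> b
      + marks (Suc i) (shape (P_C w)) \<nu> b"
    using assms(1) by (auto simp: block_def)
  have p: "is_partition (shape (P_C w))" using tableaux_shape(1) P_C_tableaux assms(2) by blast
  show "ssot_extend S \<nu> (shape (P_C w)) \<in> SSOT (Suc i) (shape (P_C w))"
    by (rule ssot_extend_SSOT[OF S \<nu>(1) p \<nu>(2,3)])
  have "i = 0 \<longrightarrow> \<nu> = []" using S \<nu> strip_Nil by (auto simp: SSOT_0)
  then show "Q_C w = ssot_tableau (Suc i) (ssot_extend S \<nu> (shape (P_C w)))"
    using Q ssot_tableau_extend[OF S] by auto
qed

lemma array_ssot:
  "w \<in> arrays_upto k i \<Longrightarrow> \<exists>S \<in> SSOT i (shape (P_C w)). Q_C w = ssot_tableau i S"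
proof (induction i arbitrary: w)
  case 0
  have "w = []"
  proof (cases w)
    case (Cons a z)
    then have "fst a \<in> {1..k}" "fst a \<le> 0" using 0 by (auto simp: arrays_upto_def arrays_def)
    then show ?thesis by simp
  qed
  then show ?case by (auto simp: SSOT_0 shape_def ssot_tableau_def)
next
  case (Suc i)
  have arr: "w \<in> arrays k" using Suc(2) by (simp add: arrays_upto_def)
  from array_block[OF Suc(1) Suc(2)] obtain S \<kappa> \<nu> where "block k i w S \<kappa> \<nu>" by blast
  from block_ssot[OF this arr] show ?case by blast
qed

lemma ssot_extend_inject:
  assumes S: "S \<in> SSOT i \<kappa>" "is_partition \<nu>" "strip \<nu> \<kappa>"
    and S': "S' \<in> SSOT i \<kappa>'" "is_partition \<nu>'" "strip \<nu>' \<kappa>'"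
    and eq: "ssot_extend S \<nu> \<mu> = ssot_extend S' \<nu>' \<mu>"
  shows "S = S' \<and> \<kappa> = \<kappa>' \<and> \<nu> = \<nu>'"
proof (cases i)
  case 0
  then show ?thesis using S S' strip_Nil by (auto simp: SSOT_0)
next
  case (Suc n)
  have "length S = 2 * i - 1" "length S' = 2 * i - 1" using S S' by (simp_all add: SSOT_def)
  then have "S = S' \<and> \<nu> = \<nu>'" using eq Suc by (auto simp: ssot_extend_def split: if_splits)
  then show ?thesis using ssot_S_last[OF S(1)] ssot_S_last[OF S'(1)] by simp
qed

text \<open>The three shapes determine the last change: after an addition the current shape exceeds
  \<open>\<nu>\<close>, after a deletion it equals \<open>\<nu>\<close>, and the topmost or lowest
  changed row is unique. If \<open>w'\<close> had no column in step \<open>Suc i\<close>, all three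
  shapes would coincide, which the last change of \<open>w\<close> forbids.\<close>

lemma last_step_inject:
  assumes w: "w \<in> arrays k" "w \<noteq> []" "fst (last w) = Suc i" and w': "w' \<in> arrays k"
    and L: "last_step k i w \<kappa> \<nu>" "last_step k i w' \<kappa> \<nu>" and P: "P_C w = P_C w'"
    and st: "strip \<nu> \<kappa>"
  shows "w' \<noteq> [] \<and> \<not> fst (last w') \<le> i \<and> last_change k w = last_change k w'"
proof -
  let ?\<mu> = "shape (P_C w)"
  have ne: "w' \<noteq> [] \<and> \<not> fst (last w') \<le> i"
  proof (rule ccontr)
    assume "\<not> ?thesis"
    then have eq: "\<kappa> = \<nu>" "?\<mu> = \<nu>" using L(2) P unfolding last_step_def by simp_all
    show False
      by (cases rule: last_change_cases[OF w(1,2)])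
        (use L(1) w(2,3) in \<open>simp_all add: last_step_def eq\<close>)
  qed
  then have ne': "w' \<noteq> []" by simp
  have l: "case last_change k z of
       Deleted q \<Rightarrow> ?\<mu> = \<nu> \<and> row \<nu> q < row \<kappa> q \<and> (\<forall>r > q. row \<kappa> r = row \<nu> r)
     | Added q \<Rightarrow> row \<nu> q < row ?\<mu> q \<and> (\<forall>r < q. row ?\<mu> r = row \<nu> r)
     | _ \<Rightarrow> False" if "z = w \<or> z = w'" for z
    using that
  proof
    assume z: "z = w"
    show ?thesis using L(1) w(2,3) unfolding last_step_def z by simp
  next
    assume z: "z = w'"
    show ?thesis using L(2) ne unfolding last_step_def z P[symmetric] by simp
  qed
  have "last_change k w = last_change k w'"
  proof (cases rule: last_change_cases[OF w(1,2)]; cases rule: last_change_cases[OF w' ne'])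
    fix r q assume a: "last_change k w = Added r" "last_change k w' = Added q"
    have "r = q" using l[of w] l[of w'] a by (cases r q rule: linorder_cases) auto
    then show ?thesis using a by simp
  next
    fix r q assume a: "last_change k w = Deleted r" "last_change k w' = Deleted q"
    have "r = q" using l[of w] l[of w'] a by (cases r q rule: linorder_cases) auto
    then show ?thesis using a by simp
  next
    fix r q assume a: "last_change k w = Added r" "last_change k w' = Deleted q"
    then show ?thesis using l[of w] l[of w'] by simp
  next
    fix r q assume a: "last_change k w = Deleted r" "last_change k w' = Added q"
    then show ?thesis using l[of w] l[of w'] by simp
  qed
  then show ?thesis using ne by blast
qed

text \<open>Last columns are stripped off simultaneously: once both arrays are known to end with the
  same upper entry and the same change of shape, injectivity of a single insertion identifies the
  last letters and the preceding tableaux.\<close>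

lemma Phi_C_inject:
  assumes "w \<in> arrays k" "w' \<in> arrays k" "P_C w = P_C w'" "Q_C w = Q_C w'"
  shows "w = w'"
  using assms
proof (induction "length w + length w'" arbitrary: w w' rule: less_induct)
  case less
  note w = less(2) and w' = less(3) and P = less(4) and Q = less(5)
  show ?case
  proof (cases "w = [] \<and> w' = []")
    case False
    \<comment> \<open>The empty array gets 0, below every upper entry. The last upper entries are
      not yet known to agree, so both arrays are treated as arrays with \<open>Suc i\<close> steps,
      where \<open>Suc i\<close> is the larger of the two values.\<close>
    define n where "n z = (if z = [] then 0 else fst (last z))" for z :: two_line
    have up: "z \<in> arrays_upto k (n z)" if "z \<in> arrays k" for z
      using arrays_fst_le_last[OF that] that by (auto simp: arrays_upto_def n_def)
    have pos: "0 < n z" if "z \<in> arrays k" "z \<noteq> []" for z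
    proof -
      have "last z \<in> set z" using that(2) by simp
      then have "fst (last z) \<in> {1..k}" using that(1) by (auto simp: arrays_def)
      then show ?thesis using that by (simp add: n_def)
    qed
    obtain i where i: "max (n w) (n w') = Suc i"
      using False pos[OF w] pos[OF w'] by (cases "max (n w) (n w')") auto
    have "w \<in> arrays_upto k (Suc i)" "w' \<in> arrays_upto k (Suc i)"
      using up[OF w] up[OF w'] i by (auto simp: arrays_upto_def)
    moreover have "\<exists>S \<kappa> \<nu>. block k i z S \<kappa> \<nu>" if "z \<in> arrays_upto k (Suc i)" for z
      by (rule array_block[OF _ that]) (erule array_ssot)
    ultimately obtain S \<kappa> \<nu> S' \<kappa>' \<nu>' where B: "block k i w S \<kappa> \<nu>" and B': "block k i w' S' \<kappa>' \<nu>'"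
      by meson
    have "ssot_extend S \<nu> (shape (P_C w)) = ssot_extend S' \<nu>' (shape (P_C w))"
      using block_ssot[OF B w] block_ssot[OF B' w'] P Q
      by (intro inj_onD[OF inj_on_ssot_tableau[of "Suc i"]]) auto
    then have "S = S' \<and> \<kappa> = \<kappa>' \<and> \<nu> = \<nu>'"
      using B B' by (intro ssot_extend_inject) (auto simp: block_def)
    then have L: "last_step k i w \<kappa> \<nu>" "last_step k i w' \<kappa> \<nu>" and st: "strip \<nu> \<kappa>"
      using B B' by (auto simp: block_def)
    have "w \<noteq> [] \<and> w' \<noteq> [] \<and> fst (last w) = Suc i \<and> fst (last w') = Suc i
      \<and> last_change k w = last_change k w'"
    proof (cases "n w = Suc i")
      case True
      then have a: "w \<noteq> []" "fst (last w) = Suc i" by (auto simp: n_def split: if_splits)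
      from last_step_inject[OF w a w' L P st] a i show ?thesis by (auto simp: n_def)
    next
      case F: False
      then have "n w' = Suc i" using i by (auto simp: max_def split: if_splits)
      then have a: "w' \<noteq> []" "fst (last w') = Suc i" by (auto simp: n_def split: if_splits)
      from last_step_inject[OF w' a w L(2,1) P[symmetric] st] a i show ?thesis by (auto simp: n_def)
    qed
    then obtain z v z' v' where z: "w = z @ [(Suc i, v)]" "w' = z' @ [(Suc i, v')]"
      and lc: "last_change k w = last_change k w'"
      by (metis append_butlast_last_id prod.collapse)
    have zz: "z \<in> arrays k" "v \<in> letters k" "z' \<in> arrays k" "v' \<in> letters k"
      using w w' unfolding z arrays_snoc by blast+
    have "P_C z = P_C z' \<and> v = v'"
      using berele_insert_inject[OF P_C_tableaux[OF zz(1)] zz(2) P_C_tableaux[OF zz(3)] zz(4)]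
        P lc unfolding z P_C_snoc last_change_def by simp
    moreover have "Q_C z = Q_C z'"
    proof
      fix b
      have "Q_C w b = Q_C w' b" using Q by simp
      then show "Q_C z b = Q_C z' b"
        using \<open>P_C z = P_C z' \<and> v = v'\<close> unfolding z Q_C_snoc by (simp split: if_splits)
    qed
    ultimately show ?thesis using less(1)[of z z'] zz z by simp
  qed simp
qed

section \<open>Surjectivity\<close>

lemma shift_Deleted_inverse:
  "g = shift (Deleted q) h \<Longrightarrow> 0 < h q \<Longrightarrow> h = g(q := Suc (g q))"
  by auto

lemma shift_Added_inverse:
  "g = shift (Added q) h \<Longrightarrow> h = g(q := g q - 1) \<and> 0 < g q"
  by auto

definition gap :: "nat \<Rightarrow> nat list \<Rightarrow> nat list \<Rightarrow> nat" where
  "gap k \<mu> \<nu> = (\<Sum>r<k. row \<mu> r - row \<nu> r)"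

lemma gap_less:
  assumes "\<And>r. row \<mu> r - row \<nu> r \<le> row \<mu>' r - row \<nu>' r" "row \<mu> q - row \<nu> q < row \<mu>' q - row \<nu>' q" "q < k"
  shows "gap k \<mu> \<nu> < gap k \<mu>' \<nu>'"
  unfolding gap_def by (rule sum_strict_mono_ex1) (use assms in auto)

lemma row_beyond: "length \<mu> \<le> r \<Longrightarrow> row \<mu> r = 0"
  by (simp add: row_def)

lemma arrays_upto_append:
  assumes w: "w \<in> arrays_upto k (Suc i)" and i: "Suc i \<le> k" and x: "x \<in> letters k"
    and ord: "w \<noteq> [] \<Longrightarrow> fst (last w) = Suc i \<Longrightarrow> in_order (last_change k w) (change k (P_C w) x)"
  shows "w @ [(Suc i, x)] \<in> arrays_upto k (Suc i)"
proof -
  have arr: "w \<in> arrays k" and le: "\<forall>a \<in> set w. fst a \<le> Suc i" using w by (auto simp: arrays_upto_def)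
  have "snd (last w) \<le> x" if "w \<noteq> []" "fst (last w) = Suc i"
    using in_order_last_change[OF arr that(1) x] ord[OF that] by blast
  moreover have "fst (last w) \<le> Suc i" if "w \<noteq> []" using le that by simp
  ultimately show ?thesis using arr le i x by (auto simp: arrays_upto_def arrays_snoc)
qed

text \<open>Deletions are undone from the bottom: \<open>q\<close> is the lowest row in which
  \<open>P\<close> is shorter than \<open>\<kappa>\<close>. An earlier deletion of the same step
  then acts in a row of index at most \<open>q\<close>, so the letters come out in order. The last
  conjunct hands on the information needed for this check.\<close>

lemma delete_strip:
  assumes i: "Suc i \<le> k" and S: "S \<in> SSOT i \<kappa>"
    and base: "\<And>P. P \<in> tableaux k \<Longrightarrow> shape P = \<kappa> \<Longrightarrow>
      \<exists>w \<in> arrays_upto k i. P_C w = P \<and> Q_C w = ssot_tableau i S"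
  shows "P \<in> tableaux k \<Longrightarrow> strip (shape P) \<kappa> \<Longrightarrow>
    \<exists>w \<in> arrays_upto k (Suc i). P_C w = P
      \<and> (\<forall>b. Q_C w b = ssot_tableau i S b + marks (Suc i) \<kappa> (shape P) b)
      \<and> (w \<noteq> [] \<longrightarrow> fst (last w) = Suc i \<longrightarrow>
          (\<exists>q. last_change k w = Deleted q \<and> row (shape P) q < row \<kappa> q))"
proof (induction "gap k \<kappa> (shape P)" arbitrary: P rule: less_induct)
  case less
  note P = less(2) and st = less(3)
  have p: "is_partition (shape P)" "is_partition \<kappa>"
    using tableaux_shape(1)[OF P] SSOT_partition[OF S] by auto
  show ?case
  proof (cases "row (shape P) = row \<kappa>")
    case True
    then have eq: "shape P = \<kappa>" using row_inject p by blast
    from base[OF P this] obtain w where w: "w \<in> arrays_upto k i" "P_C w = P" "Q_C w = ssot_tableau i S"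
      by blast
    then have "w \<in> arrays_upto k (Suc i)" by (auto simp: arrays_upto_def)
    moreover have "fst (last w) \<noteq> Suc i" if "w \<noteq> []"
    proof -
      have "fst (last w) \<le> i" using w(1) that by (simp add: arrays_upto_def)
      then show ?thesis by simp
    qed
    ultimately show ?thesis using w eq by (intro bexI[of _ w]) auto
  next
    case False
    define D where "D = {r. row (shape P) r < row \<kappa> r}"
    have sub: "D \<subseteq> {..<i}"
    proof
      fix r assume "r \<in> D"
      then have "row \<kappa> r \<noteq> 0" by (simp add: D_def)
      then show "r \<in> {..<i}" using SSOT_row[OF S, of r] by (cases "i \<le> r") auto
    qed
    then have fin: "finite D" by (rule finite_subset) simp
    have "D \<noteq> {}"
    proof
      assume "D = {}"
      then have "row (shape P) r = row \<kappa> r" for r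
        using st unfolding D_def strip_def by (metis (mono_tags) empty_Collect_eq le_neq_implies_less)
      then show False using False by blast
    qed
    define q where "q = Max D"
    have qD: "row (shape P) q < row \<kappa> q" using Max_in[OF fin \<open>D \<noteq> {}\<close>] by (simp add: q_def D_def)
    have qmax: "r \<le> q" if "row (shape P) r < row \<kappa> r" for r
      using Max_ge[OF fin, of r] that by (simp add: q_def D_def)
    have qk: "q < k" using Max_in[OF fin \<open>D \<noteq> {}\<close>] sub i by (auto simp: q_def)
    \<comment> \<open>The strip condition bounds \<open>row \<kappa> q\<close> by the length of row
      \<open>q'\<close> of \<open>P\<close>, so a box can be restored in row
      \<open>q\<close>.\<close>
    have "row (shape P) q < row (shape P) q'" if "q = Suc q'" for q'
      using st qD that unfolding strip_def by (metis less_le_trans)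
    then obtain T x where T: "T \<in> tableaux k" "x \<in> letters k" "berele_insert T x = P"
      "change k T x = Deleted q"
      using berele_insert_surj[OF P, of "Deleted q" q] qk by blast
    have pos: "0 < row (shape T) q"
      by (cases rule: change_cases[OF T(1,2)]) (use T(4) in auto)
    have rT: "row (shape T) = (row (shape P))(q := Suc (row (shape P) q))"
      using shift_Deleted_inverse[of "row (shape P)" q "row (shape T)"] pos row_shape_berele_insert[OF T(1,2)] T(3,4) by simp
    have "strip (shape T) \<kappa>"
      unfolding strip_def
    proof (intro allI conjI)
      fix r
      show "row (shape T) r \<le> row \<kappa> r" using st qD unfolding rT strip_def by simp
      have "row \<kappa> (Suc r) \<le> row (shape P) r" using st by (simp add: strip_def)
      then show "row \<kappa> (Suc r) \<le> row (shape T) r" unfolding rT by (cases "r = q") auto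
    qed
    moreover have "gap k \<kappa> (shape T) < gap k \<kappa> (shape P)"
      by (rule gap_less[of _ _ _ _ q]) (use qD qk in \<open>auto simp: rT\<close>)
    ultimately obtain w where w: "w \<in> arrays_upto k (Suc i)" "P_C w = T"
      and Q: "\<And>b. Q_C w b = ssot_tableau i S b + marks (Suc i) \<kappa> (shape T) b"
      and last: "w \<noteq> [] \<Longrightarrow> fst (last w) = Suc i \<Longrightarrow>
          \<exists>q. last_change k w = Deleted q \<and> row (shape T) q < row \<kappa> q"
      using less(1) T(1) by blast
    have "in_order (last_change k w) (change k (P_C w) x)" if ne: "w \<noteq> []" "fst (last w) = Suc i"
    proof -
      obtain q' where q': "last_change k w = Deleted q'" "row (shape T) q' < row \<kappa> q'"
        using last[OF ne] by blast
      have "row (shape P) q' \<le> row (shape T) q'" unfolding rT by simp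
      then have "q' \<le> q" using qmax[of q'] q'(2) by simp
      then show ?thesis using q'(1) T(4) w(2) by simp
    qed
    then have arr: "w @ [(Suc i, x)] \<in> arrays_upto k (Suc i)"
      by (rule arrays_upto_append[OF w(1) i T(2)])
    have PC: "P_C (w @ [(Suc i, x)]) = P" by (simp add: P_C_snoc w T)
    have m: "marks (Suc i) \<kappa> (shape P) b = (if b \<in> changed_boxes T P
        then add_mset (Suc i) (marks (Suc i) \<kappa> (shape T) b) else marks (Suc i) \<kappa> (shape T) b)" for b
      by (rule marks_Deleted[OF _ _ pos refl])
        (use \<open>strip (shape T) \<kappa>\<close> row_shape_berele_insert[OF T(1,2)] T(3,4) in \<open>auto simp: strip_def\<close>)
    have "Q_C (w @ [(Suc i, x)]) b = ssot_tableau i S b + marks (Suc i) \<kappa> (shape P) b" for b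
      unfolding Q_C_snoc w(2) T(3) Q m by simp
    moreover have "last_change k (w @ [(Suc i, x)]) = Deleted q"
      by (simp add: last_change_def w T)
    ultimately show ?thesis using arr PC qD by (intro bexI[OF _ arr]) auto
  qed
qed

text \<open>Additions are undone from the top until the shape is \<open>\<nu>\<close>, where
  \<open>delete_strip\<close> takes over. A deletion followed by an addition is always in order, so
  the last conjunct records a row bound only for additions.\<close>

lemma add_strip:
  assumes i: "Suc i \<le> k" and S: "S \<in> SSOT i \<kappa>" and \<nu>: "is_partition \<nu>" "strip \<nu> \<kappa>"
    and base: "\<And>P. P \<in> tableaux k \<Longrightarrow> shape P = \<kappa> \<Longrightarrow>
      \<exists>w \<in> arrays_upto k i. P_C w = P \<and> Q_C w = ssot_tableau i S"
  shows "P \<in> tableaux k \<Longrightarrow> strip \<nu> (shape P) \<Longrightarrow>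
    \<exists>w \<in> arrays_upto k (Suc i). P_C w = P
      \<and> (\<forall>b. Q_C w b = ssot_tableau i S b + marks (Suc i) \<kappa> \<nu> b + marks (Suc i) (shape P) \<nu> b)
      \<and> (w \<noteq> [] \<longrightarrow> fst (last w) = Suc i \<longrightarrow>
          (\<exists>q. last_change k w = Deleted q
            \<or> last_change k w = Added q \<and> row \<nu> q < row (shape P) q))"
proof (induction "gap k (shape P) \<nu>" arbitrary: P rule: less_induct)
  case less
  note P = less(2) and st = less(3)
  have p: "is_partition (shape P)" "length (shape P) \<le> k"
    using tableaux_shape[OF P] by auto
  show ?case
  proof (cases "row (shape P) = row \<nu>")
    case True
    then have eq: "shape P = \<nu>" using row_inject p(1) \<nu>(1) by blast
    have "\<exists>w \<in> arrays_upto k (Suc i). P_C w = P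
      \<and> (\<forall>b. Q_C w b = ssot_tableau i S b + marks (Suc i) \<kappa> (shape P) b)
      \<and> (w \<noteq> [] \<longrightarrow> fst (last w) = Suc i \<longrightarrow>
          (\<exists>q. last_change k w = Deleted q \<and> row (shape P) q < row \<kappa> q))"
      using \<nu>(2) eq by (intro delete_strip[OF i S base P]) auto
    then show ?thesis unfolding eq by fastforce
  next
    case False
    have ex: "\<exists>r. row \<nu> r < row (shape P) r"
    proof (rule ccontr)
      assume "\<not> ?thesis"
      then have "row (shape P) r = row \<nu> r" for r
        using st unfolding strip_def by (metis le_neq_implies_less)
      then show False using False by blast
    qed
    define q where "q = (LEAST r. row \<nu> r < row (shape P) r)"
    have qD: "row \<nu> q < row (shape P) q" using LeastI_ex[OF ex] by (simp add: q_def)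
    have qmin: "q \<le> r" if "row \<nu> r < row (shape P) r" for r
      unfolding q_def using that by (rule Least_le)
    have qk: "q < k" using qD row_beyond[of "shape P" q] p(2) by (cases "q < k") auto
    have "row (shape P) (Suc q) \<le> row \<nu> q" using st by (simp add: strip_def)
    then have "row (shape P) (Suc q) < row (shape P) q" using qD by simp
    then obtain T x where T: "T \<in> tableaux k" "x \<in> letters k" "berele_insert T x = P"
      "change k T x = Added q"
      using berele_insert_surj[OF P, of "Added q" q] by blast
    have rT: "row (shape T) = (row (shape P))(q := row (shape P) q - 1)"
      using shift_Added_inverse[of "row (shape P)" q "row (shape T)"] row_shape_berele_insert[OF T(1,2)] T(3,4) by simp
    have stT: "strip \<nu> (shape T)"
      unfolding strip_def
    proof (intro allI conjI)
      fix r
      have "row \<nu> r \<le> row (shape P) r" using st by (simp add: strip_def)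
      then show "row \<nu> r \<le> row (shape T) r" using qD unfolding rT by (cases "r = q") auto
      have "row (shape P) (Suc r) \<le> row \<nu> r" using st by (simp add: strip_def)
      then show "row (shape T) (Suc r) \<le> row \<nu> r" unfolding rT by (cases "Suc r = q") auto
    qed
    moreover have "gap k (shape T) \<nu> < gap k (shape P) \<nu>"
      by (rule gap_less[of _ _ _ _ q]) (use qD qk in \<open>auto simp: rT\<close>)
    ultimately obtain w where w: "w \<in> arrays_upto k (Suc i)" "P_C w = T"
      and Q: "\<And>b. Q_C w b = ssot_tableau i S b + marks (Suc i) \<kappa> \<nu> b + marks (Suc i) (shape T) \<nu> b"
      and last: "w \<noteq> [] \<Longrightarrow> fst (last w) = Suc i \<Longrightarrow>
          \<exists>q. last_change k w = Deleted q \<or> last_change k w = Added q \<and> row \<nu> q < row (shape T) q"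
      using less(1) T(1) by blast
    have "in_order (last_change k w) (change k (P_C w) x)" if ne: "w \<noteq> []" "fst (last w) = Suc i"
    proof -
      obtain q' where "last_change k w = Deleted q'
          \<or> last_change k w = Added q' \<and> row \<nu> q' < row (shape T) q'"
        using last[OF ne] by blast
      then show ?thesis
      proof
        assume "last_change k w = Deleted q'"
        then show ?thesis using T(4) w(2) by simp
      next
        assume a: "last_change k w = Added q' \<and> row \<nu> q' < row (shape T) q'"
        have "row (shape T) q' \<le> row (shape P) q'" unfolding rT by simp
        then have "q \<le> q'" using qmin[of q'] a by simp
        then show ?thesis using a T(4) w(2) by simp
      qed
    qed
    then have arr: "w @ [(Suc i, x)] \<in> arrays_upto k (Suc i)"
      by (rule arrays_upto_append[OF w(1) i T(2)])
    have PC: "P_C (w @ [(Suc i, x)]) = P" by (simp add: P_C_snoc w T)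
    have m: "marks (Suc i) (shape P) \<nu> b = (if b \<in> changed_boxes T P
        then add_mset (Suc i) (marks (Suc i) (shape T) \<nu> b) else marks (Suc i) (shape T) \<nu> b)" for b
      by (rule marks_Added[OF _ _ refl])
        (use stT row_shape_berele_insert[OF T(1,2)] T(3,4) in \<open>auto simp: strip_def\<close>)
    have "Q_C (w @ [(Suc i, x)]) b
      = ssot_tableau i S b + marks (Suc i) \<kappa> \<nu> b + marks (Suc i) (shape P) \<nu> b" for b
      unfolding Q_C_snoc w(2) T(3) Q m by simp
    moreover have "last_change k (w @ [(Suc i, x)]) = Added q"
      by (simp add: last_change_def w T)
    ultimately show ?thesis using arr PC qD by (intro bexI[OF _ arr]) auto
  qed
qed

lemma ssot_array:
  "i \<le> k \<Longrightarrow> P \<in> tableaux k \<Longrightarrow> S \<in> SSOT i (shape P) \<Longrightarrow>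
    \<exists>w \<in> arrays_upto k i. P_C w = P \<and> Q_C w = ssot_tableau i S"
proof (induction i arbitrary: P S)
  case 0
  then have "S = []" "P = []" by (auto simp: SSOT_0 shape_def)
  then show ?case
    by (intro bexI[of _ "[]"]) (auto simp: ssot_tableau_def arrays_upto_def)
next
  case (Suc i)
  from Suc(4) obtain S0 \<kappa> \<nu> where S: "S = ssot_extend S0 \<nu> (shape P)" "S0 \<in> SSOT i \<kappa>"
    and \<nu>: "is_partition \<nu>" "strip \<nu> \<kappa>" "strip \<nu> (shape P)"
    by (rule SSOT_Suc_cases)
  have "\<exists>w \<in> arrays_upto k i. P_C w = P' \<and> Q_C w = ssot_tableau i S0"
    if "P' \<in> tableaux k" "shape P' = \<kappa>" for P'
    using Suc(1)[OF _ that(1)] Suc(2) S(2) that(2) by simp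
  from add_strip[OF Suc(2) S(2) \<nu>(1,2) this Suc(3) \<nu>(3)]
  obtain w where w: "w \<in> arrays_upto k (Suc i)" "P_C w = P"
    "\<And>b. Q_C w b = ssot_tableau i S0 b + marks (Suc i) \<kappa> \<nu> b + marks (Suc i) (shape P) \<nu> b"
    by blast
  have "i = 0 \<longrightarrow> \<nu> = []" using S(2) \<nu> strip_Nil by (auto simp: SSOT_0)
  then have "Q_C w = ssot_tableau (Suc i) S"
    using w(3) ssot_tableau_extend[OF S(2)] unfolding S(1) by auto
  then show ?case using w by blast
qed

theorem theorem4p17:
  fixes k :: nat
  assumes "k \<ge> 1"
  shows "bij_betw Phi_C (arrays k)
    (\<Union>\<mu> \<in> {\<mu>. is_partition \<mu> \<and> length \<mu> \<le> k}. KT k \<mu> \<times> ssot_tableau k ` SSOT k \<mu>)"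
  unfolding bij_betw_def
proof
  show "inj_on Phi_C (arrays k)"
    by (rule inj_onI) (auto simp: Phi_C_def intro: Phi_C_inject)
  have upto: "arrays_upto k k = arrays k" by (auto simp: arrays_upto_def arrays_def)
  show "Phi_C ` arrays k
    = (\<Union>\<mu> \<in> {\<mu>. is_partition \<mu> \<and> length \<mu> \<le> k}. KT k \<mu> \<times> ssot_tableau k ` SSOT k \<mu>)"
  proof (intro equalityI subsetI)
    fix z assume "z \<in> Phi_C ` arrays k"
    then obtain w where w: "w \<in> arrays k" "z = (P_C w, Q_C w)" by (auto simp: Phi_C_def)
    obtain S where S: "S \<in> SSOT k (shape (P_C w))" "Q_C w = ssot_tableau k S"
      using array_ssot[of w k k] w(1) upto by auto
    note T = P_C_tableaux[OF w(1)]
    note sh = tableaux_shape[OF T]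
    have "P_C w \<in> KT k (shape (P_C w))" using KT_eq[OF sh(1)] T by blast
    then show "z \<in> (\<Union>\<mu> \<in> {\<mu>. is_partition \<mu> \<and> length \<mu> \<le> k}. KT k \<mu> \<times> ssot_tableau k ` SSOT k \<mu>)"
      using sh S w(2) by blast
  next
    fix z
    assume "z \<in> (\<Union>\<mu> \<in> {\<mu>. is_partition \<mu> \<and> length \<mu> \<le> k}. KT k \<mu> \<times> ssot_tableau k ` SSOT k \<mu>)"
    then obtain \<mu> P S where \<mu>: "is_partition \<mu>" "P \<in> KT k \<mu>" "S \<in> SSOT k \<mu>" "z = (P, ssot_tableau k S)"
      by blast
    then have P: "P \<in> tableaux k" "shape P = \<mu>" using KT_eq by blast+
    then obtain w where "w \<in> arrays k" "P_C w = P" "Q_C w = ssot_tableau k S"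
      using ssot_array[of k k P S] \<mu>(3) upto by blast
    then have "Phi_C w = z" using \<mu>(4) by (simp add: Phi_C_def)
    then show "z \<in> Phi_C ` arrays k" using \<open>w \<in> arrays k\<close> by blast
  qed
qed

end
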